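(* Let $\mathcal{C}$ be a skeletally small, idempotent complete triangulated category with suspension $[1]$, and let $\mathcal{X}\subseteq\mathcal{C}$ be a full additive subcategory that is contravariantly finite, rigid and closed under direct summands. Put $\mathcal{N}=\mathcal{X}^{\perp_0}=\{C\in\mathcal{C}\mid\mathcal{C}(X,C)=0\ \forall X\in\mathcal{X}\}$. Then the sequence of abelian groups $$K_0(\mathcal{C}/\mathcal{N})\xrightarrow{\ \theta^R_{\mathcal{N}}\ }K_0(\mathcal{C},\mathbb{E}^R_{\mathcal{N}},\mathfrak{s}^R_{\mathcal{N}})\xrightarrow{\ \pi^R_{\mathcal{N}}\ }K_0(\mathcal{C})\longrightarrow 0$$ is exact.
   Context: Subcategories are full and closed under isomorphisms. $\mathcal{X}$ is rigid if $\mathcal{C}(X,X'[1])=0$ for all $X,X'\in\mathcal{X}$; it is contravariantly finite if every $C\in\mathcal{C}$ admits a right $\mathcal{X}$-approximation. The subcategory $\mathcal{N}=\mathcal{X}^{\perp_0}$ is extension-closed and closed under direct summands. For a subcategory $\mathcal{A}\subseteq\mathcal{C}$, $[\mathcal{A}]$ denotes the ideal of morphisms factoring through an object of $\mathcal{A}$. For $A,C\in\mathcal{C}$ put $\mathbb{E}^L_{\mathcal{N}}(C,A)=\{h\colon C\to A[1]\mid hx\in[\mathcal{N}[1]]\text{ for all }x\colon N\to C,\ N\in\mathcal{N}\}$, $\mathbb{E}^R_{\mathcal{N}}(C,A)=\{h\colon C\to A[1]\mid y\circ h[-1]\in[\mathcal{N}[-1]]\text{ for all }y\colon A\to N,\ N\in\mathcal{N}\}$,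 and $\mathbb{E}_{\mathcal{N}}=\mathbb{E}^L_{\mathcal{N}}\cap\mathbb{E}^R_{\mathcal{N}}$. Each defines an extriangulated structure on $\mathcal{C}$, relative to the triangulated one; in $(\mathcal{C},\mathbb{E}^R_{\mathcal{N}},\mathfrak{s}^R_{\mathcal{N}})$ the conflations are the sequences $A\to B\to C$ that are part of a triangle $A\to B\to C\xrightarrow{h}A[1]$ with $h\in\mathbb{E}^R_{\mathcal{N}}(C,A)$. The group $K_0(\mathcal{C},\mathbb{E}^R_{\mathcal{N}},\mathfrak{s}^R_{\mathcal{N}})$ is the abelian group generated by isomorphism classes of objects of $\mathcal{C}$ modulo $[A]-[B]+[C]$ for all such conflations; $[C]^R_{\mathcal{N}}$ denotes the class of $C$. $K_0(\mathcal{C})$ is the usual Grothendieck group of the triangulated category $\mathcal{C}$, and $\pi^R_{\mathcal{N}}$ is the canonical surjection $[C]^R_{\mathcal{N}}\mapsto[C]$. Let $\mathcal{S}_{\mathcal{N}}$ be the smallest class of morphisms of $\mathcal{C}$ closed under composition and containing (a) every $f$ lying in a triangle $A\xrightarrow{f}B\to C\xrightarrow{h}A[1]$ with $h\in\mathbb{E}_{\mathcal{N}}(C,A)$ and $C\in\mathcal{N}$, and (b) every $g$ lying in a triangle $A\to B\xrightarrow{g}C\xrightarrow{h}A[1]$ with $h\in\mathbb{E}_{\mathcal{N}}(C,A)$ and $A\in\mathcal{N}$. Let $\mathcal{C}/\mathcal{N}$ be the localization of the ideal quotient $\mathcal{C}/[\mathcal{N}]$ at the image of $\mathcal{S}_{\mathcal{N}}$,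 and $Q\colon\mathcal{C}\to\mathcal{C}/\mathcal{N}$ the canonical functor. It is known that $\mathcal{C}/\mathcal{N}$ is an abelian category and $Q$ is cohomological. $K_0(\mathcal{C}/\mathcal{N})$ is the Grothendieck group of this abelian category, and $\theta^R_{\mathcal{N}}$ is the (well-defined) homomorphism given by $\theta^R_{\mathcal{N}}([Q(C)])=[C]^R_{\mathcal{N}}+[C[-1]]^R_{\mathcal{N}}$ for $C\in\mathcal{C}$. *)

theory Defs
  imports "HOL-Algebra.Free_Abelian_Groups" "HOL-Algebra.Exact_Sequence"
begin

section \<open>Categories\<close>

text \<open>
  A category has a set of objects and a set of arrows, so every category below is small.
  \<open>g \<cdot> f\<close> is the composite ``first f, then g''; it is meaningful only for composable arrows.
\<close>

record ('o, 'm) cat =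
  Ob :: "'o set"
  Ar :: "'m set"
  Dom :: "'m \<Rightarrow> 'o"
  Cod :: "'m \<Rightarrow> 'o"
  Idn :: "'o \<Rightarrow> 'm"
  Cmp :: "'m \<Rightarrow> 'm \<Rightarrow> 'm"  (infixr \<open>\<cdot>\<index>\<close> 70)

definition Hom :: "('o, 'm, 'x) cat_scheme \<Rightarrow> 'o \<Rightarrow> 'o \<Rightarrow> 'm set" where
  "Hom C A B = {f \<in> Ar C. Dom C f = A \<and> Cod C f = B}"

locale category =
  fixes C :: "('o, 'm, 'x) cat_scheme" (structure)
  assumes Dom_Ob: "f \<in> Ar C \<Longrightarrow> Dom C f \<in> Ob C"
    and Cod_Ob: "f \<in> Ar C \<Longrightarrow> Cod C f \<in> Ob C"
    and Idn_Hom: "A \<in> Ob C \<Longrightarrow> Idn C A \<in> Hom C A A"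
    and Cmp_Hom: "\<lbrakk>f \<in> Hom C A B; g \<in> Hom C B D\<rbrakk> \<Longrightarrow> g \<cdot> f \<in> Hom C A D"
    and Cmp_Idn: "f \<in> Hom C A B \<Longrightarrow> f \<cdot> Idn C A = f"
    and Idn_Cmp: "f \<in> Hom C A B \<Longrightarrow> Idn C B \<cdot> f = f"
    and Cmp_assoc: "\<lbrakk>f \<in> Hom C A B; g \<in> Hom C B D; h \<in> Hom C D E\<rbrakk>
          \<Longrightarrow> h \<cdot> (g \<cdot> f) = (h \<cdot> g) \<cdot> f"

definition is_iso :: "('o, 'm, 'x) cat_scheme \<Rightarrow> 'm \<Rightarrow> bool" where
  "is_iso C f \<longleftrightarrow> f \<in> Ar C \<and>
     (\<exists>g \<in> Hom C (Cod C f) (Dom C f).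
        g \<cdot>\<^bsub>C\<^esub> f = Idn C (Dom C f) \<and> f \<cdot>\<^bsub>C\<^esub> g = Idn C (Cod C f))"

definition isomorphic :: "('o, 'm, 'x) cat_scheme \<Rightarrow> 'o \<Rightarrow> 'o \<Rightarrow> bool" where
  "isomorphic C A B \<longleftrightarrow> (\<exists>f \<in> Hom C A B. is_iso C f)"

definition zero_object :: "('o, 'm, 'x) cat_scheme \<Rightarrow> 'o \<Rightarrow> bool" where
  "zero_object C Z \<longleftrightarrow> Z \<in> Ob C \<and>
     (\<forall>A \<in> Ob C. (\<exists>!f. f \<in> Hom C A Z) \<and> (\<exists>!f. f \<in> Hom C Z A))"

definition factoring :: "('o, 'm, 'x) cat_scheme \<Rightarrow> 'o set \<Rightarrow> 'm set" where
  "factoring C \<A> = {f \<in> Ar C. \<exists>M \<in> \<A>. \<exists>u \<in> Hom C (Dom C f) M. \<exists>v \<in> Hom C M (Cod C f).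
     f = v \<cdot>\<^bsub>C\<^esub> u}"

definition zero_arrow :: "('o, 'm, 'x) cat_scheme \<Rightarrow> 'm \<Rightarrow> bool" where
  "zero_arrow C f \<longleftrightarrow> f \<in> factoring C {Z. zero_object C Z}"

definition is_kernel :: "('o, 'm, 'x) cat_scheme \<Rightarrow> 'm \<Rightarrow> 'm \<Rightarrow> bool" where
  "is_kernel C k g \<longleftrightarrow> k \<in> Ar C \<and> g \<in> Ar C \<and> Cod C k = Dom C g \<and> zero_arrow C (g \<cdot>\<^bsub>C\<^esub> k) \<and>
     (\<forall>t \<in> Ar C. Cod C t = Dom C g \<and> zero_arrow C (g \<cdot>\<^bsub>C\<^esub> t) \<longrightarrow>
        (\<exists>!u. u \<in> Hom C (Dom C t) (Dom C k) \<and> k \<cdot>\<^bsub>C\<^esub> u = t))"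

definition is_cokernel :: "('o, 'm, 'x) cat_scheme \<Rightarrow> 'm \<Rightarrow> 'm \<Rightarrow> bool" where
  "is_cokernel C c f \<longleftrightarrow> c \<in> Ar C \<and> f \<in> Ar C \<and> Dom C c = Cod C f \<and> zero_arrow C (c \<cdot>\<^bsub>C\<^esub> f) \<and>
     (\<forall>t \<in> Ar C. Dom C t = Cod C f \<and> zero_arrow C (t \<cdot>\<^bsub>C\<^esub> f) \<longrightarrow>
        (\<exists>!u. u \<in> Hom C (Cod C c) (Cod C t) \<and> u \<cdot>\<^bsub>C\<^esub> c = t))"

section \<open>Additive categories\<close>

record ('o, 'm) addcat = "('o, 'm) cat" +
  Add :: "'m \<Rightarrow> 'm \<Rightarrow> 'm"
  Zer :: "'o \<Rightarrow> 'o \<Rightarrow> 'm"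

definition hom_group :: "('o, 'm, 'x) addcat_scheme \<Rightarrow> 'o \<Rightarrow> 'o \<Rightarrow> 'm monoid" where
  "hom_group C A B = \<lparr>carrier = Hom C A B, monoid.mult = Add C, one = Zer C A B\<rparr>"

definition Neg :: "('o, 'm, 'x) addcat_scheme \<Rightarrow> 'm \<Rightarrow> 'm" where
  "Neg C f = inv\<^bsub>hom_group C (Dom C f) (Cod C f)\<^esub> f"

definition is_biproduct :: "('o, 'm, 'x) addcat_scheme \<Rightarrow> 'o \<Rightarrow> 'o \<Rightarrow> 'o \<Rightarrow> bool" where
  "is_biproduct C A B P \<longleftrightarrow> A \<in> Ob C \<and> B \<in> Ob C \<and> P \<in> Ob C \<and>
     (\<exists>i \<in> Hom C A P. \<exists>j \<in> Hom C B P. \<exists>p \<in> Hom C P A. \<exists>q \<in> Hom C P B.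
        p \<cdot>\<^bsub>C\<^esub> i = Idn C A \<and> q \<cdot>\<^bsub>C\<^esub> j = Idn C B \<and>
        p \<cdot>\<^bsub>C\<^esub> j = Zer C B A \<and> q \<cdot>\<^bsub>C\<^esub> i = Zer C A B \<and>
        Add C (i \<cdot>\<^bsub>C\<^esub> p) (j \<cdot>\<^bsub>C\<^esub> q) = Idn C P)"

locale additive_category = category C
  for C :: "('o, 'm, 'x) addcat_scheme" (structure) +
  assumes hom_comm_group: "\<lbrakk>A \<in> Ob C; B \<in> Ob C\<rbrakk> \<Longrightarrow> comm_group (hom_group C A B)"
    and Cmp_Add_right: "\<lbrakk>f \<in> Hom C A B; f' \<in> Hom C A B; g \<in> Hom C B D\<rbrakk>
          \<Longrightarrow> g \<cdot> Add C f f' = Add C (g \<cdot> f) (g \<cdot> f')"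
    and Cmp_Add_left: "\<lbrakk>f \<in> Hom C A B; g \<in> Hom C B D; g' \<in> Hom C B D\<rbrakk>
          \<Longrightarrow> Add C g g' \<cdot> f = Add C (g \<cdot> f) (g' \<cdot> f)"
    and zero_object_ex: "\<exists>Z. zero_object C Z"
    and biproduct_ex: "\<lbrakk>A \<in> Ob C; B \<in> Ob C\<rbrakk> \<Longrightarrow> \<exists>P. is_biproduct C A B P"

definition idempotent_complete :: "('o, 'm, 'x) cat_scheme \<Rightarrow> bool" where
  "idempotent_complete C \<longleftrightarrow>
     (\<forall>A \<in> Ob C. \<forall>e \<in> Hom C A A. e \<cdot>\<^bsub>C\<^esub> e = e \<longrightarrow>
        (\<exists>B \<in> Ob C. \<exists>r \<in> Hom C A B. \<exists>s \<in> Hom C B A.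
           s \<cdot>\<^bsub>C\<^esub> r = e \<and> r \<cdot>\<^bsub>C\<^esub> s = Idn C B))"

section \<open>Triangulated categories\<close>

text \<open>
  The suspension \<open>[1]\<close>, given by \<open>shO\<close> on objects and \<open>shA\<close> on arrows, is only required to
  be an auto-equivalence; \<open>[-1]\<close> is a chosen quasi-inverse \<open>unshO\<close>, \<open>unshA\<close>, with natural
  isomorphisms \<open>unsh_sh A : A[1][-1] \<rightarrow> A\<close> and \<open>sh_unsh A : A[-1][1] \<rightarrow> A\<close>. For an
  automorphism both are identities.  \<open>Tri\<close> is the class of distinguished triangles, an
  element \<open>(f, g, h)\<close> standing for a triangle \<open>A \<rightarrow> B \<rightarrow> D \<rightarrow> A[1]\<close>.
\<close>

record ('o, 'm) tricat = "('o, 'm) addcat" +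
  shO :: "'o \<Rightarrow> 'o"
  shA :: "'m \<Rightarrow> 'm"
  unshO :: "'o \<Rightarrow> 'o"
  unshA :: "'m \<Rightarrow> 'm"
  unsh_sh :: "'o \<Rightarrow> 'm"
  sh_unsh :: "'o \<Rightarrow> 'm"
  Tri :: "('m \<times> 'm \<times> 'm) set"

definition endofunctor :: "('o, 'm, 'x) cat_scheme \<Rightarrow> ('o \<Rightarrow> 'o) \<Rightarrow> ('m \<Rightarrow> 'm) \<Rightarrow> bool" where
  "endofunctor C F\<^sub>o F\<^sub>a \<longleftrightarrow>
     (\<forall>A \<in> Ob C. F\<^sub>o A \<in> Ob C \<and> F\<^sub>a (Idn C A) = Idn C (F\<^sub>o A)) \<and>
     (\<forall>f \<in> Ar C. F\<^sub>a f \<in> Hom C (F\<^sub>o (Dom C f)) (F\<^sub>o (Cod C f))) \<and>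
     (\<forall>f \<in> Ar C. \<forall>g \<in> Ar C. Dom C g = Cod C f \<longrightarrow> F\<^sub>a (g \<cdot>\<^bsub>C\<^esub> f) = F\<^sub>a g \<cdot>\<^bsub>C\<^esub> F\<^sub>a f)"

text \<open>
  In \<open>unsh_sh_adjoint\<close> the equivalence is taken to be an adjoint one; given \<open>unsh_sh\<close>, there is
  always exactly one natural isomorphism \<open>sh_unsh\<close> with this property, so it is no restriction.
\<close>

locale triangulated_category = additive_category C
  for C :: "('o, 'm, 'x) tricat_scheme" (structure) +
  assumes sh_functor: "endofunctor C (shO C) (shA C)"
    and sh_Add: "\<lbrakk>f \<in> Hom C A B; g \<in> Hom C A B\<rbrakk>
          \<Longrightarrow> shA C (Add C f g) = Add C (shA C f) (shA C g)"
    and unsh_functor: "endofunctor C (unshO C) (unshA C)"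
    and unsh_sh_iso: "A \<in> Ob C \<Longrightarrow>
          unsh_sh C A \<in> Hom C (unshO C (shO C A)) A \<and> is_iso C (unsh_sh C A)"
    and unsh_sh_natural: "f \<in> Hom C A B \<Longrightarrow>
          unsh_sh C B \<cdot> unshA C (shA C f) = f \<cdot> unsh_sh C A"
    and sh_unsh_iso: "A \<in> Ob C \<Longrightarrow>
          sh_unsh C A \<in> Hom C (shO C (unshO C A)) A \<and> is_iso C (sh_unsh C A)"
    and sh_unsh_natural: "f \<in> Hom C A B \<Longrightarrow>
          sh_unsh C B \<cdot> shA C (unshA C f) = f \<cdot> sh_unsh C A"
    and unsh_sh_adjoint: "A \<in> Ob C \<Longrightarrow> shA C (unsh_sh C A) = sh_unsh C (shO C A)"
    and Tri_typed: "(f, g, h) \<in> Tri C \<Longrightarrow>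
          f \<in> Ar C \<and> g \<in> Hom C (Cod C f) (Dom C h) \<and> h \<in> Hom C (Cod C g) (shO C (Dom C f))"
    and TR1_iso: "\<lbrakk>(f, g, h) \<in> Tri C;
          f \<in> Hom C A B; g \<in> Hom C B D; h \<in> Hom C D (shO C A);
          f' \<in> Hom C A' B'; g' \<in> Hom C B' D'; h' \<in> Hom C D' (shO C A');
          a \<in> Hom C A A'; b \<in> Hom C B B'; d \<in> Hom C D D';
          is_iso C a; is_iso C b; is_iso C d;
          b \<cdot> f = f' \<cdot> a; d \<cdot> g = g' \<cdot> b; shA C a \<cdot> h = h' \<cdot> d\<rbrakk>
          \<Longrightarrow> (f', g', h') \<in> Tri C"
    and TR1_Idn: "\<lbrakk>A \<in> Ob C; zero_object C Z\<rbrakk>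
          \<Longrightarrow> (Idn C A, Zer C A Z, Zer C Z (shO C A)) \<in> Tri C"
    and TR1_cone: "f \<in> Ar C \<Longrightarrow> \<exists>g h. (f, g, h) \<in> Tri C"
    and TR2: "\<lbrakk>f \<in> Hom C A B; g \<in> Hom C B D; h \<in> Hom C D (shO C A)\<rbrakk>
          \<Longrightarrow> (f, g, h) \<in> Tri C \<longleftrightarrow> (g, h, Neg C (shA C f)) \<in> Tri C"
    and TR3: "\<lbrakk>(f, g, h) \<in> Tri C; (f', g', h') \<in> Tri C;
          a \<in> Hom C (Dom C f) (Dom C f'); b \<in> Hom C (Cod C f) (Cod C f'); b \<cdot> f = f' \<cdot> a\<rbrakk>
          \<Longrightarrow> \<exists>d \<in> Hom C (Cod C g) (Cod C g'). d \<cdot> g = g' \<cdot> b \<and> shA C a \<cdot> h = h' \<cdot> d"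
    and TR4: "\<lbrakk>f \<in> Hom C A B; g \<in> Hom C B D;
          (f, f', f'') \<in> Tri C; (g, g', g'') \<in> Tri C; (g \<cdot> f, k', k'') \<in> Tri C\<rbrakk>
          \<Longrightarrow> \<exists>u \<in> Hom C (Cod C f') (Cod C k'). \<exists>v \<in> Hom C (Cod C k') (Cod C g').
            (u, v, shA C f' \<cdot> g'') \<in> Tri C \<and>
            u \<cdot> f' = k' \<cdot> g \<and> k'' \<cdot> u = f'' \<and> v \<cdot> k' = g' \<and> g'' \<cdot> v = shA C f \<cdot> k''"

section \<open>Subcategories\<close>

text \<open>Full subcategories are given by their sets of objects.\<close>

definition iso_closed :: "('o, 'm, 'x) cat_scheme \<Rightarrow> 'o set \<Rightarrow> bool" where
  "iso_closed C \<X> \<longleftrightarrow> (\<forall>A \<in> \<X>. \<forall>B \<in> Ob C. isomorphic C A B \<longrightarrow> B \<in> \<X>)"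

definition additive_subcategory :: "('o, 'm, 'x) addcat_scheme \<Rightarrow> 'o set \<Rightarrow> bool" where
  "additive_subcategory C \<X> \<longleftrightarrow> \<X> \<subseteq> Ob C \<and> iso_closed C \<X> \<and>
     (\<exists>Z \<in> \<X>. zero_object C Z) \<and>
     (\<forall>A \<in> \<X>. \<forall>B \<in> \<X>. \<forall>P. is_biproduct C A B P \<longrightarrow> P \<in> \<X>)"

definition summand_closed :: "('o, 'm, 'x) addcat_scheme \<Rightarrow> 'o set \<Rightarrow> bool" where
  "summand_closed C \<X> \<longleftrightarrow> (\<forall>A B P. P \<in> \<X> \<and> is_biproduct C A B P \<longrightarrow> A \<in> \<X> \<and> B \<in> \<X>)"

definition right_approximation ::
    "('o, 'm, 'x) cat_scheme \<Rightarrow> 'o set \<Rightarrow> 'm \<Rightarrow> 'o \<Rightarrow> bool" where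
  "right_approximation C \<X> x D \<longleftrightarrow> x \<in> Ar C \<and> Dom C x \<in> \<X> \<and> Cod C x = D \<and>
     (\<forall>X' \<in> \<X>. \<forall>x' \<in> Hom C X' D. \<exists>u \<in> Hom C X' (Dom C x). x' = x \<cdot>\<^bsub>C\<^esub> u)"

definition contravariantly_finite :: "('o, 'm, 'x) cat_scheme \<Rightarrow> 'o set \<Rightarrow> bool" where
  "contravariantly_finite C \<X> \<longleftrightarrow> (\<forall>D \<in> Ob C. \<exists>x. right_approximation C \<X> x D)"

definition rigid :: "('o, 'm, 'x) tricat_scheme \<Rightarrow> 'o set \<Rightarrow> bool" where
  "rigid C \<X> \<longleftrightarrow> (\<forall>X \<in> \<X>. \<forall>X' \<in> \<X>. Hom C X (shO C X') = {Zer C X (shO C X')})"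

definition perp0 :: "('o, 'm, 'x) addcat_scheme \<Rightarrow> 'o set \<Rightarrow> 'o set" where
  "perp0 C \<X> = {D \<in> Ob C. \<forall>X \<in> \<X>. Hom C X D = {Zer C X D}}"

section \<open>Relative extensions\<close>

definition EL :: "('o, 'm, 'x) tricat_scheme \<Rightarrow> 'o set \<Rightarrow> 'o \<Rightarrow> 'o \<Rightarrow> 'm set" where
  "EL C \<N> D A = {h \<in> Hom C D (shO C A).
     \<forall>M \<in> \<N>. \<forall>x \<in> Hom C M D. h \<cdot>\<^bsub>C\<^esub> x \<in> factoring C (shO C ` \<N>)}"

text \<open>
  For \<open>h : D \<rightarrow> A[1]\<close> the arrow \<open>h[-1] : D[-1] \<rightarrow> A\<close> is \<open>unshA h\<close> followed by the
  identification \<open>A[1][-1] \<rightarrow> A\<close>.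
\<close>

definition ER :: "('o, 'm, 'x) tricat_scheme \<Rightarrow> 'o set \<Rightarrow> 'o \<Rightarrow> 'o \<Rightarrow> 'm set" where
  "ER C \<N> D A = {h \<in> Hom C D (shO C A).
     \<forall>M \<in> \<N>. \<forall>y \<in> Hom C A M.
       y \<cdot>\<^bsub>C\<^esub> (unsh_sh C A \<cdot>\<^bsub>C\<^esub> unshA C h) \<in> factoring C (unshO C ` \<N>)}"

definition EN :: "('o, 'm, 'x) tricat_scheme \<Rightarrow> 'o set \<Rightarrow> 'o \<Rightarrow> 'o \<Rightarrow> 'm set" where
  "EN C \<N> D A = EL C \<N> D A \<inter> ER C \<N> D A"

section \<open>Ideal quotients and localizations\<close>

definition ideal_class :: "('o, 'm, 'x) addcat_scheme \<Rightarrow> 'o set \<Rightarrow> 'm \<Rightarrow> 'm set" where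
  "ideal_class C \<A> f =
     {g \<in> Hom C (Dom C f) (Cod C f). Add C g (Neg C f) \<in> factoring C \<A>}"

definition ideal_quotient ::
    "('o, 'm, 'x) addcat_scheme \<Rightarrow> 'o set \<Rightarrow> ('o, 'm set) cat" where
  "ideal_quotient C \<A> =
     \<lparr>Ob = Ob C,
      Ar = ideal_class C \<A> ` Ar C,
      Dom = (\<lambda>F. Dom C (SOME f. f \<in> F)),
      Cod = (\<lambda>F. Cod C (SOME f. f \<in> F)),
      Idn = (\<lambda>A. ideal_class C \<A> (Idn C A)),
      Cmp = (\<lambda>G F. ideal_class C \<A> ((SOME g. g \<in> G) \<cdot>\<^bsub>C\<^esub> (SOME f. f \<in> F)))\<rparr>"

text \<open>
  The localization at \<open>S\<close> is constructed as usual from zigzags: paths of arrows and formal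
  inverses of elements of \<open>S\<close>, listed in the order of traversal, modulo the congruence
  \<open>zigzag_eq\<close>.  An arrow of the localization records source, class of paths, and target.
\<close>

datatype 'm step = Fwd 'm | Bwd 'm

fun zigzag :: "('o, 'm, 'x) cat_scheme \<Rightarrow> 'm set \<Rightarrow> 'o \<Rightarrow> 'm step list \<Rightarrow> 'o \<Rightarrow> bool" where
  "zigzag C S A [] B \<longleftrightarrow> A \<in> Ob C \<and> A = B"
| "zigzag C S A (Fwd f # p) B \<longleftrightarrow> f \<in> Ar C \<and> Dom C f = A \<and> zigzag C S (Cod C f) p B"
| "zigzag C S A (Bwd s # p) B \<longleftrightarrow> s \<in> S \<and> s \<in> Ar C \<and> Cod C s = A \<and> zigzag C S (Dom C s) p B"

inductive zigzag_eq ::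
    "('o, 'm, 'x) cat_scheme \<Rightarrow> 'm set \<Rightarrow> 'o \<Rightarrow> 'm step list \<Rightarrow> 'm step list \<Rightarrow> 'o \<Rightarrow> bool"
  for C :: "('o, 'm, 'x) cat_scheme" and S :: "'m set" where
  refl: "zigzag C S A p B \<Longrightarrow> zigzag_eq C S A p p B"
| sym: "zigzag_eq C S A p q B \<Longrightarrow> zigzag_eq C S A q p B"
| trans: "\<lbrakk>zigzag_eq C S A p q B; zigzag_eq C S A q r B\<rbrakk> \<Longrightarrow> zigzag_eq C S A p r B"
| append: "\<lbrakk>zigzag_eq C S A p p' B; zigzag_eq C S B q q' D\<rbrakk>
    \<Longrightarrow> zigzag_eq C S A (p @ q) (p' @ q') D"
| Idn: "A \<in> Ob C \<Longrightarrow> zigzag_eq C S A [Fwd (Idn C A)] [] A"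
| Cmp: "\<lbrakk>f \<in> Hom C A B; g \<in> Hom C B D\<rbrakk>
    \<Longrightarrow> zigzag_eq C S A [Fwd f, Fwd g] [Fwd (g \<cdot>\<^bsub>C\<^esub> f)] D"
| Fwd_Bwd: "\<lbrakk>s \<in> S; s \<in> Hom C A B\<rbrakk> \<Longrightarrow> zigzag_eq C S A [Fwd s, Bwd s] [] A"
| Bwd_Fwd: "\<lbrakk>s \<in> S; s \<in> Hom C A B\<rbrakk> \<Longrightarrow> zigzag_eq C S B [Bwd s, Fwd s] [] B"

definition zigzag_class ::
    "('o, 'm, 'x) cat_scheme \<Rightarrow> 'm set \<Rightarrow> 'o \<Rightarrow> 'm step list \<Rightarrow> 'o
      \<Rightarrow> 'o \<times> 'm step list set \<times> 'o" where
  "zigzag_class C S A p B = (A, {q. zigzag_eq C S A p q B}, B)"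

definition localization ::
    "('o, 'm, 'x) cat_scheme \<Rightarrow> 'm set \<Rightarrow> ('o, 'o \<times> 'm step list set \<times> 'o) cat" where
  "localization C S =
     \<lparr>Ob = Ob C,
      Ar = {zigzag_class C S A p B |A p B. zigzag C S A p B},
      Dom = (\<lambda>(A, P, B). A),
      Cod = (\<lambda>(A, P, B). B),
      Idn = (\<lambda>A. zigzag_class C S A [] A),
      Cmp = (\<lambda>(B', Q, D) (A, P, B).
               zigzag_class C S A ((SOME p. p \<in> P) @ (SOME q. q \<in> Q)) D)\<rparr>"

inductive_set SN :: "('o, 'm, 'x) tricat_scheme \<Rightarrow> 'o set \<Rightarrow> 'm set"
  for C :: "('o, 'm, 'x) tricat_scheme" and \<N> :: "'o set" where
  cone: "\<lbrakk>(f, g, h) \<in> Tri C; h \<in> EN C \<N> (Cod C g) (Dom C f); Cod C g \<in> \<N>\<rbrakk> \<Longrightarrow> f \<in> SN C \<N>"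
| cocone: "\<lbrakk>(f, g, h) \<in> Tri C; h \<in> EN C \<N> (Cod C g) (Dom C f); Dom C f \<in> \<N>\<rbrakk> \<Longrightarrow> g \<in> SN C \<N>"
| comp: "\<lbrakk>f \<in> SN C \<N>; g \<in> SN C \<N>; Dom C g = Cod C f\<rbrakk> \<Longrightarrow> g \<cdot>\<^bsub>C\<^esub> f \<in> SN C \<N>"

text \<open>
  Ideal quotient and localization keep the objects, so the canonical functor
  \<open>Q : C \<rightarrow> C/N\<close> is the identity on objects.
\<close>

definition quotient_category ::
    "('o, 'm, 'x) tricat_scheme \<Rightarrow> 'o set
      \<Rightarrow> ('o, 'o \<times> 'm set step list set \<times> 'o) cat" where
  "quotient_category C \<N> =
     localization (ideal_quotient C \<N>) (ideal_class C \<N> ` SN C \<N>)"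

definition Q_ob :: "('o, 'm, 'x) tricat_scheme \<Rightarrow> 'o set \<Rightarrow> 'o \<Rightarrow> 'o" where
  "Q_ob C \<N> A = A"

section \<open>Grothendieck groups\<close>

text \<open>A set of ``conflations'' enters only through the triples of its objects.\<close>

definition iso_class :: "('o, 'm, 'x) cat_scheme \<Rightarrow> 'o \<Rightarrow> 'o set" where
  "iso_class C A = {B \<in> Ob C. isomorphic C A B}"

definition K0_free :: "('o, 'm, 'x) cat_scheme \<Rightarrow> ('o set \<Rightarrow>\<^sub>0 int) monoid" where
  "K0_free C = free_Abelian_group (iso_class C ` Ob C)"

definition K0_relations ::
    "('o, 'm, 'x) cat_scheme \<Rightarrow> ('o \<times> 'o \<times> 'o) set \<Rightarrow> ('o set \<Rightarrow>\<^sub>0 int) set" where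
  "K0_relations C \<E> = generate (K0_free C)
     {frag_of (iso_class C A) - frag_of (iso_class C B) + frag_of (iso_class C D) |A B D.
        (A, B, D) \<in> \<E>}"

definition K0 ::
    "('o, 'm, 'x) cat_scheme \<Rightarrow> ('o \<times> 'o \<times> 'o) set \<Rightarrow> ('o set \<Rightarrow>\<^sub>0 int) set monoid" where
  "K0 C \<E> = K0_free C Mod K0_relations C \<E>"

definition K0_class ::
    "('o, 'm, 'x) cat_scheme \<Rightarrow> ('o \<times> 'o \<times> 'o) set \<Rightarrow> 'o \<Rightarrow> ('o set \<Rightarrow>\<^sub>0 int) set" where
  "K0_class C \<E> A = K0_relations C \<E> #>\<^bsub>K0_free C\<^esub> frag_of (iso_class C A)"

definition triangles :: "('o, 'm, 'x) tricat_scheme \<Rightarrow> ('o \<times> 'o \<times> 'o) set" where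
  "triangles C = {(Dom C f, Cod C f, Cod C g) |f g h. (f, g, h) \<in> Tri C}"

definition conflations_R :: "('o, 'm, 'x) tricat_scheme \<Rightarrow> 'o set \<Rightarrow> ('o \<times> 'o \<times> 'o) set" where
  "conflations_R C \<N> = {(Dom C f, Cod C f, Cod C g) |f g h.
     (f, g, h) \<in> Tri C \<and> h \<in> ER C \<N> (Cod C g) (Dom C f)}"

definition short_exact_sequences :: "('o, 'm, 'x) cat_scheme \<Rightarrow> ('o \<times> 'o \<times> 'o) set" where
  "short_exact_sequences C = {(Dom C f, Cod C f, Cod C g) |f g.
     is_kernel C f g \<and> is_cokernel C g f}"

definition K0_triangulated ::
    "('o, 'm, 'x) tricat_scheme \<Rightarrow> ('o set \<Rightarrow>\<^sub>0 int) set monoid" where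
  "K0_triangulated C = K0 C (triangles C)"

definition K0_R ::
    "('o, 'm, 'x) tricat_scheme \<Rightarrow> 'o set \<Rightarrow> ('o set \<Rightarrow>\<^sub>0 int) set monoid" where
  "K0_R C \<N> = K0 C (conflations_R C \<N>)"

definition K0_abelian :: "('o, 'm, 'x) cat_scheme \<Rightarrow> ('o set \<Rightarrow>\<^sub>0 int) set monoid" where
  "K0_abelian C = K0 C (short_exact_sequences C)"

definition class_triangulated ::
    "('o, 'm, 'x) tricat_scheme \<Rightarrow> 'o \<Rightarrow> ('o set \<Rightarrow>\<^sub>0 int) set" where
  "class_triangulated C A = K0_class C (triangles C) A"

definition class_R ::
    "('o, 'm, 'x) tricat_scheme \<Rightarrow> 'o set \<Rightarrow> 'o \<Rightarrow> ('o set \<Rightarrow>\<^sub>0 int) set" where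
  "class_R C \<N> A = K0_class C (conflations_R C \<N>) A"

definition class_abelian ::
    "('o, 'm, 'x) cat_scheme \<Rightarrow> 'o \<Rightarrow> ('o set \<Rightarrow>\<^sub>0 int) set" where
  "class_abelian C A = K0_class C (short_exact_sequences C) A"

end

theory Submission
  imports Defs
begin

text \<open>
  Let \<open>H\<close> send an object \<open>A\<close> to the family of groups \<open>Hom X A\<close>, \<open>X \<in> \<X>\<close>. It is cohomological, its
  kernel on objects is \<open>\<N>\<close>, and it vanishes on \<open>\<X>[1]\<close> because \<open>\<X>\<close> is rigid. Hence the cone of a
  right \<open>\<X>\<close>-approximation lies in \<open>\<N>\<close> (\<open>approximation_triangle\<close>), and an arrow is killed by \<open>H\<close> if
  and only if it factors through \<open>\<N>\<close>. It follows that a triangle \<open>A \<rightarrow> B \<rightarrow> D\<close> is a conflation as soon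
  as \<open>H B \<rightarrow> H D\<close> is onto, and that its desuspension \<open>A[-1] \<rightarrow> B[-1] \<rightarrow> D[-1]\<close> is one as soon as
  \<open>H A \<rightarrow> H B\<close> is injective. All computations in \<open>K0_R\<close> rest on these two facts.

  Write \<open>[A] + [A[-1]]\<close> as \<open>theta_gen A\<close>. The two facts show that it is additive on triangles with
  \<open>0 \<rightarrow> H A \<rightarrow> H B \<rightarrow> H D \<rightarrow> 0\<close> exact and that it does not change along an arrow \<open>f\<close> with \<open>H f\<close>
  invertible. Adding an object of \<open>\<N>\<close> to the middle term, one concludes that it is additive on any
  pair of composable arrows that \<open>H\<close> makes short exact (\<open>theta_gen_H_exact\<close>). So \<open>\<theta>\<close> is well defined once isomorphisms and short exact
  sequences of \<open>\<C>/\<N>\<close> are known to come from such arrows of \<open>\<C>\<close>. For this, \<open>H\<close> is extended to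
  zigzags, so that \<open>Q f = Q g\<close> forces \<open>H f = H g\<close> (\<open>Q_eqD\<close>); and each object is replaced, along an
  arrow of \<open>\<S>\<^sub>\<N>\<close>, by a cone of an arrow in \<open>\<X>\<close>, out of which every arrow of \<open>\<C>/\<N>\<close> is the image of
  an arrow of \<open>\<C>\<close> (\<open>liftable_resolution\<close>, \<open>liftable_full\<close>). Kernels and cokernels are then tested
  on objects of \<open>\<X>\<close>.

  The kernel of \<open>\<pi>\<close> is generated by the relations \<open>[A] - [B] + [D]\<close> of all triangles
  \<open>A \<rightarrow> B \<rightarrow> D \<rightarrow> A[1]\<close>. Such a relation measures the failure of \<open>H B \<rightarrow> H D\<close> to be onto: it equals
  \<open>\<theta> [Q I]\<close>, where \<open>I\<close> is the cone of \<open>X\<^sub>B \<rightarrow> B \<rightarrow> D\<close> for an \<open>\<X>\<close>-approximation \<open>X\<^sub>B\<close> of \<open>B\<close>, so that \<open>H I\<close>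
  is the image of \<open>H D \<rightarrow> H (A[1])\<close> (\<open>triangle_relation_eq_theta_gen\<close>). Conversely \<open>\<pi> \<circ> \<theta> = 0\<close> by the
  triangles \<open>A[-1] \<rightarrow> 0 \<rightarrow> A\<close>, and \<open>\<pi>\<close> is onto since both groups have the same generators.
\<close>

section \<open>Generators and relations for Grothendieck groups\<close>

abbreviation gen :: "('o, 'm, 'x) cat_scheme \<Rightarrow> 'o \<Rightarrow> ('o set \<Rightarrow>\<^sub>0 int)" where
  "gen C A \<equiv> frag_of (iso_class C A)"

lemma carrier_K0_free: "x \<in> carrier (K0_free C) \<longleftrightarrow> Poly_Mapping.keys x \<subseteq> iso_class C ` Ob C"
  by (simp add: K0_free_def)

lemma gen_closed: "A \<in> Ob C \<Longrightarrow> gen C A \<in> carrier (K0_free C)"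
  by (simp add: K0_free_def)

lemma comm_group_K0_free: "comm_group (K0_free C)"
  by (simp add: K0_free_def abelian_free_Abelian_group)

lemma group_K0_free: "Group.group (K0_free C)"
  by (simp add: K0_free_def)

lemma K0_free_add_closed:
  "\<lbrakk>x \<in> carrier (K0_free C); y \<in> carrier (K0_free C)\<rbrakk> \<Longrightarrow> x + y \<in> carrier (K0_free C)"
  using keys_add[of x y] by (auto simp: carrier_K0_free)

lemma K0_free_diff_closed:
  "\<lbrakk>x \<in> carrier (K0_free C); y \<in> carrier (K0_free C)\<rbrakk> \<Longrightarrow> x - y \<in> carrier (K0_free C)"
  using keys_diff[of x y] by (auto simp: carrier_K0_free)

lemma K0_free_hom_eq:
  assumes "Group.group G" "h \<in> hom (K0_free C) G" "k \<in> hom (K0_free C) G"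
    and "\<And>A. A \<in> Ob C \<Longrightarrow> h (gen C A) = k (gen C A)"
    and x: "x \<in> carrier (K0_free C)"
  shows "h x = k x"
proof -
  interpret h: group_hom "K0_free C" G h
    using assms group_K0_free by (simp add: group_hom_def group_hom_axioms_def)
  interpret k: group_hom "K0_free C" G k
    using assms group_K0_free by (simp add: group_hom_def group_hom_axioms_def)
  have keys: "Poly_Mapping.keys x \<subseteq> iso_class C ` Ob C" using x by (simp add: carrier_K0_free)
  show ?thesis
  proof (rule free_Abelian_group_induct[OF keys])
    show "h 0 = k 0" using h.hom_one k.hom_one by (simp add: K0_free_def)
  next
    fix y z
    assume y: "Poly_Mapping.keys y \<subseteq> iso_class C ` Ob C" and z: "Poly_Mapping.keys z \<subseteq> iso_class C ` Ob C"
      and "h y = k y" "h z = k z"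
    have yz: "y - z = y \<otimes>\<^bsub>K0_free C\<^esub> inv\<^bsub>K0_free C\<^esub> z" using z by (simp add: K0_free_def)
    have "y \<in> carrier (K0_free C)" "z \<in> carrier (K0_free C)" using y z by (auto simp: carrier_K0_free)
    then show "h (y - z) = k (y - z)"
      unfolding yz using \<open>h y = k y\<close> \<open>h z = k z\<close> by simp
  next
    fix S assume "S \<in> iso_class C ` Ob C"
    then show "h (frag_of S) = k (frag_of S)" using assms(4) by auto
  qed
qed

lemma K0_relations_incl:
  "(A, B, D) \<in> \<E> \<Longrightarrow> gen C A - gen C B + gen C D \<in> K0_relations C \<E>"
  unfolding K0_relations_def by (rule generate.incl) blast

lemma K0_relations_add:
  "\<lbrakk>x \<in> K0_relations C \<E>; y \<in> K0_relations C \<E>\<rbrakk> \<Longrightarrow> x + y \<in> K0_relations C \<E>"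
  using generate.eng[of x "K0_free C" _ y]
  by (simp add: K0_relations_def K0_free_def)

context
  fixes C :: "('o, 'm, 'x) cat_scheme" and \<E> :: "('o \<times> 'o \<times> 'o) set"
  assumes \<E>: "\<E> \<subseteq> Ob C \<times> Ob C \<times> Ob C"
begin

lemma K0_relators_closed:
  "{gen C A - gen C B + gen C D |A B D. (A, B, D) \<in> \<E>} \<subseteq> carrier (K0_free C)"
  using \<E> by (auto intro!: K0_free_add_closed K0_free_diff_closed gen_closed)

lemma subgroup_K0_relations: "subgroup (K0_relations C \<E>) (K0_free C)"
  unfolding K0_relations_def
  by (rule group.generate_is_subgroup[OF group_K0_free K0_relators_closed])

lemma K0_relations_closed: "x \<in> K0_relations C \<E> \<Longrightarrow> x \<in> carrier (K0_free C)"
  using subgroup.subset[OF subgroup_K0_relations] by blast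

lemma K0_relations_zero: "0 \<in> K0_relations C \<E>"
  using subgroup.one_closed[OF subgroup_K0_relations] by (simp add: K0_free_def)

lemma K0_relations_uminus: "x \<in> K0_relations C \<E> \<Longrightarrow> - x \<in> K0_relations C \<E>"
  using subgroup.m_inv_closed[OF subgroup_K0_relations, of x] K0_relations_closed[of x]
  by (simp add: K0_free_def)

lemma K0_relations_diff:
  "\<lbrakk>x \<in> K0_relations C \<E>; y \<in> K0_relations C \<E>\<rbrakk> \<Longrightarrow> x - y \<in> K0_relations C \<E>"
  using K0_relations_add[of x C \<E> "- y"] K0_relations_uminus[of y] by simp

lemma normal_K0_relations: "K0_relations C \<E> \<lhd> K0_free C"
  by (simp add: comm_group.normal_iff_subgroup[OF comm_group_K0_free] subgroup_K0_relations)

lemma comm_group_K0: "comm_group (K0 C \<E>)"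
  unfolding K0_def
  by (rule comm_group.abelian_FactGroup[OF comm_group_K0_free subgroup_K0_relations])

lemma coset_hom: "(\<lambda>x. K0_relations C \<E> #>\<^bsub>K0_free C\<^esub> x) \<in> hom (K0_free C) (K0 C \<E>)"
  unfolding K0_def by (rule normal.r_coset_hom_Mod[OF normal_K0_relations])

lemma carrier_K0:
  "carrier (K0 C \<E>) = (\<lambda>x. K0_relations C \<E> #>\<^bsub>K0_free C\<^esub> x) ` carrier (K0_free C)"
  unfolding K0_def by (rule carrier_FactGroup)

lemma K0_class_closed: "A \<in> Ob C \<Longrightarrow> K0_class C \<E> A \<in> carrier (K0 C \<E>)"
  by (simp add: K0_class_def carrier_K0 gen_closed)

lemma one_K0: "\<one>\<^bsub>K0 C \<E>\<^esub> = K0_relations C \<E>"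
  by (simp add: K0_def)

lemma coset_eq_iff:
  "K0_relations C \<E> #>\<^bsub>K0_free C\<^esub> x = K0_relations C \<E> #>\<^bsub>K0_free C\<^esub> y
    \<longleftrightarrow> x - y \<in> K0_relations C \<E>" (is "?L x = ?L y \<longleftrightarrow> _")
proof -
  have mem: "z \<in> ?L x \<longleftrightarrow> z - x \<in> K0_relations C \<E>" for z x
  proof -
    have "z \<in> ?L x \<longleftrightarrow> (\<exists>r \<in> K0_relations C \<E>. z = r + x)"
      by (auto simp: r_coset_def K0_free_def)
    then show ?thesis by (auto intro: bexI[of _ "z - x"])
  qed
  show ?thesis
  proof
    assume "?L x = ?L y"
    moreover have "x \<in> ?L x" using mem[of x x] K0_relations_zero by simp
    ultimately show "x - y \<in> K0_relations C \<E>" using mem[of x y] by simp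
  next
    assume xy: "x - y \<in> K0_relations C \<E>"
    have "z - x \<in> K0_relations C \<E> \<longleftrightarrow> z - y \<in> K0_relations C \<E>" for z
      using K0_relations_add[OF _ xy, of "z - x"] K0_relations_diff[OF _ xy, of "z - y"] by auto
    then show "?L x = ?L y" using mem by blast
  qed
qed

lemma coset_eq_one_iff:
  "K0_relations C \<E> #>\<^bsub>K0_free C\<^esub> x = \<one>\<^bsub>K0 C \<E>\<^esub> \<longleftrightarrow> x \<in> K0_relations C \<E>"
proof -
  have "K0_relations C \<E> = K0_relations C \<E> #>\<^bsub>K0_free C\<^esub> 0"
    by (auto simp: r_coset_def K0_free_def)
  then show ?thesis using coset_eq_iff[of x 0] by (simp add: one_K0)
qed

lemma coset_add:
  "\<lbrakk>x \<in> carrier (K0_free C); y \<in> carrier (K0_free C)\<rbrakk> \<Longrightarrow>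
    K0_relations C \<E> #>\<^bsub>K0_free C\<^esub> (x + y)
      = (K0_relations C \<E> #>\<^bsub>K0_free C\<^esub> x) \<otimes>\<^bsub>K0 C \<E>\<^esub> (K0_relations C \<E> #>\<^bsub>K0_free C\<^esub> y)"
  using hom_mult[OF coset_hom, of x y] by (simp add: K0_free_def)

lemma coset_mult_eqI:
  assumes "x \<in> carrier (K0_free C)" "y \<in> carrier (K0_free C)" "x - z + y \<in> K0_relations C \<E>"
  shows "(K0_relations C \<E> #>\<^bsub>K0_free C\<^esub> x) \<otimes>\<^bsub>K0 C \<E>\<^esub> (K0_relations C \<E> #>\<^bsub>K0_free C\<^esub> y)
    = K0_relations C \<E> #>\<^bsub>K0_free C\<^esub> z"
proof -
  have "(x + y) - z \<in> K0_relations C \<E>" using assms(3) by (simp add: algebra_simps)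
  then show ?thesis
    unfolding coset_add[OF assms(1,2), symmetric] coset_eq_iff .
qed

lemma K0_class_relation:
  assumes "(A, B, D) \<in> \<E>"
  shows "K0_class C \<E> A \<otimes>\<^bsub>K0 C \<E>\<^esub> K0_class C \<E> D = K0_class C \<E> B"
  unfolding K0_class_def
  by (rule coset_mult_eqI[OF gen_closed gen_closed K0_relations_incl[OF assms]]) (use \<E> assms in auto)

lemma K0_hom_eq:
  assumes "Group.group G" and h: "h \<in> hom (K0 C \<E>) G" and k: "k \<in> hom (K0 C \<E>) G"
    and eq: "\<And>A. A \<in> Ob C \<Longrightarrow> h (K0_class C \<E> A) = k (K0_class C \<E> A)"
    and x: "x \<in> carrier (K0 C \<E>)"
  shows "h x = k x"
proof -
  obtain y where y: "y \<in> carrier (K0_free C)" and x_eq: "x = K0_relations C \<E> #>\<^bsub>K0_free C\<^esub> y"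
    using x by (auto simp: carrier_K0)
  have "(h \<circ> (\<lambda>x. K0_relations C \<E> #>\<^bsub>K0_free C\<^esub> x)) y = (k \<circ> (\<lambda>x. K0_relations C \<E> #>\<^bsub>K0_free C\<^esub> x)) y"
    by (rule K0_free_hom_eq[OF assms(1) hom_compose[OF coset_hom h] hom_compose[OF coset_hom k] _ y])
       (use eq in \<open>simp add: K0_class_def\<close>)
  then show ?thesis by (simp add: x_eq)
qed

lemma K0_universal:
  assumes G: "comm_group G" and f: "\<And>A. A \<in> Ob C \<Longrightarrow> f A \<in> carrier G"
    and iso: "\<And>A B. \<lbrakk>A \<in> Ob C; B \<in> Ob C; iso_class C A = iso_class C B\<rbrakk> \<Longrightarrow> f A = f B"
    and rel: "\<And>A B D. (A, B, D) \<in> \<E> \<Longrightarrow> f A \<otimes>\<^bsub>G\<^esub> f D = f B"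
  shows "\<exists>h \<in> hom (K0 C \<E>) G. \<forall>A \<in> Ob C. h (K0_class C \<E> A) = f A"
proof -
  interpret G: comm_group G by (rule G)
  define f' where "f' S = f (SOME A. A \<in> Ob C \<and> iso_class C A = S)" for S
  have f': "f' (iso_class C A) = f A" if "A \<in> Ob C" for A
  proof -
    have "(SOME B. B \<in> Ob C \<and> iso_class C B = iso_class C A) \<in> Ob C \<and>
          iso_class C (SOME B. B \<in> Ob C \<and> iso_class C B = iso_class C A) = iso_class C A"
      using that by (intro someI[of "\<lambda>B. B \<in> Ob C \<and> iso_class C B = iso_class C A" A]) simp
    then show ?thesis using iso[OF _ that] by (simp add: f'_def)
  qed
  then have "f' ` (iso_class C ` Ob C) \<subseteq> carrier G" using f by auto
  then obtain h where h: "h \<in> hom (K0_free C) G"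
    and h_gen: "\<And>S. S \<in> iso_class C ` Ob C \<Longrightarrow> h (frag_of S) = f' S"
    unfolding K0_free_def by (rule G.free_Abelian_group_universal) blast
  interpret h: group_hom "K0_free C" G h
    using h group_K0_free by (simp add: group_hom_def group_hom_axioms_def)
  have hA: "h (gen C A) = f A" if "A \<in> Ob C" for A using h_gen f' that by simp
  have h_add: "h (x + y) = h x \<otimes>\<^bsub>G\<^esub> h y" if "x \<in> carrier (K0_free C)" "y \<in> carrier (K0_free C)" for x y
    using h.hom_mult[OF that] by (simp add: K0_free_def)
  have rel1: "r \<in> kernel (K0_free C) G h" if "r \<in> K0_relations C \<E>" for r
  proof -
    have "K0_relations C \<E> \<subseteq> kernel (K0_free C) G h"
      unfolding K0_relations_def
    proof (rule h.G.generate_subgroup_incl[OF _ h.subgroup_kernel], safe)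
      fix A B D assume ABD: "(A, B, D) \<in> \<E>"
      then have Ob: "A \<in> Ob C" "B \<in> Ob C" "D \<in> Ob C" using \<E> by auto
      let ?r = "gen C A - gen C B + gen C D"
      have r: "?r \<in> carrier (K0_free C)" using K0_relators_closed ABD by blast
      have "h (?r + gen C B) = h (gen C A + gen C D)" by simp
      then have "h ?r \<otimes>\<^bsub>G\<^esub> f B = f B"
        using h_add[OF r gen_closed[OF Ob(2)]] h_add[OF gen_closed[OF Ob(1)] gen_closed[OF Ob(3)]]
          hA Ob rel[OF ABD] by simp
      then have "h ?r = \<one>\<^bsub>G\<^esub>" using f[OF Ob(2)] h.hom_closed[OF r] by simp
      then show "?r \<in> kernel (K0_free C) G h" using r by (simp add: kernel_def)
    qed
    then show ?thesis using that by blast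
  qed
  have well_defined: "h x = h y"
    if xy: "x \<in> carrier (K0_free C)" "y \<in> carrier (K0_free C)"
      and coset: "K0_relations C \<E> #>\<^bsub>K0_free C\<^esub> x = K0_relations C \<E> #>\<^bsub>K0_free C\<^esub> y" for x y
  proof -
    have "x - y \<in> kernel (K0_free C) G h" using rel1 coset by (simp add: coset_eq_iff)
    then have d: "x - y \<in> carrier (K0_free C)" "h (x - y) = \<one>\<^bsub>G\<^esub>" by (auto simp: kernel_def)
    have "h x = h ((x - y) + y)" by simp
    then show ?thesis using h_add[OF d(1) xy(2)] d(2) xy by simp
  qed
  obtain k where k: "k \<in> hom (K0_free C Mod K0_relations C \<E>) G"
    and k_coset: "\<And>x. x \<in> carrier (K0_free C) \<Longrightarrow> k (K0_relations C \<E> #>\<^bsub>K0_free C\<^esub> x) = h x"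
    using FactGroup_universal[OF h normal_K0_relations well_defined] by metis
  show ?thesis
  proof (intro bexI[of _ k] ballI)
    show "k \<in> hom (K0 C \<E>) G" using k by (simp add: K0_def)
    show "k (K0_class C \<E> A) = f A" if "A \<in> Ob C" for A
      using k_coset[OF gen_closed[OF that]] hA[OF that] by (simp add: K0_class_def)
  qed
qed

end

section \<open>Categories\<close>

lemma HomI: "\<lbrakk>f \<in> Ar C; Dom C f = A; Cod C f = B\<rbrakk> \<Longrightarrow> f \<in> Hom C A B"
  by (simp add: Hom_def)

lemma HomD:
  assumes "f \<in> Hom C A B"
  shows "f \<in> Ar C" "Dom C f = A" "Cod C f = B"
  using assms by (auto simp: Hom_def)

context category
begin

lemma Hom_Ob:
  assumes "f \<in> Hom C A B"
  shows "A \<in> Ob C" "B \<in> Ob C"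
  using assms Dom_Ob Cod_Ob by (auto simp: Hom_def)

lemma is_isoI: "\<lbrakk>f \<in> Hom C A B; g \<in> Hom C B A; g \<cdot> f = Idn C A; f \<cdot> g = Idn C B\<rbrakk> \<Longrightarrow> is_iso C f"
  unfolding is_iso_def using HomD by metis

lemma is_isoE:
  assumes "is_iso C f" "f \<in> Hom C A B"
  obtains g where "g \<in> Hom C B A" "g \<cdot> f = Idn C A" "f \<cdot> g = Idn C B" "is_iso C g"
proof -
  obtain g where g: "g \<in> Hom C B A" "g \<cdot> f = Idn C A" "f \<cdot> g = Idn C B"
    using assms HomD[OF assms(2)] unfolding is_iso_def by auto
  then show thesis using that is_isoI[OF g(1) assms(2)] by simp
qed

lemma is_iso_Idn: "A \<in> Ob C \<Longrightarrow> is_iso C (Idn C A)"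
  using is_isoI[OF Idn_Hom Idn_Hom Cmp_Idn[OF Idn_Hom] Cmp_Idn[OF Idn_Hom]] .

lemma is_iso_Cmp:
  assumes "f \<in> Hom C A B" "g \<in> Hom C B D" "is_iso C f" "is_iso C g"
  shows "is_iso C (g \<cdot> f)"
proof -
  obtain f' where f': "f' \<in> Hom C B A" "f' \<cdot> f = Idn C A" "f \<cdot> f' = Idn C B"
    using is_isoE[OF assms(3,1)] by blast
  obtain g' where g': "g' \<in> Hom C D B" "g' \<cdot> g = Idn C B" "g \<cdot> g' = Idn C D"
    using is_isoE[OF assms(4,2)] by blast
  show ?thesis
  proof (rule is_isoI[OF Cmp_Hom[OF assms(1,2)] Cmp_Hom[OF g'(1) f'(1)]])
    note gf = Cmp_Hom[OF assms(1,2)] and fg' = Cmp_Hom[OF g'(1) f'(1)]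
    have "(f' \<cdot> g') \<cdot> g \<cdot> f = f' \<cdot> g' \<cdot> g \<cdot> f" using Cmp_assoc[OF gf g'(1) f'(1)] by simp
    also have "g' \<cdot> g \<cdot> f = f"
      using Cmp_assoc[OF assms(1,2) g'(1)] g'(2) Idn_Cmp[OF assms(1)] by simp
    finally show "(f' \<cdot> g') \<cdot> g \<cdot> f = Idn C A" using f'(2) by simp
    have "(g \<cdot> f) \<cdot> f' \<cdot> g' = g \<cdot> f \<cdot> f' \<cdot> g'" using Cmp_assoc[OF fg' assms(1,2)] by simp
    also have "f \<cdot> f' \<cdot> g' = g'"
      using Cmp_assoc[OF g'(1) f'(1) assms(1)] f'(3) Idn_Cmp[OF g'(1)] by simp
    finally show "(g \<cdot> f) \<cdot> f' \<cdot> g' = Idn C D" using g'(3) by simp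
  qed
qed

lemma iso_class_self: "A \<in> Ob C \<Longrightarrow> A \<in> iso_class C A"
  unfolding iso_class_def isomorphic_def using Idn_Hom is_iso_Idn by blast

lemma iso_class_eqI:
  assumes "f \<in> Hom C A B" "is_iso C f"
  shows "iso_class C A = iso_class C B"
proof -
  obtain g where g: "g \<in> Hom C B A" "is_iso C g" using is_isoE[OF assms(2,1)] by blast
  have "isomorphic C A D \<longleftrightarrow> isomorphic C B D" for D
    unfolding isomorphic_def
    using Cmp_Hom[OF g(1), of _ D] is_iso_Cmp[OF g(1) _ g(2), of _ D]
      Cmp_Hom[OF assms(1), of _ D] is_iso_Cmp[OF assms(1) _ assms(2), of _ D] by blast
  then show ?thesis by (simp add: iso_class_def)
qed

lemma iso_class_eqD:
  assumes "A \<in> Ob C" "B \<in> Ob C" "iso_class C A = iso_class C B"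
  obtains f where "f \<in> Hom C A B" "is_iso C f"
proof -
  have "B \<in> iso_class C A" using iso_class_self assms by simp
  then show thesis using that by (auto simp: iso_class_def isomorphic_def)
qed

lemma iso_cancel_left:
  assumes "f \<in> Hom C B D" "is_iso C f" "x \<in> Hom C A B" "y \<in> Hom C A B" "f \<cdot> x = f \<cdot> y"
  shows "x = y"
proof -
  obtain g where g: "g \<in> Hom C D B" "g \<cdot> f = Idn C B" using is_isoE[OF assms(2,1)] by blast
  have "g \<cdot> f \<cdot> x = x" "g \<cdot> f \<cdot> y = y"
    using Cmp_assoc[OF assms(3,1) g(1)] Cmp_assoc[OF assms(4,1) g(1)] g(2)
      Idn_Cmp[OF assms(3)] Idn_Cmp[OF assms(4)] by simp_all
  then show ?thesis using assms(5) by metis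
qed

lemma iso_cancel_right:
  assumes "f \<in> Hom C A B" "is_iso C f" "x \<in> Hom C B D" "y \<in> Hom C B D" "x \<cdot> f = y \<cdot> f"
  shows "x = y"
proof -
  obtain g where g: "g \<in> Hom C B A" "f \<cdot> g = Idn C B" using is_isoE[OF assms(2,1)] by blast
  have "(x \<cdot> f) \<cdot> g = x" "(y \<cdot> f) \<cdot> g = y"
    using Cmp_assoc[OF g(1) assms(1,3)] Cmp_assoc[OF g(1) assms(1,4)] g(2)
      Cmp_Idn[OF assms(3)] Cmp_Idn[OF assms(4)] by simp_all
  then show ?thesis using assms(5) by metis
qed

lemma zero_object_unique:
  assumes "zero_object C Z"
  shows "\<lbrakk>f \<in> Hom C A Z; g \<in> Hom C A Z\<rbrakk> \<Longrightarrow> f = g"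
    and "\<lbrakk>f \<in> Hom C Z A; g \<in> Hom C Z A\<rbrakk> \<Longrightarrow> f = g"
  using assms Hom_Ob[of f A Z] Hom_Ob[of f Z A] unfolding zero_object_def by blast+

lemma zero_arrowI:
  "\<lbrakk>zero_object C Z; u \<in> Hom C A Z; v \<in> Hom C Z B\<rbrakk> \<Longrightarrow> zero_arrow C (v \<cdot> u)"
  unfolding zero_arrow_def factoring_def
  using Cmp_Hom[of u A Z v B] HomD[of u] HomD[of v] HomD[of "v \<cdot> u" C A B] by auto

lemma zero_arrowE:
  assumes "zero_arrow C f" "f \<in> Hom C A B"
  obtains Z u v where "zero_object C Z" "u \<in> Hom C A Z" "v \<in> Hom C Z B" "f = v \<cdot> u"
  using assms HomD[OF assms(2)] unfolding zero_arrow_def factoring_def by blast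

lemma zero_arrow_Cmp_left:
  assumes "zero_arrow C f" "f \<in> Hom C A B" "g \<in> Hom C B D"
  shows "zero_arrow C (g \<cdot> f)"
proof -
  obtain Z u v where Z: "zero_object C Z" "u \<in> Hom C A Z" "v \<in> Hom C Z B" "f = v \<cdot> u"
    using zero_arrowE[OF assms(1,2)] .
  then have "g \<cdot> f = (g \<cdot> v) \<cdot> u" using Cmp_assoc assms(3) by simp
  then show ?thesis using zero_arrowI[OF Z(1,2) Cmp_Hom[OF Z(3) assms(3)]] by simp
qed

lemma zero_arrow_Cmp_right:
  assumes "zero_arrow C g" "f \<in> Hom C A B" "g \<in> Hom C B D"
  shows "zero_arrow C (g \<cdot> f)"
proof -
  obtain Z u v where Z: "zero_object C Z" "u \<in> Hom C B Z" "v \<in> Hom C Z D" "g = v \<cdot> u"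
    using zero_arrowE[OF assms(1,3)] .
  then have "g \<cdot> f = v \<cdot> (u \<cdot> f)" using Cmp_assoc assms(2) by simp
  then show ?thesis using zero_arrowI[OF Z(1) Cmp_Hom[OF assms(2) Z(2)] Z(3)] by simp
qed

lemma is_kernelD:
  assumes "is_kernel C k g" "k \<in> Hom C A B" "g \<in> Hom C B D"
  shows "zero_arrow C (g \<cdot> k)"
    and "\<And>t T. \<lbrakk>t \<in> Hom C T B; zero_arrow C (g \<cdot> t)\<rbrakk> \<Longrightarrow> \<exists>!u. u \<in> Hom C T A \<and> k \<cdot> u = t"
proof -
  have dom: "Dom C k = A" "Dom C g = B" using HomD[OF assms(2)] HomD[OF assms(3)] by simp_all
  note k = assms(1)[unfolded is_kernel_def dom]
  show "zero_arrow C (g \<cdot> k)" using k by blast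
  fix t T assume t: "t \<in> Hom C T B" and "zero_arrow C (g \<cdot> t)"
  then show "\<exists>!u. u \<in> Hom C T A \<and> k \<cdot> u = t"
    using k HomD[OF t] by blast
qed

lemma is_cokernelD:
  assumes "is_cokernel C c f" "f \<in> Hom C A B" "c \<in> Hom C B D"
  shows "zero_arrow C (c \<cdot> f)"
    and "\<And>t T. \<lbrakk>t \<in> Hom C B T; zero_arrow C (t \<cdot> f)\<rbrakk> \<Longrightarrow> \<exists>!u. u \<in> Hom C D T \<and> u \<cdot> c = t"
proof -
  have cod: "Cod C f = B" "Cod C c = D" using HomD[OF assms(2)] HomD[OF assms(3)] by simp_all
  note c = assms(1)[unfolded is_cokernel_def cod]
  show "zero_arrow C (c \<cdot> f)" using c by blast
  fix t T assume t: "t \<in> Hom C B T" and "zero_arrow C (t \<cdot> f)"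
  then show "\<exists>!u. u \<in> Hom C D T \<and> u \<cdot> c = t"
    using c HomD[OF t] by blast
qed

lemma kernel_cancel:
  assumes k: "is_kernel C k g" "k \<in> Hom C A B" "g \<in> Hom C B D"
    and uv: "u \<in> Hom C T A" "v \<in> Hom C T A" "k \<cdot> u = k \<cdot> v"
  shows "u = v"
proof -
  have "g \<cdot> k \<cdot> u = (g \<cdot> k) \<cdot> u" using Cmp_assoc[OF uv(1) k(2,3)] .
  then have "zero_arrow C (g \<cdot> k \<cdot> u)"
    using zero_arrow_Cmp_right[OF is_kernelD(1)[OF k] uv(1) Cmp_Hom[OF k(2,3)]] by simp
  then show ?thesis using is_kernelD(2)[OF k Cmp_Hom[OF uv(1) k(2)]] uv by metis
qed

lemma cokernel_cancel:
  assumes c: "is_cokernel C c f" "f \<in> Hom C A B" "c \<in> Hom C B D"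
    and uv: "u \<in> Hom C D T" "v \<in> Hom C D T" "u \<cdot> c = v \<cdot> c"
  shows "u = v"
proof -
  have "(u \<cdot> c) \<cdot> f = u \<cdot> c \<cdot> f" using Cmp_assoc[OF c(2,3) uv(1)] by simp
  then have "zero_arrow C ((u \<cdot> c) \<cdot> f)"
    using zero_arrow_Cmp_left[OF is_cokernelD(1)[OF c] Cmp_Hom[OF c(2,3)] uv(1)] by simp
  then show ?thesis using is_cokernelD(2)[OF c Cmp_Hom[OF c(3) uv(1)]] uv by metis
qed

end

section \<open>Additive categories\<close>

context additive_category
begin

lemma
  assumes "A \<in> Ob C" "B \<in> Ob C"
  shows Zer_Hom: "Zer C A B \<in> Hom C A B"
    and Add_Hom: "\<lbrakk>f \<in> Hom C A B; g \<in> Hom C A B\<rbrakk> \<Longrightarrow> Add C f g \<in> Hom C A B"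
    and Zer_Add: "f \<in> Hom C A B \<Longrightarrow> Add C (Zer C A B) f = f"
    and Add_Zer: "f \<in> Hom C A B \<Longrightarrow> Add C f (Zer C A B) = f"
    and Add_cancel: "\<lbrakk>f \<in> Hom C A B; g \<in> Hom C A B; h \<in> Hom C A B; Add C f g = Add C f h\<rbrakk> \<Longrightarrow> g = h"
proof -
  interpret G: comm_group "hom_group C A B" by (rule hom_comm_group[OF assms])
  have [simp]: "carrier (hom_group C A B) = Hom C A B" "monoid.mult (hom_group C A B) = Add C"
    "\<one>\<^bsub>hom_group C A B\<^esub> = Zer C A B"
    by (simp_all add: hom_group_def)
  show "Zer C A B \<in> Hom C A B" using G.one_closed by simp
  show "\<lbrakk>f \<in> Hom C A B; g \<in> Hom C A B\<rbrakk> \<Longrightarrow> Add C f g \<in> Hom C A B" using G.m_closed by simp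
  show "f \<in> Hom C A B \<Longrightarrow> Add C (Zer C A B) f = f" using G.l_one by simp
  show "f \<in> Hom C A B \<Longrightarrow> Add C f (Zer C A B) = f" using G.r_one by simp
  show "\<lbrakk>f \<in> Hom C A B; g \<in> Hom C A B; h \<in> Hom C A B; Add C f g = Add C f h\<rbrakk> \<Longrightarrow> g = h"
    using G.Units_l_cancel[of f g h] by simp
qed

lemma
  assumes f: "f \<in> Hom C A B"
  shows Neg_Hom: "Neg C f \<in> Hom C A B"
    and Add_Neg: "Add C f (Neg C f) = Zer C A B"
    and Neg_Add: "Add C (Neg C f) f = Zer C A B"
proof -
  interpret G: comm_group "hom_group C A B" by (rule hom_comm_group[OF Hom_Ob[OF f]])
  have car: "carrier (hom_group C A B) = Hom C A B" "monoid.mult (hom_group C A B) = Add C"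
    "\<one>\<^bsub>hom_group C A B\<^esub> = Zer C A B"
    by (simp_all add: hom_group_def)
  have N: "Neg C f = inv\<^bsub>hom_group C A B\<^esub> f" using HomD[OF f] by (simp add: Neg_def)
  have f': "f \<in> carrier (hom_group C A B)" using f car by simp
  show "Neg C f \<in> Hom C A B" using G.inv_closed[OF f'] by (simp add: N car)
  show "Add C f (Neg C f) = Zer C A B" using G.r_inv[OF f'] by (simp add: N car)
  show "Add C (Neg C f) f = Zer C A B" using G.l_inv[OF f'] by (simp add: N car)
qed

lemma Neg_unique:
  assumes "f \<in> Hom C A B" "g \<in> Hom C A B" "Add C f g = Zer C A B"
  shows "g = Neg C f"
  using Add_cancel[OF Hom_Ob[OF assms(1)] assms(1,2) Neg_Hom[OF assms(1)]] Add_Neg[OF assms(1)]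
    assms(3) by simp

lemma Neg_Neg: "f \<in> Hom C A B \<Longrightarrow> Neg C (Neg C f) = f"
  using Neg_unique[of "Neg C f" A B f] Neg_Hom Neg_Add by simp

lemma Neg_Zer: "\<lbrakk>A \<in> Ob C; B \<in> Ob C\<rbrakk> \<Longrightarrow> Neg C (Zer C A B) = Zer C A B"
  using Neg_unique[of "Zer C A B" A B "Zer C A B"] Zer_Hom Zer_Add by simp

lemma diff_zero_iff:
  assumes "f \<in> Hom C A B" "g \<in> Hom C A B"
  shows "Add C f (Neg C g) = Zer C A B \<longleftrightarrow> f = g"
proof
  assume "Add C f (Neg C g) = Zer C A B"
  then have "Neg C (Neg C g) = Neg C (Neg C f)"
    using Neg_unique[OF assms(1) Neg_Hom[OF assms(2)]] by simp
  then show "f = g" using Neg_Neg[OF assms(1)] Neg_Neg[OF assms(2)] by simp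
qed (simp add: Add_Neg[OF assms(2)])

lemma Cmp_Zer:
  assumes "A \<in> Ob C" "f \<in> Hom C B D"
  shows "f \<cdot> Zer C A B = Zer C A D"
proof -
  note Ob = assms(1) Hom_Ob[OF assms(2)]
  let ?z = "f \<cdot> Zer C A B"
  have z: "?z \<in> Hom C A D" using Cmp_Hom[OF Zer_Hom[OF Ob(1,2)] assms(2)] .
  have "Add C ?z ?z = ?z"
    using Cmp_Add_right[OF Zer_Hom[OF Ob(1,2)] Zer_Hom[OF Ob(1,2)] assms(2)]
      Zer_Add[OF Ob(1,2) Zer_Hom[OF Ob(1,2)]] by simp
  then show ?thesis
    using Add_cancel[OF Ob(1,3) z z Zer_Hom[OF Ob(1,3)]] Add_Zer[OF Ob(1,3) z] by simp
qed

lemma Zer_Cmp: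
  assumes "D \<in> Ob C" "f \<in> Hom C A B"
  shows "Zer C B D \<cdot> f = Zer C A D"
proof -
  note Ob = assms(1) Hom_Ob[OF assms(2)]
  let ?z = "Zer C B D \<cdot> f"
  have z: "?z \<in> Hom C A D" using Cmp_Hom[OF assms(2) Zer_Hom[OF Ob(3,1)]] .
  have "Add C ?z ?z = ?z"
    using Cmp_Add_left[OF assms(2) Zer_Hom[OF Ob(3,1)] Zer_Hom[OF Ob(3,1)]]
      Zer_Add[OF Ob(3,1) Zer_Hom[OF Ob(3,1)]] by simp
  then show ?thesis
    using Add_cancel[OF Ob(2,1) z z Zer_Hom[OF Ob(2,1)]] Add_Zer[OF Ob(2,1) z] by simp
qed

lemma Cmp_Neg:
  assumes "f \<in> Hom C A B" "g \<in> Hom C B D"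
  shows "g \<cdot> Neg C f = Neg C (g \<cdot> f)"
proof (rule Neg_unique[OF Cmp_Hom[OF assms] Cmp_Hom[OF Neg_Hom[OF assms(1)] assms(2)]])
  show "Add C (g \<cdot> f) (g \<cdot> Neg C f) = Zer C A D"
    using Cmp_Add_right[OF assms(1) Neg_Hom[OF assms(1)] assms(2)] Add_Neg[OF assms(1)]
      Cmp_Zer[OF Hom_Ob(1)[OF assms(1)] assms(2)] by simp
qed

lemma Neg_Cmp:
  assumes "f \<in> Hom C A B" "g \<in> Hom C B D"
  shows "Neg C g \<cdot> f = Neg C (g \<cdot> f)"
proof (rule Neg_unique[OF Cmp_Hom[OF assms] Cmp_Hom[OF assms(1) Neg_Hom[OF assms(2)]]])
  show "Add C (g \<cdot> f) (Neg C g \<cdot> f) = Zer C A D"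
    using Cmp_Add_left[OF assms(1,2) Neg_Hom[OF assms(2)]] Add_Neg[OF assms(2)]
      Zer_Cmp[OF Hom_Ob(2)[OF assms(2)] assms(1)] by simp
qed

lemma Neg_eq_Zer_iff:
  assumes "f \<in> Hom C A B"
  shows "Neg C f = Zer C A B \<longleftrightarrow> f = Zer C A B"
  using Neg_Neg[OF assms] Neg_Zer[OF Hom_Ob[OF assms]] by auto

lemma diff_Cmp:
  assumes "x \<in> Hom C A B" "f \<in> Hom C B D" "g \<in> Hom C B D"
  shows "Add C f (Neg C g) \<cdot> x = Zer C A D \<longleftrightarrow> f \<cdot> x = g \<cdot> x"
  using Cmp_Add_left[OF assms(1,2) Neg_Hom[OF assms(3)]] Neg_Cmp[OF assms(1,3)]
    diff_zero_iff[OF Cmp_Hom[OF assms(1,2)] Cmp_Hom[OF assms(1,3)]] by simp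

lemma Cmp_diff:
  assumes "x \<in> Hom C A B" "y \<in> Hom C A B" "f \<in> Hom C B D"
  shows "f \<cdot> Add C x (Neg C y) = Zer C A D \<longleftrightarrow> f \<cdot> x = f \<cdot> y"
  using Cmp_Add_right[OF assms(1) Neg_Hom[OF assms(2)] assms(3)] Cmp_Neg[OF assms(2,3)]
    diff_zero_iff[OF Cmp_Hom[OF assms(1,3)] Cmp_Hom[OF assms(2,3)]] by simp

end

section \<open>Rotation and exactness of triangles\<close>

context triangulated_category
begin

lemma shO_Ob: "A \<in> Ob C \<Longrightarrow> shO C A \<in> Ob C"
  and unshO_Ob: "A \<in> Ob C \<Longrightarrow> unshO C A \<in> Ob C"
  using sh_functor unsh_functor by (auto simp: endofunctor_def)

lemma shA_Hom: "f \<in> Hom C A B \<Longrightarrow> shA C f \<in> Hom C (shO C A) (shO C B)"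
  and unshA_Hom: "f \<in> Hom C A B \<Longrightarrow> unshA C f \<in> Hom C (unshO C A) (unshO C B)"
  using sh_functor unsh_functor HomD[of f C A B] by (auto simp: endofunctor_def)

lemma shA_Idn: "A \<in> Ob C \<Longrightarrow> shA C (Idn C A) = Idn C (shO C A)"
  using sh_functor by (auto simp: endofunctor_def)

lemma shA_Cmp: "\<lbrakk>f \<in> Hom C A B; g \<in> Hom C B D\<rbrakk> \<Longrightarrow> shA C (g \<cdot> f) = shA C g \<cdot> shA C f"
  and unshA_Cmp: "\<lbrakk>f \<in> Hom C A B; g \<in> Hom C B D\<rbrakk> \<Longrightarrow> unshA C (g \<cdot> f) = unshA C g \<cdot> unshA C f"
  using sh_functor unsh_functor HomD[of f C A B] HomD[of g C B D] by (auto simp: endofunctor_def)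

lemma shA_Zer:
  assumes "A \<in> Ob C" "B \<in> Ob C"
  shows "shA C (Zer C A B) = Zer C (shO C A) (shO C B)"
proof -
  note Z = Zer_Hom[OF assms] and Ob = shO_Ob[OF assms(1)] shO_Ob[OF assms(2)]
  have "Add C (shA C (Zer C A B)) (shA C (Zer C A B)) = shA C (Zer C A B)"
    using sh_Add[OF Z Z] Zer_Add[OF assms Z] by simp
  then show ?thesis
    using Add_cancel[OF Ob shA_Hom[OF Z] shA_Hom[OF Z] Zer_Hom[OF Ob]] Add_Zer[OF Ob shA_Hom[OF Z]]
    by simp
qed

lemma shA_Neg: "f \<in> Hom C A B \<Longrightarrow> shA C (Neg C f) = Neg C (shA C f)"
  using Neg_unique[OF shA_Hom shA_Hom[OF Neg_Hom], of f A B f] sh_Add[OF _ Neg_Hom, of f A B f]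
    Add_Neg[of f A B] shA_Zer Hom_Ob[of f A B] by simp

lemma shA_faithful:
  assumes "f \<in> Hom C A B" "g \<in> Hom C A B" "shA C f = shA C g"
  shows "f = g"
proof -
  have "f \<cdot> unsh_sh C A = g \<cdot> unsh_sh C A"
    using unsh_sh_natural[OF assms(1)] unsh_sh_natural[OF assms(2)] assms(3) by simp
  moreover have "unsh_sh C A \<in> Hom C (unshO C (shO C A)) A" "is_iso C (unsh_sh C A)"
    using unsh_sh_iso[OF Hom_Ob(1)[OF assms(1)]] by auto
  ultimately show ?thesis using iso_cancel_right[OF _ _ assms(1,2)] by simp
qed

text \<open>The preimage of \<open>d\<close> is \<open>d[-1]\<close>, transported along \<open>unsh_sh\<close>; naturality of \<open>sh_unsh\<close> and the
  adjunction identity return \<open>d\<close> after suspension.\<close>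

lemma shA_full:
  assumes A: "A \<in> Ob C" and B: "B \<in> Ob C" and d: "d \<in> Hom C (shO C A) (shO C B)"
  obtains u where "u \<in> Hom C A B" "shA C u = d"
proof -
  have iA: "unsh_sh C A \<in> Hom C (unshO C (shO C A)) A" "is_iso C (unsh_sh C A)"
    and iB: "unsh_sh C B \<in> Hom C (unshO C (shO C B)) B"
    using unsh_sh_iso A B by auto
  obtain v where v: "v \<in> Hom C A (unshO C (shO C A))" "unsh_sh C A \<cdot> v = Idn C A"
    using is_isoE[OF iA(2,1)] by blast
  note ud = unshA_Hom[OF d]
  define u where "u = (unsh_sh C B \<cdot> unshA C d) \<cdot> v"
  have u: "u \<in> Hom C A B" unfolding u_def using Cmp_Hom[OF v(1) Cmp_Hom[OF ud iB]] .
  have sA: "shA C (unsh_sh C A) = sh_unsh C (shO C A)" "sh_unsh C (shO C A) \<in> Hom C (shO C (unshO C (shO C A))) (shO C A)"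
    using unsh_sh_adjoint[OF A] sh_unsh_iso[OF shO_Ob[OF A]] by auto
  have sB: "shA C (unsh_sh C B) = sh_unsh C (shO C B)"
    using unsh_sh_adjoint[OF B] .
  have "shA C u = (sh_unsh C (shO C B) \<cdot> shA C (unshA C d)) \<cdot> shA C v"
    unfolding u_def using shA_Cmp[OF v(1) Cmp_Hom[OF ud iB]] shA_Cmp[OF ud iB] sB by simp
  also have "\<dots> = (d \<cdot> sh_unsh C (shO C A)) \<cdot> shA C v"
    using sh_unsh_natural[OF d] by simp
  also have "\<dots> = d \<cdot> (sh_unsh C (shO C A) \<cdot> shA C v)"
    using Cmp_assoc[OF shA_Hom[OF v(1)] sA(2) d] by simp
  also have "sh_unsh C (shO C A) \<cdot> shA C v = Idn C (shO C A)"
    using shA_Cmp[OF v(1) iA(1)] v(2) shA_Idn[OF A] sA by simp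
  finally have "shA C u = d" using Cmp_Idn[OF d] by simp
  then show thesis using that u by blast
qed

text \<open>Distinguished triangles together with their objects, which the triples in \<open>Tri\<close> leave implicit.\<close>

definition tri :: "'m \<Rightarrow> 'm \<Rightarrow> 'm \<Rightarrow> 'o \<Rightarrow> 'o \<Rightarrow> 'o \<Rightarrow> bool" where
  "tri f g h A B D \<longleftrightarrow> (f, g, h) \<in> Tri C \<and> f \<in> Hom C A B \<and> g \<in> Hom C B D \<and> h \<in> Hom C D (shO C A)"

lemma triD:
  assumes "tri f g h A B D"
  shows "(f, g, h) \<in> Tri C" "f \<in> Hom C A B" "g \<in> Hom C B D" "h \<in> Hom C D (shO C A)"
    "A \<in> Ob C" "B \<in> Ob C" "D \<in> Ob C"
  using assms Hom_Ob[of f A B] Hom_Ob[of g B D] by (auto simp: tri_def)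

lemma Tri_tri:
  assumes "(f, g, h) \<in> Tri C"
  shows "tri f g h (Dom C f) (Cod C f) (Cod C g)"
proof -
  note T = Tri_typed[OF assms]
  then have "g \<in> Hom C (Cod C f) (Dom C h)" "h \<in> Hom C (Cod C g) (shO C (Dom C f))" by simp_all
  moreover have "f \<in> Hom C (Dom C f) (Cod C f)" using T by (simp add: HomI)
  ultimately show ?thesis using assms HomD(2)[of h C "Cod C g"] by (simp add: tri_def)
qed

lemma cone_ex:
  assumes "f \<in> Hom C A B"
  obtains g h D where "tri f g h A B D"
proof -
  obtain g h where "(f, g, h) \<in> Tri C" using TR1_cone[of f] HomD[OF assms] by blast
  then show thesis using that[of g h "Cod C g"] Tri_tri[of f g h] HomD[OF assms] by simp
qed

lemma tri_rotate: "tri f g h A B D \<Longrightarrow> tri g h (Neg C (shA C f)) B D (shO C A)"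
  using TR2[of f A B g D h] Neg_Hom[OF shA_Hom] unfolding tri_def by blast

text \<open>With \<open>w = - h[-1]\<close> the axiom on rotations asks for the triangle on \<open>f\<close>, \<open>g\<close> and \<open>- w[1]\<close>. The triangle
  identity of the adjoint equivalence shows that this is the given one, up to the identification
  \<open>D[-1][1] \<cong> D\<close>.\<close>

lemma tri_unrotate:
  assumes t: "tri f g h A B D"
  obtains w g' where "tri w f g' (unshO C D) A B"
proof -
  define w where "w = Neg C (unsh_sh C A \<cdot> unshA C h)"
  note T = triD[OF t]
  have iA: "unsh_sh C A \<in> Hom C (unshO C (shO C A)) A" using unsh_sh_iso T by auto
  have eD: "sh_unsh C D \<in> Hom C (shO C (unshO C D)) D" "is_iso C (sh_unsh C D)"
    using sh_unsh_iso T by auto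
  obtain e where e: "e \<in> Hom C D (shO C (unshO C D))" "e \<cdot> sh_unsh C D = Idn C (shO C (unshO C D))"
    "sh_unsh C D \<cdot> e = Idn C D" "is_iso C e"
    using is_isoE[OF eD(2,1)] by blast
  note c = Cmp_Hom[OF unshA_Hom[OF T(4)] iA]
  have w: "w \<in> Hom C (unshO C D) A" unfolding w_def by (rule Neg_Hom[OF c])
  define g' where "g' = e \<cdot> g"
  have g': "g' \<in> Hom C B (shO C (unshO C D))" unfolding g'_def by (rule Cmp_Hom[OF T(3) e(1)])
  have "shA C (unsh_sh C A \<cdot> unshA C h) = shA C (unsh_sh C A) \<cdot> shA C (unshA C h)"
    using shA_Cmp[OF unshA_Hom[OF T(4)] iA] .
  also have "\<dots> = h \<cdot> sh_unsh C D"
    using sh_unsh_natural[OF T(4)] unsh_sh_adjoint[OF T(5)] by simp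
  finally have "Neg C (shA C w) = h \<cdot> sh_unsh C D"
    unfolding w_def using shA_Neg[OF c] Neg_Neg[OF shA_Hom[OF c]] by simp
  moreover have "h \<cdot> sh_unsh C D \<in> Hom C (shO C (unshO C D)) (shO C A)" by (rule Cmp_Hom[OF eD(1) T(4)])
  moreover have "(f, g', h \<cdot> sh_unsh C D) \<in> Tri C"
  proof (rule TR1_iso[OF T(1-4) T(2) g' calculation(2) Idn_Hom[OF T(5)] Idn_Hom[OF T(6)] e(1)
        is_iso_Idn[OF T(5)] is_iso_Idn[OF T(6)] e(4)])
    show "Idn C B \<cdot> f = f \<cdot> Idn C A" using Idn_Cmp Cmp_Idn T by simp
    show "e \<cdot> g = g' \<cdot> Idn C B" using Cmp_Idn[OF g'] by (simp add: g'_def)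
    have "(h \<cdot> sh_unsh C D) \<cdot> e = h" using Cmp_assoc[OF e(1) eD(1) T(4)] e(3) Cmp_Idn[OF T(4)] by simp
    then show "shA C (Idn C A) \<cdot> h = (h \<cdot> sh_unsh C D) \<cdot> e"
      using shA_Idn[OF T(5)] Idn_Cmp[OF T(4)] by simp
  qed
  ultimately have "(w, f, g') \<in> Tri C" using TR2[OF w T(2) g'] by simp
  then show thesis using that[of w g'] w g' T(2) by (simp add: tri_def)
qed

lemma tri_Idn:
  assumes "A \<in> Ob C" "zero_object C Z"
  shows "tri (Idn C A) (Zer C A Z) (Zer C Z (shO C A)) A A Z"
  using TR1_Idn[OF assms] assms Idn_Hom Zer_Hom shO_Ob
  by (auto simp: tri_def zero_object_def)

lemma tri_comp_zero:
  assumes t: "tri f g h A B D"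
  shows "g \<cdot> f = Zer C A D"
proof -
  note T = triD[OF t]
  obtain Z where Z: "zero_object C Z" using zero_object_ex by blast
  note I = triD[OF tri_Idn[OF T(5) Z]]
  have "\<exists>d \<in> Hom C (Cod C (Zer C A Z)) (Cod C g).
          d \<cdot> Zer C A Z = g \<cdot> f \<and> shA C (Idn C A) \<cdot> Zer C Z (shO C A) = h \<cdot> d"
    by (rule TR3[OF I(1) T(1)]) (use T(2) Idn_Hom[OF T(5)] HomD[OF T(2)] HomD[OF I(2)] in simp_all)
  then obtain d where "d \<in> Hom C Z D" "d \<cdot> Zer C A Z = g \<cdot> f"
    using HomD[OF I(3)] HomD[OF T(3)] by auto
  then show ?thesis using Cmp_Zer[OF T(5)] by simp
qed

text \<open>The pair \<open>(x, 0)\<close> is a morphism from the rotated triangle \<open>X \<rightarrow> 0 \<rightarrow> X[1]\<close> to \<open>B \<rightarrow> D \<rightarrow> A[1]\<close>. Its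
  completion is an arrow \<open>X[1] \<rightarrow> A[1]\<close>, which desuspends because \<open>[1]\<close> is full.\<close>

lemma tri_exact:
  assumes t: "tri f g h A B D" and x: "x \<in> Hom C X B" and gx: "g \<cdot> x = Zer C X D"
  obtains u where "u \<in> Hom C X A" "x = f \<cdot> u"
proof -
  note T = triD[OF t] and R = triD[OF tri_rotate[OF t]] and X = Hom_Ob(1)[OF x]
  obtain Z where Z: "zero_object C Z" using zero_object_ex by blast
  have ZO: "Z \<in> Ob C" using Z by (simp add: zero_object_def)
  note I = triD[OF tri_rotate[OF tri_Idn[OF X Z]]]
  have "\<exists>d \<in> Hom C (Cod C (Zer C Z (shO C X))) (Cod C h).
          d \<cdot> Zer C Z (shO C X) = h \<cdot> Zer C Z D \<and> shA C x \<cdot> Neg C (shA C (Idn C X)) = Neg C (shA C f) \<cdot> d"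
  proof (rule TR3[OF I(1) R(1)])
    show "x \<in> Hom C (Dom C (Zer C X Z)) (Dom C g)" using x HomD[OF I(2)] HomD[OF R(2)] by simp
    show "Zer C Z D \<in> Hom C (Cod C (Zer C X Z)) (Cod C g)"
      using Zer_Hom[OF ZO T(7)] HomD[OF I(2)] HomD[OF R(2)] by simp
    show "Zer C Z D \<cdot> Zer C X Z = g \<cdot> x" using Cmp_Zer[OF X Zer_Hom[OF ZO T(7)]] gx by simp
  qed
  then obtain d where d: "d \<in> Hom C (shO C X) (shO C A)"
    and eq: "shA C x \<cdot> Neg C (shA C (Idn C X)) = Neg C (shA C f) \<cdot> d"
    using HomD[OF I(3)] HomD[OF R(3)] by auto
  obtain u where u: "u \<in> Hom C X A" "shA C u = d" using shA_full[OF X T(5) d] .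
  have "Neg C (shA C x) = Neg C (shA C f \<cdot> d)"
    using eq Cmp_Neg[OF shA_Hom[OF Idn_Hom[OF X]] shA_Hom[OF x]] Neg_Cmp[OF d shA_Hom[OF T(2)]]
      shA_Idn[OF X] Cmp_Idn[OF shA_Hom[OF x]] by simp
  then have "Neg C (Neg C (shA C x)) = Neg C (Neg C (shA C f \<cdot> d))" by (rule arg_cong)
  then have "shA C x = shA C f \<cdot> d"
    unfolding Neg_Neg[OF shA_Hom[OF x]] Neg_Neg[OF Cmp_Hom[OF d shA_Hom[OF T(2)]]] .
  then have "shA C x = shA C (f \<cdot> u)" unfolding shA_Cmp[OF u(1) T(2)] u(2) .
  then show thesis using that u(1) shA_faithful[OF x Cmp_Hom[OF u(1) T(2)]] by blast
qed

text \<open>Dually, complete \<open>(0, y)\<close> to a morphism into the triangle \<open>0 \<rightarrow> T \<rightarrow> T\<close>.\<close>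

lemma tri_coexact:
  assumes t: "tri f g h A B D" and y: "y \<in> Hom C B T" and yf: "y \<cdot> f = Zer C A T"
  obtains r where "r \<in> Hom C D T" "y = r \<cdot> g"
proof -
  note T = triD[OF t] and TO = Hom_Ob(2)[OF y]
  obtain Z where Z: "zero_object C Z" using zero_object_ex by blast
  obtain w g' where I': "tri w (Idn C T) g' (unshO C Z) T T"
    using tri_unrotate[OF tri_Idn[OF TO Z]] .
  note I = triD[OF I']
  have "\<exists>d \<in> Hom C (Cod C g) (Cod C (Idn C T)).
          d \<cdot> g = Idn C T \<cdot> y \<and> shA C (Zer C A (unshO C Z)) \<cdot> h = g' \<cdot> d"
  proof (rule TR3[OF T(1) I(1)])
    show "Zer C A (unshO C Z) \<in> Hom C (Dom C f) (Dom C w)"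
      using Zer_Hom[OF T(5) I(5)] HomD[OF T(2)] HomD[OF I(2)] by simp
    show "y \<in> Hom C (Cod C f) (Cod C w)" using y HomD[OF T(2)] HomD[OF I(2)] by simp
    show "y \<cdot> f = w \<cdot> Zer C A (unshO C Z)" using yf Cmp_Zer[OF T(5) I(2)] by simp
  qed
  then show thesis using that Idn_Cmp[OF y] HomD[OF T(3)] HomD[OF I(3)] by auto
qed

end

section \<open>The restricted Yoneda functor of a rigid subcategory\<close>

text \<open>
  Write \<open>H\<close> for the functor sending \<open>A\<close> to the family of groups \<open>Hom C X A\<close>, \<open>X \<in> \<X>\<close>. It is
  cohomological, it vanishes exactly on \<open>\<N>\<close>, and it vanishes on \<open>\<X>[1]\<close> by rigidity. The four
  predicates say that \<open>H\<close> takes an arrow to zero, to a monomorphism or to an epimorphism, and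
  that it identifies two arrows.
\<close>

locale rigid_subcategory = triangulated_category C
  for C :: "('o, 'm, 'x) tricat_scheme" (structure) +
  fixes \<X> \<N> :: "'o set"
  assumes additive_\<X>: "additive_subcategory C \<X>"
    and contravariantly_finite_\<X>: "contravariantly_finite C \<X>"
    and rigid_\<X>: "rigid C \<X>"
    and \<N>_def: "\<N> = perp0 C \<X>"
begin

definition Xzero :: "'m \<Rightarrow> 'o \<Rightarrow> 'o \<Rightarrow> bool" where
  "Xzero f A B \<longleftrightarrow> (\<forall>X \<in> \<X>. \<forall>x \<in> Hom C X A. f \<cdot> x = Zer C X B)"

definition Xmono :: "'m \<Rightarrow> 'o \<Rightarrow> bool" where
  "Xmono f A \<longleftrightarrow> (\<forall>X \<in> \<X>. \<forall>x \<in> Hom C X A. \<forall>y \<in> Hom C X A. f \<cdot> x = f \<cdot> y \<longrightarrow> x = y)"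

definition Xepi :: "'m \<Rightarrow> 'o \<Rightarrow> 'o \<Rightarrow> bool" where
  "Xepi f A B \<longleftrightarrow> (\<forall>X \<in> \<X>. \<forall>y \<in> Hom C X B. \<exists>x \<in> Hom C X A. y = f \<cdot> x)"

definition Xeq :: "'m \<Rightarrow> 'm \<Rightarrow> 'o \<Rightarrow> bool" where
  "Xeq f g A \<longleftrightarrow> (\<forall>X \<in> \<X>. \<forall>x \<in> Hom C X A. f \<cdot> x = g \<cdot> x)"

lemma X_Ob: "X \<in> \<X> \<Longrightarrow> X \<in> Ob C"
  using additive_\<X> by (auto simp: additive_subcategory_def)

lemma N_Ob: "M \<in> \<N> \<Longrightarrow> M \<in> Ob C"
  by (simp add: \<N>_def perp0_def)

lemma N_zero: "\<lbrakk>M \<in> \<N>; X \<in> \<X>; x \<in> Hom C X M\<rbrakk> \<Longrightarrow> x = Zer C X M"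
  by (auto simp: \<N>_def perp0_def)

lemma N_I: "\<lbrakk>M \<in> Ob C; \<And>X x. \<lbrakk>X \<in> \<X>; x \<in> Hom C X M\<rbrakk> \<Longrightarrow> x = Zer C X M\<rbrakk> \<Longrightarrow> M \<in> \<N>"
  using Zer_Hom X_Ob by (auto simp: \<N>_def perp0_def)

lemma X_sh_zero: "\<lbrakk>P \<in> \<X>; X \<in> \<X>; x \<in> Hom C X (shO C P)\<rbrakk> \<Longrightarrow> x = Zer C X (shO C P)"
  using rigid_\<X> by (auto simp: rigid_def)

lemma X_zero_object: obtains Z where "Z \<in> \<X>" "zero_object C Z"
  using additive_\<X> by (auto simp: additive_subcategory_def)

lemma XzeroD: "\<lbrakk>Xzero f A B; X \<in> \<X>; x \<in> Hom C X A\<rbrakk> \<Longrightarrow> f \<cdot> x = Zer C X B"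
  by (simp add: Xzero_def)

lemma XepiE:
  assumes "Xepi f A B" "X \<in> \<X>" "y \<in> Hom C X B"
  obtains x where "x \<in> Hom C X A" "y = f \<cdot> x"
  using assms unfolding Xepi_def by blast

lemma XmonoD: "\<lbrakk>Xmono f A; X \<in> \<X>; x \<in> Hom C X A; y \<in> Hom C X A; f \<cdot> x = f \<cdot> y\<rbrakk> \<Longrightarrow> x = y"
  by (simp add: Xmono_def)

lemma XeqD: "\<lbrakk>Xeq f g A; X \<in> \<X>; x \<in> Hom C X A\<rbrakk> \<Longrightarrow> f \<cdot> x = g \<cdot> x"
  by (simp add: Xeq_def)

lemma XmonoI:
  assumes "f \<in> Hom C A B"
    and "\<And>X x. \<lbrakk>X \<in> \<X>; x \<in> Hom C X A; f \<cdot> x = Zer C X B\<rbrakk> \<Longrightarrow> x = Zer C X A"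
  shows "Xmono f A"
  unfolding Xmono_def
proof (intro ballI impI)
  fix X x y assume X: "X \<in> \<X>" and x: "x \<in> Hom C X A" and y: "y \<in> Hom C X A" and eq: "f \<cdot> x = f \<cdot> y"
  have d: "Add C x (Neg C y) \<in> Hom C X A" using Add_Hom[OF Hom_Ob[OF x] x Neg_Hom[OF y]] .
  have "f \<cdot> Add C x (Neg C y) = Zer C X B" using Cmp_diff[OF x y assms(1)] eq by simp
  then have "Add C x (Neg C y) = Zer C X A" using assms(2)[OF X d] by simp
  then show "x = y" using diff_zero_iff[OF x y] by simp
qed

lemma Xmono_zero:
  assumes "Xmono f A" "f \<in> Hom C A B" "X \<in> \<X>" "x \<in> Hom C X A" "f \<cdot> x = Zer C X B"
  shows "x = Zer C X A"
  using XmonoD[OF assms(1,3,4) Zer_Hom[OF Hom_Ob[OF assms(4)]]] assms(5)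
    Cmp_Zer[OF X_Ob[OF assms(3)] assms(2)] by simp

lemma Xzero_to_N: "\<lbrakk>h \<in> Hom C A B; B \<in> \<N>\<rbrakk> \<Longrightarrow> Xzero h A B"
  unfolding Xzero_def using N_zero Cmp_Hom by blast

lemma Xzero_to_X_sh: "\<lbrakk>h \<in> Hom C A (shO C P); P \<in> \<X>\<rbrakk> \<Longrightarrow> Xzero h A (shO C P)"
  unfolding Xzero_def using X_sh_zero Cmp_Hom by blast

lemma Xmono_from_N:
  assumes "A \<in> \<N>"
  shows "Xmono f A"
  unfolding Xmono_def
proof (intro ballI impI)
  fix X x y assume "X \<in> \<X>" "x \<in> Hom C X A" "y \<in> Hom C X A"
  then show "x = y" using N_zero[OF assms, of X x] N_zero[OF assms, of X y] by simp
qed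

lemma Xepi_of_factor:
  assumes "u \<in> Hom C P A" "f \<in> Hom C A B" "Xepi (f \<cdot> u) P B"
  shows "Xepi f A B"
  unfolding Xepi_def
proof (intro ballI)
  fix X y assume X: "X \<in> \<X>" and y: "y \<in> Hom C X B"
  obtain x where x: "x \<in> Hom C X P" "y = (f \<cdot> u) \<cdot> x" using XepiE[OF assms(3) X y] .
  have "y = f \<cdot> u \<cdot> x" using x Cmp_assoc[OF x(1) assms(1,2)] by simp
  then show "\<exists>x \<in> Hom C X A. y = f \<cdot> x" using Cmp_Hom[OF x(1) assms(1)] by blast
qed

lemma tri_Xzero_of_Xepi:
  assumes t: "tri f g h A B D" and "Xepi g B D"
  shows "Xzero h D (shO C A)"
  unfolding Xzero_def
proof (intro ballI)
  note T = triD[OF t]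
  fix X x assume X: "X \<in> \<X>" and x: "x \<in> Hom C X D"
  obtain u where u: "u \<in> Hom C X B" "x = g \<cdot> u" using XepiE[OF assms(2) X x] .
  have "h \<cdot> x = (h \<cdot> g) \<cdot> u" using u Cmp_assoc[OF u(1) T(3,4)] by simp
  then show "h \<cdot> x = Zer C X (shO C A)"
    using tri_comp_zero[OF tri_rotate[OF t]] Zer_Cmp[OF shO_Ob[OF T(5)] u(1)] by simp
qed

lemma tri_Xepi_of_Xzero:
  assumes t: "tri f g h A B D" and "Xzero h D (shO C A)"
  shows "Xepi g B D"
  unfolding Xepi_def
proof (intro ballI)
  fix X y assume X: "X \<in> \<X>" and y: "y \<in> Hom C X D"
  show "\<exists>x \<in> Hom C X B. y = g \<cdot> x"
    using tri_exact[OF tri_rotate[OF t] y XzeroD[OF assms(2) X y]] by blast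
qed

lemma tri_Xmono_of_Xzero:
  assumes t: "tri f g h A B D" and "Xzero f A B"
  shows "Xmono g B"
proof (rule XmonoI)
  note T = triD[OF t]
  show "g \<in> Hom C B D" by (rule T(3))
  fix X x assume X: "X \<in> \<X>" and x: "x \<in> Hom C X B" and "g \<cdot> x = Zer C X D"
  then obtain u where "u \<in> Hom C X A" "x = f \<cdot> u" using tri_exact[OF t] by blast
  then show "x = Zer C X B" using XzeroD[OF assms(2) X] by simp
qed

lemma tri_Xzero_of_Xmono:
  assumes t: "tri f g h A B D" and "Xmono g B"
  shows "Xzero f A B"
  unfolding Xzero_def
proof (intro ballI)
  note T = triD[OF t]
  fix X x assume X: "X \<in> \<X>" and x: "x \<in> Hom C X A"
  have "g \<cdot> f \<cdot> x = Zer C X D"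
    using Cmp_assoc[OF x T(2,3)] tri_comp_zero[OF t] Zer_Cmp[OF T(7) x] by simp
  then show "f \<cdot> x = Zer C X B" using Xmono_zero[OF assms(2) T(3) X Cmp_Hom[OF x T(2)]] by simp
qed

text \<open>The cone of a right \<open>\<X>\<close>-approximation lies in \<open>\<N>\<close>: an arrow from \<open>X\<close> to it lifts to \<open>D\<close>
  because \<open>Hom C X (P[1])\<close> vanishes, hence factors through the approximation and dies in the cone.\<close>

lemma approximation_triangle:
  assumes D: "D \<in> Ob C"
  obtains P x M n m where "P \<in> \<X>" "M \<in> \<N>" "tri x n m P D M" "Xepi x P D"
proof -
  obtain x where x: "right_approximation C \<X> x D"
    using contravariantly_finite_\<X> D by (auto simp: contravariantly_finite_def)
  define P where "P = Dom C x"
  have P: "P \<in> \<X>" and xH: "x \<in> Hom C P D" and epi: "Xepi x P D"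
    using x unfolding right_approximation_def P_def Xepi_def Hom_def by blast+
  obtain n m M where t: "tri x n m P D M" using cone_ex[OF xH] .
  note T = triD[OF t]
  have "M \<in> \<N>"
  proof (rule N_I[OF T(7)])
    fix X y assume X: "X \<in> \<X>" and y: "y \<in> Hom C X M"
    have "m \<cdot> y = Zer C X (shO C P)" using X_sh_zero[OF P X Cmp_Hom[OF y T(4)]] .
    then obtain u where u: "u \<in> Hom C X D" "y = n \<cdot> u" using tri_exact[OF tri_rotate[OF t] y] by blast
    obtain v where v: "v \<in> Hom C X P" "u = x \<cdot> v" using XepiE[OF epi X u(1)] .
    show "y = Zer C X M"
      using u v Cmp_assoc[OF v(1) T(2,3)] tri_comp_zero[OF t] Zer_Cmp[OF T(7) v(1)] by simp
  qed
  then show thesis using that[OF P _ t epi] by blast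
qed

lemma factor_through_N_approximation:
  assumes P: "P \<in> \<X>" and t: "tri x n m P D M" and f: "f \<in> Hom C D B" and "Xzero f D B"
  obtains v where "v \<in> Hom C M B" "f = v \<cdot> n"
  using tri_coexact[OF t f] XzeroD[OF assms(4) P triD(2)[OF t]] by blast

lemma Xzero_iff_factoring:
  assumes f: "f \<in> Hom C A B"
  shows "Xzero f A B \<longleftrightarrow> f \<in> factoring C \<N>"
proof
  assume z: "Xzero f A B"
  obtain P x M n m where a: "P \<in> \<X>" "M \<in> \<N>" "tri x n m P A M" "Xepi x P A"
    using approximation_triangle[OF Hom_Ob(1)[OF f]] .
  obtain v where v: "v \<in> Hom C M B" "f = v \<cdot> n"
    using factor_through_N_approximation[OF a(1,3) f z] .
  then show "f \<in> factoring C \<N>"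
    unfolding factoring_def using HomD[OF f] triD(3)[OF a(3)] a(2) by blast
next
  assume "f \<in> factoring C \<N>"
  then obtain M u v where M: "M \<in> \<N>" and u: "u \<in> Hom C A M" and v: "v \<in> Hom C M B" and f_eq: "f = v \<cdot> u"
    unfolding factoring_def using HomD[OF f] by auto
  show "Xzero f A B"
    unfolding Xzero_def
  proof (intro ballI)
    fix X x assume X: "X \<in> \<X>" and x: "x \<in> Hom C X A"
    have "u \<cdot> x = Zer C X M" using N_zero[OF M X Cmp_Hom[OF x u]] .
    then show "f \<cdot> x = Zer C X B"
      using f_eq Cmp_assoc[OF x u v] Cmp_Zer[OF X_Ob[OF X] v] by simp
  qed
qed

section \<open>Conflations and the class of an object plus its desuspension\<close>

text \<open>If \<open>H h = 0\<close> then \<open>h\<close> factors through \<open>\<N>\<close>, so \<open>h[-1]\<close> factors through \<open>\<N>[-1]\<close>.\<close>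

lemma Xzero_imp_ER:
  assumes h: "h \<in> Hom C D (shO C A)" and z: "Xzero h D (shO C A)" and A: "A \<in> Ob C"
  shows "h \<in> ER C \<N> D A"
proof -
  obtain M u v where M: "M \<in> \<N>" and u: "u \<in> Hom C D M" and v: "v \<in> Hom C M (shO C A)" and h_eq: "h = v \<cdot> u"
    using z Xzero_iff_factoring[OF h] HomD[OF h] unfolding factoring_def by auto
  have i: "unsh_sh C A \<in> Hom C (unshO C (shO C A)) A" using unsh_sh_iso[OF A] by simp
  note uu = unshA_Hom[OF u] and uv = unshA_Hom[OF v]
  have "y \<cdot> (unsh_sh C A \<cdot> unshA C h) \<in> factoring C (unshO C ` \<N>)" if y: "y \<in> Hom C A M'" for y M'
  proof -
    note iv = Cmp_Hom[OF uv i]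
    have "y \<cdot> (unsh_sh C A \<cdot> unshA C h) = (y \<cdot> (unsh_sh C A \<cdot> unshA C v)) \<cdot> unshA C u"
      using h_eq unshA_Cmp[OF u v] Cmp_assoc[OF uu uv i] Cmp_assoc[OF uu iv y] by simp
    then show ?thesis
      unfolding factoring_def
      using M uu Cmp_Hom[OF iv y] HomD[OF Cmp_Hom[OF uu Cmp_Hom[OF iv y]]] by auto
  qed
  then show ?thesis using h by (auto simp: ER_def)
qed

lemma conflations_R_Ob: "conflations_R C \<N> \<subseteq> Ob C \<times> Ob C \<times> Ob C"
  unfolding conflations_R_def using triD[OF Tri_tri] by auto

lemma triangles_Ob: "triangles C \<subseteq> Ob C \<times> Ob C \<times> Ob C"
  unfolding triangles_def using triD[OF Tri_tri] by auto

lemma tri_triangles: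
  assumes t: "tri f g h A B D"
  shows "(A, B, D) \<in> triangles C"
proof -
  have "Dom C f = A" "Cod C f = B" "Cod C g = D" using HomD[OF triD(2)[OF t]] HomD[OF triD(3)[OF t]] by simp_all
  then show ?thesis unfolding triangles_def using triD(1)[OF t] by blast
qed

abbreviation Rel :: "('o set \<Rightarrow>\<^sub>0 int) set" where
  "Rel \<equiv> K0_relations C (conflations_R C \<N>)"

lemma Rel_add: "\<lbrakk>x \<in> Rel; y \<in> Rel\<rbrakk> \<Longrightarrow> x + y \<in> Rel"
  by (rule K0_relations_add)

lemma Rel_diff: "\<lbrakk>x \<in> Rel; y \<in> Rel\<rbrakk> \<Longrightarrow> x - y \<in> Rel"
  by (rule K0_relations_diff[OF conflations_R_Ob])

lemma Rel_conflation:
  assumes t: "tri f g h A B D" and "Xzero h D (shO C A)"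
  shows "gen C A - gen C B + gen C D \<in> Rel"
proof (rule K0_relations_incl)
  note T = triD[OF t]
  have "h \<in> ER C \<N> D A" using Xzero_imp_ER[OF T(4) assms(2) T(5)] .
  then show "(A, B, D) \<in> conflations_R C \<N>"
    unfolding conflations_R_def using T(1) HomD[OF T(2)] HomD[OF T(3)] by force
qed

text \<open>A triangle desuspends to \<open>A[-1] \<rightarrow> B[-1] \<rightarrow> D[-1] \<rightarrow> A\<close>, and its last arrow is killed by \<open>H\<close>
  when \<open>H f\<close> is a monomorphism.\<close>

lemma tri_desuspend:
  assumes t: "tri f g h A B D"
  obtains w2 w1 k where "tri w2 w1 k (unshO C A) (unshO C B) (unshO C D)"
    "Xmono f A \<Longrightarrow> Xzero k (unshO C D) (shO C (unshO C A))"
proof -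
  obtain w g' where t1: "tri w f g' (unshO C D) A B" using tri_unrotate[OF t] .
  obtain w1 f' where t2: "tri w1 w f' (unshO C B) (unshO C D) A" using tri_unrotate[OF t1] .
  obtain w2 w' where t3: "tri w2 w1 w' (unshO C A) (unshO C B) (unshO C D)" using tri_unrotate[OF t2] .
  have "Xzero w' (unshO C D) (shO C (unshO C A))" if "Xmono f A"
  proof (rule tri_Xzero_of_Xepi[OF t3])
    have w: "Xzero w (unshO C D) A" by (rule tri_Xzero_of_Xmono[OF t1 that])
    show "Xepi w1 (unshO C B) (unshO C D)"
      unfolding Xepi_def
    proof (intro ballI)
      fix X y assume X: "X \<in> \<X>" and y: "y \<in> Hom C X (unshO C D)"
      show "\<exists>x \<in> Hom C X (unshO C B). y = w1 \<cdot> x"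
        using tri_exact[OF t2 y XzeroD[OF w X y]] by blast
    qed
  qed
  then show thesis using that[OF t3] by blast
qed

lemma Rel_desuspended_conflation:
  assumes t: "tri f g h A B D" and "Xmono f A"
  shows "gen C (unshO C A) - gen C (unshO C B) + gen C (unshO C D) \<in> Rel"
  using tri_desuspend[OF t] Rel_conflation assms(2) by metis

lemma Rel_rotated_conflation:
  assumes t: "tri f g h A B D" and epi: "Xepi f A B"
  shows "gen C (unshO C D) - gen C A + gen C B \<in> Rel"
proof -
  note T = triD[OF t]
  obtain w g' where t1: "tri w f g' (unshO C D) A B" using tri_unrotate[OF t] .
  show ?thesis by (rule Rel_conflation[OF t1 tri_Xzero_of_Xepi[OF t1 epi]])
qed

text \<open>The value of \<open>\<theta>\<close> at the class of \<open>Q A\<close>, before passing to the quotient by \<open>Rel\<close>.\<close>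

definition theta_gen :: "'o \<Rightarrow> ('o set \<Rightarrow>\<^sub>0 int)" where
  "theta_gen A = gen C A + gen C (unshO C A)"

lemma theta_gen_closed: "A \<in> Ob C \<Longrightarrow> theta_gen A \<in> carrier (K0_free C)"
  unfolding theta_gen_def by (intro K0_free_add_closed gen_closed unshO_Ob)

text \<open>If \<open>H f\<close> is a monomorphism and \<open>H h = 0\<close>, then both the triangle and its desuspension are
  conflations.\<close>

lemma theta_gen_short_exact:
  assumes t: "tri f g h A B D" and "Xmono f A" and "Xzero h D (shO C A)"
  shows "theta_gen A - theta_gen B + theta_gen D \<in> Rel"
proof -
  have "(gen C A - gen C B + gen C D) + (gen C (unshO C A) - gen C (unshO C B) + gen C (unshO C D)) \<in> Rel"
    by (intro Rel_add Rel_conflation[OF t assms(3)] Rel_desuspended_conflation[OF t assms(2)])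
  then show ?thesis by (simp add: theta_gen_def algebra_simps)
qed

text \<open>For an \<open>H\<close>-isomorphism with cone \<open>D\<close> both \<open>D[-1] \<rightarrow> A \<rightarrow> B\<close> and \<open>A[-1] \<rightarrow> B[-1] \<rightarrow> D[-1]\<close> are
  conflations, and the contributions of \<open>D[-1]\<close> cancel.\<close>

lemma theta_gen_Xiso:
  assumes f: "f \<in> Hom C A B" and "Xmono f A" "Xepi f A B"
  shows "theta_gen B - theta_gen A \<in> Rel"
proof -
  obtain g h D where t: "tri f g h A B D" using cone_ex[OF f] .
  have "(gen C (unshO C D) - gen C A + gen C B)
      - (gen C (unshO C A) - gen C (unshO C B) + gen C (unshO C D)) \<in> Rel"
    by (intro Rel_diff Rel_rotated_conflation[OF t assms(3)] Rel_desuspended_conflation[OF t assms(2)])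
  then show ?thesis by (simp add: theta_gen_def algebra_simps)
qed

lemma gen_unsh_zero_Rel:
  assumes Z: "zero_object C Z"
  shows "gen C (unshO C Z) \<in> Rel"
proof -
  have ZO: "Z \<in> Ob C" using Z by (simp add: zero_object_def)
  note t = tri_Idn[OF ZO Z]
  have "Xmono (Idn C Z) Z" unfolding Xmono_def using Idn_Cmp by auto
  then show ?thesis using Rel_desuspended_conflation[OF t] by simp
qed

lemma tri_through_zero:
  assumes A: "A \<in> Ob C" and Z: "zero_object C Z"
  obtains w z k where "tri w z k (unshO C A) (unshO C Z) A"
  using tri_unrotate[OF tri_Idn[OF A Z]] tri_unrotate by metis

text \<open>For \<open>M \<in> \<N>\<close> the triangle \<open>M[-1] \<rightarrow> 0 \<rightarrow> M\<close> is a conflation, as \<open>H M = 0\<close>.\<close>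

lemma theta_gen_N:
  assumes M: "M \<in> \<N>"
  shows "theta_gen M \<in> Rel"
proof -
  obtain Z where Z: "zero_object C Z" using zero_object_ex by blast
  obtain w z k where t: "tri w z k (unshO C M) (unshO C Z) M" using tri_through_zero[OF N_Ob[OF M] Z] .
  have "Xzero k M (shO C (unshO C M))"
    unfolding Xzero_def
  proof (intro ballI)
    fix X x assume X: "X \<in> \<X>" and x: "x \<in> Hom C X M"
    show "k \<cdot> x = Zer C X (shO C (unshO C M))"
      using N_zero[OF M X x] Cmp_Zer[OF X_Ob[OF X] triD(4)[OF t]] by simp
  qed
  then have "(gen C (unshO C M) - gen C (unshO C Z) + gen C M) + gen C (unshO C Z) \<in> Rel"
    by (intro Rel_add Rel_conflation[OF t] gen_unsh_zero_Rel[OF Z])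
  then show ?thesis by (simp add: theta_gen_def algebra_simps)
qed

lemma gen_sh_unsh: "A \<in> Ob C \<Longrightarrow> gen C (unshO C (shO C A)) = gen C A"
  using iso_class_eqI[of "unsh_sh C A"] unsh_sh_iso[of A] by auto

text \<open>The relation of an arbitrary triangle is a value of \<open>theta_gen\<close>, at an object \<open>I\<close> with \<open>H I\<close> the
  image of \<open>H h\<close>: the cone of an \<open>\<X>\<close>-approximation of \<open>B\<close> followed by \<open>g\<close>. The octahedron on this
  composite relates \<open>I\<close> to \<open>A[1]\<close>.\<close>

lemma triangle_relation_eq_theta_gen:
  assumes t: "tri f g h A B D"
  obtains I where "I \<in> Ob C" "theta_gen I - (gen C A - gen C B + gen C D) \<in> Rel"
proof -
  note T = triD[OF t] and r = tri_rotate[OF t]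
  obtain P x M n m where P: "P \<in> \<X>" and M: "M \<in> \<N>" and a: "tri x n m P B M" and epi: "Xepi x P B"
    using approximation_triangle[OF T(6)] .
  note a' = triD[OF a] and r' = triD[OF r]
  obtain k l I where c: "tri (g \<cdot> x) k l P D I" using cone_ex[OF Cmp_Hom[OF a'(2) T(3)]] .
  note c' = triD[OF c]
  have cod: "Cod C n = M" "Cod C k = I" "Cod C h = shO C A"
    using HomD[OF a'(3)] HomD[OF c'(3)] HomD[OF r'(3)] by auto
  obtain u v where uv: "u \<in> Hom C M I" "v \<in> Hom C I (shO C A)"
    "(u, v, shA C n \<cdot> Neg C (shA C f)) \<in> Tri C"
    using TR4[OF a'(2) T(3) a'(1) r'(1) c'(1)] unfolding cod by blast
  have o: "tri u v (shA C n \<cdot> Neg C (shA C f)) M I (shO C A)"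
    using uv Cmp_Hom[OF r'(4) shA_Hom[OF a'(3)]] by (simp add: tri_def)
  have 1: "gen C P - gen C B + gen C M \<in> Rel"
    by (rule Rel_conflation[OF a Xzero_to_X_sh[OF a'(4) P]])
  have 2: "gen C P - gen C D + gen C I \<in> Rel"
    by (rule Rel_conflation[OF c Xzero_to_X_sh[OF c'(4) P]])
  have 3: "gen C (unshO C M) - gen C (unshO C I) + gen C A \<in> Rel"
    using Rel_desuspended_conflation[OF o Xmono_from_N[OF M]] gen_sh_unsh[OF T(5)] by simp
  have "(gen C P - gen C D + gen C I) - (gen C P - gen C B + gen C M)
      - (gen C (unshO C M) - gen C (unshO C I) + gen C A) + theta_gen M \<in> Rel"
    by (intro Rel_add Rel_diff 1 2 3 theta_gen_N[OF M])
  then have "theta_gen I - (gen C A - gen C B + gen C D) \<in> Rel"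
    by (simp add: theta_gen_def algebra_simps)
  then show thesis using that[OF c'(7)] by blast
qed

text \<open>Adding to \<open>B\<close> the left \<open>\<N>\<close>-approximation \<open>M\<close> of \<open>A\<close> changes nothing under \<open>H\<close>, but it turns \<open>k\<close>
  into an arrow whose cone \<open>K\<close> has \<open>H K = H B / H A\<close>: the suspension of \<open>A \<rightarrow> M\<close> stays a monomorphism
  under \<open>H\<close>, as its fibre lies in \<open>\<X>[1]\<close>. It also makes room to correct \<open>g\<close> so that the composite
  \<open>g \<cdot> k\<close>, which only vanishes under \<open>H\<close>, becomes zero.\<close>

lemma theta_gen_H_exact:
  assumes k: "k \<in> Hom C A B" and g: "g \<in> Hom C B D"
    and mono: "Xmono k A" and epi: "Xepi g B D" and gk: "Xzero (g \<cdot> k) A D"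
    and exact: "\<And>X x. \<lbrakk>X \<in> \<X>; x \<in> Hom C X B; g \<cdot> x = Zer C X D\<rbrakk> \<Longrightarrow> \<exists>u \<in> Hom C X A. x = k \<cdot> u"
  shows "theta_gen A - theta_gen B + theta_gen D \<in> Rel"
proof -
  note Ob = Hom_Ob[OF k] Hom_Ob(2)[OF g]
  obtain P x M n m where P: "P \<in> \<X>" and M: "M \<in> \<N>" and a: "tri x n m P A M" and "Xepi x P A"
    using approximation_triangle[OF Ob(1)] .
  note a' = triD[OF a]
  obtain t where t: "t \<in> Hom C M D" and gk_eq: "g \<cdot> k = t \<cdot> n"
    using factor_through_N_approximation[OF P a Cmp_Hom[OF k g] gk] .
  obtain S where "is_biproduct C B M S" using biproduct_ex[OF Ob(2) N_Ob[OF M]] by blast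
  then obtain i j p q where i: "i \<in> Hom C B S" and j: "j \<in> Hom C M S" and p: "p \<in> Hom C S B"
    and q: "q \<in> Hom C S M" and pi: "p \<cdot> i = Idn C B" and qj: "q \<cdot> j = Idn C M"
    and pj: "p \<cdot> j = Zer C M B" and qi: "q \<cdot> i = Zer C B M"
    and id: "Add C (i \<cdot> p) (j \<cdot> q) = Idn C S"
    unfolding is_biproduct_def by blast
  have SO: "S \<in> Ob C" using Hom_Ob[OF i] by simp
  have qx: "q \<cdot> y = Zer C X M" if "X \<in> \<X>" "y \<in> Hom C X S" for X y
    using N_zero[OF M that(1) Cmp_Hom[OF that(2) q]] .
  have p_mono: "Xmono p S"
  proof (rule XmonoI[OF p])
    fix X y assume X: "X \<in> \<X>" and y: "y \<in> Hom C X S" and py: "p \<cdot> y = Zer C X B"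
    note XO = X_Ob[OF X]
    have "y = Add C (i \<cdot> p) (j \<cdot> q) \<cdot> y" using id Idn_Cmp[OF y] by simp
    also have "\<dots> = Add C (i \<cdot> p \<cdot> y) (j \<cdot> q \<cdot> y)"
      using Cmp_Add_left[OF y Cmp_Hom[OF p i] Cmp_Hom[OF q j]] Cmp_assoc[OF y p i] Cmp_assoc[OF y q j]
      by simp
    also have "\<dots> = Zer C X S"
      using py qx[OF X y] Cmp_Zer[OF XO i] Cmp_Zer[OF XO j] Zer_Add[OF XO SO Zer_Hom[OF XO SO]] by simp
    finally show "y = Zer C X S" .
  qed
  have p_epi: "Xepi p S B"
    unfolding Xepi_def
  proof (intro ballI)
    fix X y assume X: "X \<in> \<X>" and y: "y \<in> Hom C X B"
    have "y = p \<cdot> i \<cdot> y" using Cmp_assoc[OF y i p] pi Idn_Cmp[OF y] by simp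
    then show "\<exists>x \<in> Hom C X S. y = p \<cdot> x" using Cmp_Hom[OF y i] by blast
  qed
  \<comment> \<open>\<open>S\<close> is the sum of \<open>B\<close> and \<open>M\<close>; the corrected pair is \<open>k1 = (k, n)\<close> and \<open>g1 = (g, - t)\<close>.\<close>
  define k1 where "k1 = Add C (i \<cdot> k) (j \<cdot> n)"
  note ik = Cmp_Hom[OF k i] and jn = Cmp_Hom[OF a'(3) j]
  have k1: "k1 \<in> Hom C A S" unfolding k1_def by (rule Add_Hom[OF Ob(1) SO ik jn])
  have pk1: "p \<cdot> k1 = k"
    unfolding k1_def using Cmp_Add_right[OF ik jn p] Cmp_assoc[OF k i p] Cmp_assoc[OF a'(3) j p] pi pj
      Idn_Cmp[OF k] Zer_Cmp[OF Ob(2) a'(3)] Add_Zer[OF Ob(1,2) k] by simp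
  have qk1: "q \<cdot> k1 = n"
    unfolding k1_def using Cmp_Add_right[OF ik jn q] Cmp_assoc[OF k i q] Cmp_assoc[OF a'(3) j q] qi qj
      Idn_Cmp[OF a'(3)] Zer_Cmp[OF N_Ob[OF M] k] Zer_Add[OF Ob(1) N_Ob[OF M] a'(3)] by simp
  define g1 where "g1 = Add C (g \<cdot> p) (Neg C (t \<cdot> q))"
  note gp = Cmp_Hom[OF p g] and tq = Cmp_Hom[OF q t]
  have g1: "g1 \<in> Hom C S D" unfolding g1_def by (rule Add_Hom[OF SO Ob(3) gp Neg_Hom[OF tq]])
  have g1_zero: "g1 \<cdot> y = Zer C Y D \<longleftrightarrow> g \<cdot> p \<cdot> y = t \<cdot> q \<cdot> y" if y: "y \<in> Hom C Y S" for y Y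
    unfolding g1_def using diff_Cmp[OF y gp tq] Cmp_assoc[OF y p g] Cmp_assoc[OF y q t] by simp
  obtain c d K where K: "tri k1 c d A S K" using cone_ex[OF k1] .
  note K' = triD[OF K]
  have "g1 \<cdot> k1 = Zer C A D" using g1_zero[OF k1] pk1 qk1 gk_eq by simp
  then obtain r where r: "r \<in> Hom C K D" and g1_eq: "g1 = r \<cdot> c" using tri_coexact[OF K g1] by blast
  \<comment> \<open>An arrow \<open>d \<cdot> y\<close> is killed by \<open>k1[1]\<close>, hence by \<open>n[1] = q[1] \<cdot> k1[1]\<close>, hence comes from \<open>P[1]\<close>.\<close>
  have d_zero: "Xzero d K (shO C A)"
    unfolding Xzero_def
  proof (intro ballI)
    fix X y assume X: "X \<in> \<X>" and y: "y \<in> Hom C X K"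
    note XO = X_Ob[OF X] and rn = tri_rotate[OF tri_rotate[OF a]] and dy = Cmp_Hom[OF y K'(4)]
    have "Neg C (shA C k1) \<cdot> d = Zer C K (shO C S)"
      using tri_comp_zero[OF tri_rotate[OF tri_rotate[OF K]]] .
    then have kd: "shA C k1 \<cdot> d = Zer C K (shO C S)"
      using Neg_Cmp[OF K'(4) shA_Hom[OF k1]] Neg_eq_Zer_iff[OF Cmp_Hom[OF K'(4) shA_Hom[OF k1]]] by simp
    have "shA C n \<cdot> d \<cdot> y = (shA C q \<cdot> shA C k1) \<cdot> d \<cdot> y" using shA_Cmp[OF k1 q] qk1 by simp
    also have "\<dots> = shA C q \<cdot> (shA C k1 \<cdot> d) \<cdot> y"
      using Cmp_assoc[OF dy shA_Hom[OF k1] shA_Hom[OF q]] Cmp_assoc[OF y K'(4) shA_Hom[OF k1]] by simp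
    also have "\<dots> = Zer C X (shO C M)"
      using kd Zer_Cmp[OF shO_Ob[OF SO] y] Cmp_Zer[OF XO shA_Hom[OF q]] by simp
    finally have "Neg C (shA C n) \<cdot> d \<cdot> y = Zer C X (shO C M)"
      using Neg_Cmp[OF dy shA_Hom[OF a'(3)]] Neg_Zer[OF XO shO_Ob[OF N_Ob[OF M]]] by simp
    then obtain s where s: "s \<in> Hom C X (shO C P)" "d \<cdot> y = Neg C (shA C x) \<cdot> s"
      using tri_exact[OF tri_rotate[OF rn] dy] by blast
    then show "d \<cdot> y = Zer C X (shO C A)"
      using X_sh_zero[OF P X s(1)] Cmp_Zer[OF XO Neg_Hom[OF shA_Hom[OF a'(2)]]] by simp
  qed
  have k1_mono: "Xmono k1 A"
    unfolding Xmono_def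
  proof (intro ballI impI)
    fix X y z assume X: "X \<in> \<X>" and y: "y \<in> Hom C X A" and z: "z \<in> Hom C X A" and eq: "k1 \<cdot> y = k1 \<cdot> z"
    have "k \<cdot> y = k \<cdot> z" using eq Cmp_assoc[OF y k1 p] Cmp_assoc[OF z k1 p] pk1 by simp
    then show "y = z" using XmonoD[OF mono X y z] by simp
  qed
  have r_epi: "Xepi r K D"
    unfolding Xepi_def
  proof (intro ballI)
    fix X y assume X: "X \<in> \<X>" and y: "y \<in> Hom C X D"
    obtain z where z: "z \<in> Hom C X B" "y = g \<cdot> z" using XepiE[OF epi X y] .
    obtain w where w: "w \<in> Hom C X S" "z = p \<cdot> w" using XepiE[OF p_epi X z(1)] .
    have "r \<cdot> c \<cdot> w = g1 \<cdot> w" using Cmp_assoc[OF w(1) K'(3) r] g1_eq by simp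
    also have "\<dots> = Add C (g \<cdot> p \<cdot> w) (Neg C (t \<cdot> q) \<cdot> w)"
      unfolding g1_def using Cmp_Add_left[OF w(1) gp Neg_Hom[OF tq]] Cmp_assoc[OF w(1) p g] by simp
    also have "Neg C (t \<cdot> q) \<cdot> w = Zer C X D"
      using Neg_Cmp[OF w(1) tq] Cmp_assoc[OF w(1) q t] qx[OF X w(1)] Cmp_Zer[OF X_Ob[OF X] t]
        Neg_Zer[OF X_Ob[OF X] Ob(3)] by simp
    finally have "y = r \<cdot> c \<cdot> w" using z w Add_Zer[OF X_Ob[OF X] Ob(3) y] by simp
    then show "\<exists>x \<in> Hom C X K. y = r \<cdot> x" using Cmp_Hom[OF w(1) K'(3)] by blast
  qed
  have r_mono: "Xmono r K"
  proof (rule XmonoI[OF r])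
    fix X z assume X: "X \<in> \<X>" and z: "z \<in> Hom C X K" and rz: "r \<cdot> z = Zer C X D"
    obtain w where w: "w \<in> Hom C X S" "z = c \<cdot> w"
      using XepiE[OF tri_Xepi_of_Xzero[OF K d_zero] X z] .
    have "g1 \<cdot> w = Zer C X D" using rz w Cmp_assoc[OF w(1) K'(3) r] g1_eq by simp
    then have "g \<cdot> p \<cdot> w = Zer C X D"
      using g1_zero[OF w(1)] qx[OF X w(1)] Cmp_Zer[OF X_Ob[OF X] t] by simp
    then obtain u where u: "u \<in> Hom C X A" "p \<cdot> w = k \<cdot> u"
      using exact[OF X Cmp_Hom[OF w(1) p]] by blast
    have "p \<cdot> w = p \<cdot> k1 \<cdot> u" using u Cmp_assoc[OF u(1) k1 p] pk1 by simp
    then have "w = k1 \<cdot> u" using XmonoD[OF p_mono X w(1) Cmp_Hom[OF u(1) k1]] by simp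
    then show "z = Zer C X K"
      using w Cmp_assoc[OF u(1) k1 K'(3)] tri_comp_zero[OF K] Zer_Cmp[OF K'(7) u(1)] by simp
  qed
  have "(theta_gen A - theta_gen S + theta_gen K) - (theta_gen B - theta_gen S) + (theta_gen D - theta_gen K) \<in> Rel"
    by (intro Rel_add Rel_diff theta_gen_short_exact[OF K k1_mono d_zero] theta_gen_Xiso[OF p p_mono p_epi]
        theta_gen_Xiso[OF r r_mono r_epi])
  moreover have "(theta_gen A - theta_gen S + theta_gen K) - (theta_gen B - theta_gen S) + (theta_gen D - theta_gen K) = theta_gen A - theta_gen B + theta_gen D"
    by (simp add: algebra_simps)
  ultimately show ?thesis by simp
qed

end

section \<open>Localizations\<close>

context category
begin

lemma zigzag_Ob: "zigzag C S A p B \<Longrightarrow> A \<in> Ob C \<and> B \<in> Ob C"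
proof (induction p arbitrary: A)
  case (Cons s p)
  then show ?case using Dom_Ob Cod_Ob by (cases s) auto
qed simp

lemma zigzag_append: "\<lbrakk>zigzag C S A p B; zigzag C S B q D\<rbrakk> \<Longrightarrow> zigzag C S A (p @ q) D"
proof (induction p arbitrary: A)
  case (Cons s p)
  then show ?case by (cases s) auto
qed simp

lemma zigzag_Fwd: "f \<in> Hom C A B \<Longrightarrow> zigzag C S A [Fwd f] B"
  using HomD[of f C A B] Hom_Ob[of f A B] by simp

lemma zigzag_Bwd: "\<lbrakk>s \<in> S; s \<in> Hom C A B\<rbrakk> \<Longrightarrow> zigzag C S B [Bwd s] A"
  using HomD[of s C A B] Hom_Ob[of s A B] by simp

lemma zigzag_eq_zigzag: "zigzag_eq C S A p q B \<Longrightarrow> zigzag C S A p B \<and> zigzag C S A q B"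
proof (induction rule: zigzag_eq.induct)
  case (append A p p' B q q' D)
  then show ?case using zigzag_append by blast
next
  case (Idn A)
  then show ?case using zigzag_Fwd[OF Idn_Hom] by simp
next
  case (Cmp f A B g D)
  then show ?case
    using zigzag_append[OF zigzag_Fwd[OF Cmp(1)] zigzag_Fwd[OF Cmp(2)]] zigzag_Fwd[OF Cmp_Hom[OF Cmp]]
    by (simp del: zigzag.simps)
next
  case (Fwd_Bwd s A B)
  have "zigzag C S A [] A" using Hom_Ob[OF Fwd_Bwd(2)] by simp
  then show ?case
    using zigzag_append[OF zigzag_Fwd[OF Fwd_Bwd(2)] zigzag_Bwd[OF Fwd_Bwd]] by (simp del: zigzag.simps)
next
  case (Bwd_Fwd s A B)
  have "zigzag C S B [] B" using Hom_Ob[OF Bwd_Fwd(2)] by simp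
  then show ?case
    using zigzag_append[OF zigzag_Bwd[OF Bwd_Fwd] zigzag_Fwd[OF Bwd_Fwd(2)]] by (simp del: zigzag.simps)
qed auto

lemma zigzag_class_eq_iff:
  assumes "zigzag C S A p B"
  shows "zigzag_class C S A p B = zigzag_class C S A q B \<longleftrightarrow> zigzag_eq C S A p q B"
proof
  assume "zigzag_class C S A p B = zigzag_class C S A q B"
  then have "{r. zigzag_eq C S A p r B} = {r. zigzag_eq C S A q r B}" by (simp add: zigzag_class_def)
  then have "zigzag_eq C S A q p B" using zigzag_eq.refl[OF assms] by blast
  then show "zigzag_eq C S A p q B" by (rule zigzag_eq.sym)
next
  assume "zigzag_eq C S A p q B"
  then have "zigzag_eq C S A p r B \<longleftrightarrow> zigzag_eq C S A q r B" for r
    using zigzag_eq.trans zigzag_eq.sym by metis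
  then show "zigzag_class C S A p B = zigzag_class C S A q B" by (simp add: zigzag_class_def)
qed

lemma Ob_localization [simp]: "Ob (localization C S) = Ob C"
  by (simp add: localization_def)

lemma Hom_localization:
  "Hom (localization C S) A B = {zigzag_class C S A p B |p. zigzag C S A p B}"
  by (auto simp: Hom_def localization_def zigzag_class_def)

lemma Cmp_localization:
  assumes p: "zigzag C S A p B" and q: "zigzag C S B q D"
  shows "zigzag_class C S B q D \<cdot>\<^bsub>localization C S\<^esub> zigzag_class C S A p B = zigzag_class C S A (p @ q) D"
proof -
  have p': "zigzag_eq C S A p (SOME r. zigzag_eq C S A p r B) B"
    by (rule someI[of "\<lambda>r. zigzag_eq C S A p r B", OF zigzag_eq.refl[OF p]])
  have q': "zigzag_eq C S B q (SOME r. zigzag_eq C S B q r D) D"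
    by (rule someI[of "\<lambda>r. zigzag_eq C S B q r D", OF zigzag_eq.refl[OF q]])
  have "zigzag_class C S B q D \<cdot>\<^bsub>localization C S\<^esub> zigzag_class C S A p B
      = zigzag_class C S A ((SOME r. zigzag_eq C S A p r B) @ (SOME r. zigzag_eq C S B q r D)) D"
    by (simp add: localization_def zigzag_class_def)
  also have "\<dots> = zigzag_class C S A (p @ q) D"
    using iffD2[OF zigzag_class_eq_iff[OF zigzag_append[OF p q]] zigzag_eq.append[OF p' q']] by metis
  finally show ?thesis .
qed

lemma Idn_localization: "Idn (localization C S) A = zigzag_class C S A [] A"
  by (simp add: localization_def)

lemma category_localization: "category (localization C S)"
proof
  let ?L = "localization C S"
  fix f assume "f \<in> Ar ?L"
  then obtain A p B where "f = zigzag_class C S A p B" "zigzag C S A p B"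
    by (auto simp: localization_def)
  then show "Dom ?L f \<in> Ob ?L" "Cod ?L f \<in> Ob ?L"
    using zigzag_Ob[of S A p B] by (auto simp: localization_def zigzag_class_def)
next
  let ?L = "localization C S"
  fix A assume "A \<in> Ob ?L"
  then have "zigzag C S A [] A" by simp
  then show "Idn ?L A \<in> Hom ?L A A" by (auto simp: Idn_localization Hom_localization)
next
  let ?L = "localization C S"
  fix f A B g D assume f: "f \<in> Hom ?L A B" and g: "g \<in> Hom ?L B D"
  obtain p where p: "f = zigzag_class C S A p B" "zigzag C S A p B" using f by (auto simp: Hom_localization)
  obtain q where q: "g = zigzag_class C S B q D" "zigzag C S B q D" using g by (auto simp: Hom_localization)
  show "g \<cdot>\<^bsub>?L\<^esub> f \<in> Hom ?L A D"
    using Cmp_localization[OF p(2) q(2)] zigzag_append[OF p(2) q(2)] by (auto simp: p(1) q(1) Hom_localization)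
  fix E h assume h: "h \<in> Hom ?L D E"
  obtain r where r: "h = zigzag_class C S D r E" "zigzag C S D r E" using h by (auto simp: Hom_localization)
  show "h \<cdot>\<^bsub>?L\<^esub> g \<cdot>\<^bsub>?L\<^esub> f = (h \<cdot>\<^bsub>?L\<^esub> g) \<cdot>\<^bsub>?L\<^esub> f"
    using Cmp_localization[OF p(2) q(2)] Cmp_localization[OF q(2) r(2)]
      Cmp_localization[OF zigzag_append[OF p(2) q(2)] r(2)]
      Cmp_localization[OF p(2) zigzag_append[OF q(2) r(2)]]
    by (simp add: p(1) q(1) r(1))
next
  let ?L = "localization C S"
  fix f A B assume f: "f \<in> Hom ?L A B"
  obtain p where p: "f = zigzag_class C S A p B" "zigzag C S A p B" using f by (auto simp: Hom_localization)
  have AB: "zigzag C S A [] A" "zigzag C S B [] B" using zigzag_Ob[OF p(2)] by simp_all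
  show "f \<cdot>\<^bsub>?L\<^esub> Idn ?L A = f"
    using Cmp_localization[OF AB(1) p(2)] by (simp add: p(1) Idn_localization)
  show "Idn ?L B \<cdot>\<^bsub>?L\<^esub> f = f"
    using Cmp_localization[OF p(2) AB(2)] by (simp add: p(1) Idn_localization)
qed

lemma localization_inverts:
  assumes s: "s \<in> S" "s \<in> Hom C A B"
  shows "is_iso (localization C S) (zigzag_class C S A [Fwd s] B)"
proof -
  interpret L: category "localization C S" by (rule category_localization)
  note f = zigzag_Fwd[OF s(2), of S] and b = zigzag_Bwd[OF s]
  show ?thesis
  proof (rule L.is_isoI)
    show "zigzag_class C S A [Fwd s] B \<in> Hom (localization C S) A B"
      "zigzag_class C S B [Bwd s] A \<in> Hom (localization C S) B A"
      using f b by (auto simp: Hom_localization)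
    show "zigzag_class C S B [Bwd s] A \<cdot>\<^bsub>localization C S\<^esub> zigzag_class C S A [Fwd s] B = Idn (localization C S) A"
      using Cmp_localization[OF f b] zigzag_class_eq_iff[OF zigzag_append[OF f b]] zigzag_eq.Fwd_Bwd[OF s]
      by (simp add: Idn_localization)
    show "zigzag_class C S A [Fwd s] B \<cdot>\<^bsub>localization C S\<^esub> zigzag_class C S B [Bwd s] A = Idn (localization C S) B"
      using Cmp_localization[OF b f] zigzag_class_eq_iff[OF zigzag_append[OF b f]] zigzag_eq.Bwd_Fwd[OF s]
      by (simp add: Idn_localization)
  qed
qed

end

section \<open>Comparing the quotient category with the restricted Yoneda functor\<close>

context rigid_subcategory
begin

abbreviation cls :: "'m \<Rightarrow> 'm set" where
  "cls \<equiv> ideal_class C \<N>"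

abbreviation C_mod_N :: "('o, 'm set) cat" where
  "C_mod_N \<equiv> ideal_quotient C \<N>"

abbreviation W :: "'m set set" where
  "W \<equiv> cls ` SN C \<N>"

text \<open>Since an arrow factors through \<open>\<N>\<close> exactly when \<open>H\<close> kills it, the ideal quotient identifies
  two arrows exactly when \<open>H\<close> does.\<close>

lemma ideal_class_eq:
  assumes f: "f \<in> Hom C A B"
  shows "cls f = {g \<in> Hom C A B. Xeq g f A}"
proof -
  have "Add C g (Neg C f) \<in> factoring C \<N> \<longleftrightarrow> Xeq g f A" if g: "g \<in> Hom C A B" for g
  proof -
    have d: "Add C g (Neg C f) \<in> Hom C A B" by (rule Add_Hom[OF Hom_Ob[OF f] g Neg_Hom[OF f]])
    show ?thesis
      unfolding Xzero_iff_factoring[OF d, symmetric] Xzero_def Xeq_def using diff_Cmp[OF _ g f] by blast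
  qed
  then show ?thesis using HomD[OF f] by (auto simp: ideal_class_def)
qed

lemma cls_self: "f \<in> Hom C A B \<Longrightarrow> f \<in> cls f"
  by (simp add: ideal_class_eq Xeq_def)

lemma cls_eq_iff:
  assumes "f \<in> Hom C A B" "g \<in> Hom C A B"
  shows "cls f = cls g \<longleftrightarrow> Xeq f g A"
  unfolding ideal_class_eq[OF assms(1)] ideal_class_eq[OF assms(2)] using assms
  by (auto simp: Xeq_def)

lemma some_cls:
  assumes f: "f \<in> Hom C A B"
  shows "(SOME g. g \<in> cls f) \<in> Hom C A B" "Xeq (SOME g. g \<in> cls f) f A"
proof -
  have "(SOME g. g \<in> cls f) \<in> cls f" by (rule someI[of "\<lambda>g. g \<in> cls f", OF cls_self[OF f]])
  then show "(SOME g. g \<in> cls f) \<in> Hom C A B" "Xeq (SOME g. g \<in> cls f) f A"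
    unfolding ideal_class_eq[OF f] by simp_all
qed

lemma Ob_C_mod_N [simp]: "Ob C_mod_N = Ob C"
  by (simp add: ideal_quotient_def)

lemma Dom_Cod_cls:
  assumes "f \<in> Hom C A B"
  shows "Dom C_mod_N (cls f) = A" "Cod C_mod_N (cls f) = B"
  using HomD[OF some_cls(1)[OF assms]] by (simp_all add: ideal_quotient_def)

lemma cls_Hom:
  assumes f: "f \<in> Hom C A B"
  shows "cls f \<in> Hom C_mod_N A B"
proof (rule HomI[OF _ Dom_Cod_cls[OF f]])
  show "cls f \<in> Ar C_mod_N" using HomD(1)[OF f] by (simp add: ideal_quotient_def)
qed

lemma Hom_C_mod_N:
  assumes "F \<in> Hom C_mod_N A B"
  obtains f where "f \<in> Hom C A B" "F = cls f"
proof -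
  obtain f where f: "f \<in> Ar C" "F = cls f" using HomD(1)[OF assms] by (auto simp: ideal_quotient_def)
  then have "f \<in> Hom C (Dom C f) (Cod C f)" by (simp add: HomI)
  then show thesis using that f Dom_Cod_cls[of f] HomD(2,3)[OF assms] by metis
qed

lemma Cmp_cls:
  assumes f: "f \<in> Hom C A B" and g: "g \<in> Hom C B D"
  shows "cls g \<cdot>\<^bsub>C_mod_N\<^esub> cls f = cls (g \<cdot> f)"
proof -
  let ?f = "SOME f'. f' \<in> cls f" and ?g = "SOME g'. g' \<in> cls g"
  note f' = some_cls[OF f] and g' = some_cls[OF g]
  have "Xeq (?g \<cdot> ?f) (g \<cdot> f) A"
    unfolding Xeq_def
  proof (intro ballI)
    fix X x assume X: "X \<in> \<X>" and x: "x \<in> Hom C X A"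
    have "(?g \<cdot> ?f) \<cdot> x = ?g \<cdot> f \<cdot> x" using Cmp_assoc[OF x f'(1) g'(1)] XeqD[OF f'(2) X x] by simp
    also have "\<dots> = (g \<cdot> f) \<cdot> x" using Cmp_assoc[OF x f g] XeqD[OF g'(2) X Cmp_Hom[OF x f]] by simp
    finally show "(?g \<cdot> ?f) \<cdot> x = (g \<cdot> f) \<cdot> x" .
  qed
  then show ?thesis
    using cls_eq_iff[OF Cmp_Hom[OF f'(1) g'(1)] Cmp_Hom[OF f g]] by (simp add: ideal_quotient_def)
qed

lemma Idn_C_mod_N: "Idn C_mod_N A = cls (Idn C A)"
  by (simp add: ideal_quotient_def)

lemma category_C_mod_N: "category C_mod_N"
proof
  fix F assume "F \<in> Ar C_mod_N"
  then have F: "F \<in> Hom C_mod_N (Dom C_mod_N F) (Cod C_mod_N F)" by (simp add: HomI)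
  then obtain f where "f \<in> Hom C (Dom C_mod_N F) (Cod C_mod_N F)" using Hom_C_mod_N by blast
  then show "Dom C_mod_N F \<in> Ob C_mod_N" "Cod C_mod_N F \<in> Ob C_mod_N"
    using Hom_Ob by simp_all
next
  fix A assume "A \<in> Ob C_mod_N"
  then show "Idn C_mod_N A \<in> Hom C_mod_N A A" using cls_Hom[OF Idn_Hom] by (simp add: Idn_C_mod_N)
next
  fix F A B G D assume F: "F \<in> Hom C_mod_N A B" and G: "G \<in> Hom C_mod_N B D"
  obtain f where f: "f \<in> Hom C A B" "F = cls f" using Hom_C_mod_N[OF F] .
  obtain g where g: "g \<in> Hom C B D" "G = cls g" using Hom_C_mod_N[OF G] .
  show "G \<cdot>\<^bsub>C_mod_N\<^esub> F \<in> Hom C_mod_N A D"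
    using Cmp_cls[OF f(1) g(1)] cls_Hom[OF Cmp_Hom[OF f(1) g(1)]] f(2) g(2) by simp
  fix E K assume K: "K \<in> Hom C_mod_N D E"
  obtain k where k: "k \<in> Hom C D E" "K = cls k" using Hom_C_mod_N[OF K] .
  show "K \<cdot>\<^bsub>C_mod_N\<^esub> G \<cdot>\<^bsub>C_mod_N\<^esub> F = (K \<cdot>\<^bsub>C_mod_N\<^esub> G) \<cdot>\<^bsub>C_mod_N\<^esub> F"
    using Cmp_cls[OF f(1) g(1)] Cmp_cls[OF g(1) k(1)] Cmp_cls[OF Cmp_Hom[OF f(1) g(1)] k(1)]
      Cmp_cls[OF f(1) Cmp_Hom[OF g(1) k(1)]] Cmp_assoc[OF f(1) g(1) k(1)]
    by (simp add: f(2) g(2) k(2))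
next
  fix F A B assume F: "F \<in> Hom C_mod_N A B"
  obtain f where f: "f \<in> Hom C A B" "F = cls f" using Hom_C_mod_N[OF F] .
  note AB = Hom_Ob[OF f(1)]
  show "F \<cdot>\<^bsub>C_mod_N\<^esub> Idn C_mod_N A = F"
    using Cmp_cls[OF Idn_Hom[OF AB(1)] f(1)] Cmp_Idn[OF f(1)] by (simp add: Idn_C_mod_N f(2))
  show "Idn C_mod_N B \<cdot>\<^bsub>C_mod_N\<^esub> F = F"
    using Cmp_cls[OF f(1) Idn_Hom[OF AB(2)]] Idn_Cmp[OF f(1)] by (simp add: Idn_C_mod_N f(2))
qed

interpretation I: category C_mod_N
  by (rule category_C_mod_N)

text \<open>\<open>H\<close> inverts \<open>\<S>\<^sub>\<N>\<close>: membership of the connecting arrow in \<open>EL\<close> is tested on the identity of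
  the cone in the first case, membership in \<open>ER\<close> on the identity of the fibre in the second.\<close>

lemma EN_cone_Xmono:
  assumes t: "tri f g h A B D" and D: "D \<in> \<N>" and h: "h \<in> EN C \<N> D A"
  shows "Xmono f A"
proof (rule XmonoI)
  note T = triD[OF t]
  show "f \<in> Hom C A B" by (rule T(2))
  have "h \<cdot> Idn C D \<in> factoring C (shO C ` \<N>)"
    using h D Idn_Hom[OF T(7)] unfolding EN_def EL_def by blast
  then obtain M u v where M: "M \<in> \<N>" and u: "u \<in> Hom C D (shO C M)"
    and v: "v \<in> Hom C (shO C M) (shO C A)" and h_eq: "h = v \<cdot> u"
    unfolding Cmp_Idn[OF T(4)] factoring_def using HomD[OF T(4)] by auto
  obtain w where w: "w \<in> Hom C M A" "shA C w = v" using shA_full[OF N_Ob[OF M] T(5) v] .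
  fix X x assume X: "X \<in> \<X>" and x: "x \<in> Hom C X A" and fx: "f \<cdot> x = Zer C X B"
  note XO = X_Ob[OF X] and sx = shA_Hom[OF x]
  have "Neg C (shA C f) \<cdot> shA C x = Zer C (shO C X) (shO C B)"
    using Neg_Cmp[OF sx shA_Hom[OF T(2)]] shA_Cmp[OF x T(2)] fx shA_Zer[OF XO T(6)]
      Neg_Zer[OF shO_Ob[OF XO] shO_Ob[OF T(6)]] by simp
  then obtain y where y: "y \<in> Hom C (shO C X) D" "shA C x = h \<cdot> y"
    using tri_exact[OF tri_rotate[OF tri_rotate[OF t]] sx] by blast
  obtain z where z: "z \<in> Hom C X M" "shA C z = u \<cdot> y" using shA_full[OF XO N_Ob[OF M] Cmp_Hom[OF y(1) u]] .
  have "shA C x = shA C (w \<cdot> z)"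
    using y(2) h_eq Cmp_assoc[OF y(1) u v] z w shA_Cmp[OF z(1) w(1)] by simp
  then have "x = w \<cdot> z" using shA_faithful[OF x Cmp_Hom[OF z(1) w(1)]] by simp
  then show "x = Zer C X A" using N_zero[OF M X z(1)] Cmp_Zer[OF XO w(1)] by simp
qed

lemma EN_cocone_Xzero:
  assumes t: "tri f g h A B D" and A: "A \<in> \<N>" and h: "h \<in> EN C \<N> D A"
  shows "Xzero h D (shO C A)"
  unfolding Xzero_def
proof (intro ballI)
  note T = triD[OF t]
  have i: "unsh_sh C A \<in> Hom C (unshO C (shO C A)) A" using unsh_sh_iso[OF T(5)] by simp
  have e: "sh_unsh C D \<in> Hom C (shO C (unshO C D)) D" "is_iso C (sh_unsh C D)"
    using sh_unsh_iso[OF T(7)] by auto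
  obtain e' where e': "e' \<in> Hom C D (shO C (unshO C D))" "sh_unsh C D \<cdot> e' = Idn C D"
    using is_isoE[OF e(2,1)] by blast
  note uh = unshA_Hom[OF T(4)]
  note h' = Cmp_Hom[OF uh i]
  have "Idn C A \<cdot> (unsh_sh C A \<cdot> unshA C h) \<in> factoring C (unshO C ` \<N>)"
    using h A Idn_Hom[OF T(5)] unfolding EN_def ER_def by blast
  then obtain M u v where M: "M \<in> \<N>" and u: "u \<in> Hom C (unshO C D) (unshO C M)"
    and v: "v \<in> Hom C (unshO C M) A" and uv: "unsh_sh C A \<cdot> unshA C h = v \<cdot> u"
    unfolding Idn_Cmp[OF h'] factoring_def using HomD[OF h'] by auto
  have eM: "sh_unsh C M \<in> Hom C (shO C (unshO C M)) M" "is_iso C (sh_unsh C M)"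
    using sh_unsh_iso[OF N_Ob[OF M]] by auto
  have "shA C (v \<cdot> u) = h \<cdot> sh_unsh C D"
    using uv shA_Cmp[OF uh i] sh_unsh_natural[OF T(4)] unsh_sh_adjoint[OF T(5)] by simp
  then have he: "h \<cdot> sh_unsh C D = shA C v \<cdot> shA C u" using shA_Cmp[OF u v] by simp
  fix X x assume X: "X \<in> \<X>" and x: "x \<in> Hom C X D"
  note XO = X_Ob[OF X] and ex = Cmp_Hom[OF x e'(1)] and su = shA_Hom[OF u] and sv = shA_Hom[OF v]
  let ?y = "shA C u \<cdot> e' \<cdot> x"
  have y: "?y \<in> Hom C X (shO C (unshO C M))" by (rule Cmp_Hom[OF ex su])
  have "?y = Zer C X (shO C (unshO C M))"
  proof (rule iso_cancel_left[OF eM y])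
    show Z: "Zer C X (shO C (unshO C M)) \<in> Hom C X (shO C (unshO C M))" by (rule Zer_Hom[OF Hom_Ob[OF y]])
    show "sh_unsh C M \<cdot> ?y = sh_unsh C M \<cdot> Zer C X (shO C (unshO C M))"
      using N_zero[OF M X Cmp_Hom[OF y eM(1)]] Cmp_Zer[OF XO eM(1)] by simp
  qed
  moreover have "h \<cdot> x = shA C v \<cdot> ?y"
  proof -
    have "h \<cdot> x = h \<cdot> sh_unsh C D \<cdot> e' \<cdot> x"
      using Cmp_assoc[OF x e'(1) e(1)] e'(2) Idn_Cmp[OF x] by simp
    also have "\<dots> = (shA C v \<cdot> shA C u) \<cdot> e' \<cdot> x" using Cmp_assoc[OF ex e(1) T(4)] he by simp
    finally show ?thesis using Cmp_assoc[OF ex su sv] by simp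
  qed
  ultimately show "h \<cdot> x = Zer C X (shO C A)" using Cmp_Zer[OF XO sv] by simp
qed

lemma SN_Xiso:
  assumes "s \<in> SN C \<N>"
  shows "s \<in> Ar C \<and> Xmono s (Dom C s) \<and> Xepi s (Dom C s) (Cod C s)"
  using assms
proof (induction rule: SN.induct)
  case (cone f g h)
  note t = Tri_tri[OF cone(1)]
  note T = triD[OF t]
  have "Xzero g (Cod C f) (Cod C g)" by (rule Xzero_to_N[OF T(3) cone(3)])
  then have "Xepi f (Dom C f) (Cod C f)"
    unfolding Xepi_def using tri_exact[OF t] XzeroD by metis
  then show ?case using EN_cone_Xmono[OF t cone(3,2)] HomD(1)[OF T(2)] by simp
next
  case (cocone f g h)
  note t = Tri_tri[OF cocone(1)]
  note T = triD[OF t]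
  have "Xzero f (Dom C f) (Cod C f)"
    unfolding Xzero_def
  proof (intro ballI)
    fix X x assume X: "X \<in> \<X>" and x: "x \<in> Hom C X (Dom C f)"
    show "f \<cdot> x = Zer C X (Cod C f)"
      unfolding N_zero[OF cocone(3) X x] by (rule Cmp_Zer[OF X_Ob[OF X] T(2)])
  qed
  then show ?case
    using tri_Xmono_of_Xzero[OF t] tri_Xepi_of_Xzero[OF t EN_cocone_Xzero[OF t cocone(3,2)]] HomD[OF T(3)]
    by simp
next
  case (comp f g)
  have f: "f \<in> Hom C (Dom C f) (Cod C f)" and g: "g \<in> Hom C (Cod C f) (Cod C g)"
    using comp by (simp_all add: HomI)
  note gf = HomD[OF Cmp_Hom[OF f g]]
  have "Xmono (g \<cdot> f) (Dom C f)"
    unfolding Xmono_def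
  proof (intro ballI impI)
    fix X x y assume X: "X \<in> \<X>" and x: "x \<in> Hom C X (Dom C f)" and y: "y \<in> Hom C X (Dom C f)"
      and "(g \<cdot> f) \<cdot> x = (g \<cdot> f) \<cdot> y"
    then have "g \<cdot> f \<cdot> x = g \<cdot> f \<cdot> y" using Cmp_assoc[OF x f g] Cmp_assoc[OF y f g] by simp
    then have "f \<cdot> x = f \<cdot> y"
      using comp XmonoD[of g "Cod C f" X] X Cmp_Hom[OF x f] Cmp_Hom[OF y f] by simp
    then show "x = y" using comp XmonoD[of f "Dom C f" X] X x y by simp
  qed
  moreover have "Xepi (g \<cdot> f) (Dom C f) (Cod C g)"
    unfolding Xepi_def
  proof (intro ballI)
    fix X y assume X: "X \<in> \<X>" and y: "y \<in> Hom C X (Cod C g)"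
    obtain z where z: "z \<in> Hom C X (Cod C f)" "y = g \<cdot> z"
      using comp XepiE[of g "Cod C f" "Cod C g" X y] X y by auto
    obtain x where x: "x \<in> Hom C X (Dom C f)" "z = f \<cdot> x"
      using comp XepiE[of f "Dom C f" "Cod C f" X z] X z by auto
    show "\<exists>x \<in> Hom C X (Dom C f). y = (g \<cdot> f) \<cdot> x"
      using x z Cmp_assoc[OF x(1) f g] by auto
  qed
  ultimately show ?case using gf by simp
qed

text \<open>The relation that a zigzag from \<open>A\<close> to \<open>B\<close> induces between \<open>Hom C X A\<close> and \<open>Hom C X B\<close>. It is
  the graph of the map induced on the localization by \<open>H\<close>.\<close>

fun act :: "'o \<Rightarrow> 'm set step list \<Rightarrow> 'm \<Rightarrow> 'm \<Rightarrow> bool" where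
  "act X [] x y \<longleftrightarrow> x = y"
| "act X (Fwd F # p) x y \<longleftrightarrow> (\<exists>f \<in> F. act X p (f \<cdot> x) y)"
| "act X (Bwd F # p) x y \<longleftrightarrow> (\<exists>f \<in> F. \<exists>z \<in> Hom C X (Dom C f). f \<cdot> z = x \<and> act X p z y)"

lemma act_append: "act X (p @ q) x y \<longleftrightarrow> (\<exists>z. act X p x z \<and> act X q z y)"
proof (induction p arbitrary: x)
  case (Cons s p)
  then show ?case by (cases s) auto
qed simp

lemma act_Fwd:
  assumes f: "f \<in> Hom C A B" and X: "X \<in> \<X>" and x: "x \<in> Hom C X A"
  shows "act X (Fwd (cls f) # p) x y \<longleftrightarrow> act X p (f \<cdot> x) y"
proof -
  have "f' \<cdot> x = f \<cdot> x" if "f' \<in> cls f" for f'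
    using that XeqD[of f' f A, OF _ X x] unfolding ideal_class_eq[OF f] by simp
  moreover have "f \<in> cls f" by (rule cls_self[OF f])
  ultimately show ?thesis unfolding act.simps by metis
qed

lemma act_Bwd:
  assumes s: "s \<in> Hom C A B" and X: "X \<in> \<X>"
  shows "act X (Bwd (cls s) # p) x y \<longleftrightarrow> (\<exists>z \<in> Hom C X A. s \<cdot> z = x \<and> act X p z y)"
proof -
  have "Dom C s' = A \<and> (\<forall>z \<in> Hom C X A. s' \<cdot> z = s \<cdot> z)" if "s' \<in> cls s" for s'
    using that XeqD[of s' s A, OF _ X] HomD(2)[of s' C A B] unfolding ideal_class_eq[OF s] by simp
  moreover have "s \<in> cls s" by (rule cls_self[OF s])
  ultimately show ?thesis unfolding act.simps by metis
qed

lemma W_elem: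
  assumes "F \<in> W" "F \<in> Hom C_mod_N A B"
  obtains s where "s \<in> SN C \<N>" "s \<in> Hom C A B" "F = cls s" "Xmono s A" "Xepi s A B"
proof -
  obtain s where s: "s \<in> SN C \<N>" "F = cls s" using assms by blast
  note iso = SN_Xiso[OF s(1)]
  have sH: "s \<in> Hom C (Dom C s) (Cod C s)" using iso by (simp add: HomI)
  have "Dom C s = A" "Cod C s = B" using Dom_Cod_cls[OF sH] s(2) HomD[OF assms(2)] by simp_all
  then show thesis using that s sH iso by simp
qed

lemma act_Hom:
  assumes "zigzag C_mod_N W A p B" "X \<in> \<X>" "x \<in> Hom C X A" "act X p x y"
  shows "y \<in> Hom C X B"
  using assms
proof (induction p arbitrary: A x)
  case (Cons s p)
  show ?case
  proof (cases s)
    case (Fwd F)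
    then have "F \<in> Hom C_mod_N A (Cod C_mod_N F)" and p: "zigzag C_mod_N W (Cod C_mod_N F) p B"
      using Cons.prems(1) by (auto intro: HomI)
    then obtain f where f: "f \<in> Hom C A (Cod C_mod_N F)" "F = cls f" using Hom_C_mod_N by blast
    show ?thesis
      using Cons.IH[OF p Cons.prems(2) Cmp_Hom[OF Cons.prems(3) f(1)]]
        Cons.prems(4) act_Fwd[OF f(1) Cons.prems(2,3)] by (simp add: Fwd f(2))
  next
    case (Bwd F)
    then have F: "F \<in> Hom C_mod_N (Dom C_mod_N F) A" and p: "zigzag C_mod_N W (Dom C_mod_N F) p B"
      using Cons.prems(1) by (auto intro: HomI)
    then obtain f where f: "f \<in> Hom C (Dom C_mod_N F) A" "F = cls f" using Hom_C_mod_N by blast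
    show ?thesis
      using Cons.IH[OF p Cons.prems(2)] Cons.prems(4) act_Bwd[OF f(1) Cons.prems(2)]
      unfolding Bwd f(2) by blast
  qed
qed auto

text \<open>Cancelling a formal inverse uses that \<open>H s\<close> is injective on one side and surjective on the
  other.\<close>

lemma act_zigzag_eq:
  assumes X: "X \<in> \<X>"
  shows "\<lbrakk>zigzag_eq C_mod_N W A p q B; x \<in> Hom C X A\<rbrakk> \<Longrightarrow> act X p x y \<longleftrightarrow> act X q x y"
proof (induction arbitrary: x y rule: zigzag_eq.induct)
  case (append A p p' B q q' D)
  have p: "zigzag C_mod_N W A p B" "zigzag C_mod_N W A p' B"
    using I.zigzag_eq_zigzag[OF append(1)] by simp_all
  show ?case
    unfolding act_append
    using append.IH(1)[OF append.prems] append.IH(2) act_Hom[OF p(1) X append.prems] by blast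
next
  case (Idn A)
  then show ?case
    using act_Fwd[OF Idn_Hom X Idn.prems] Idn_Cmp[OF Idn.prems] by (simp add: Idn_C_mod_N del: act.simps(2))
next
  case (Cmp F A B G D)
  obtain f where f: "f \<in> Hom C A B" "F = cls f" using Hom_C_mod_N[OF Cmp(1)] .
  obtain g where g: "g \<in> Hom C B D" "G = cls g" using Hom_C_mod_N[OF Cmp(2)] .
  show ?case
    using act_Fwd[OF f(1) X Cmp.prems] act_Fwd[OF g(1) X Cmp_Hom[OF Cmp.prems f(1)]]
      act_Fwd[OF Cmp_Hom[OF f(1) g(1)] X Cmp.prems] Cmp_assoc[OF Cmp.prems f(1) g(1)]
    by (simp add: f(2) g(2) Cmp_cls[OF f(1) g(1)] del: act.simps(2))
next
  case (Fwd_Bwd F A B)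
  obtain s where s: "s \<in> Hom C A B" "F = cls s" "Xmono s A" using W_elem[OF Fwd_Bwd(1,2)] by blast
  show ?case
    unfolding s(2) act_Fwd[OF s(1) X Fwd_Bwd.prems] act_Bwd[OF s(1) X]
    using XmonoD[OF s(3) X] Fwd_Bwd.prems by auto
next
  case (Bwd_Fwd F A B)
  obtain s where s: "s \<in> Hom C A B" "F = cls s" "Xepi s A B" using W_elem[OF Bwd_Fwd(1,2)] by blast
  show ?case
    unfolding s(2) act_Bwd[OF s(1) X]
    using act_Fwd[OF s(1) X, of _ "[]"] XepiE[OF s(3) X Bwd_Fwd.prems]
    by (auto simp del: act.simps(2)) metis
qed auto

abbreviation L :: "('o, 'o \<times> 'm set step list set \<times> 'o) cat" where
  "L \<equiv> quotient_category C \<N>"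

lemma category_L: "category L"
  unfolding quotient_category_def by (rule I.category_localization)

interpretation L: category L
  by (rule category_L)

lemma Ob_L [simp]: "Ob L = Ob C"
  by (simp add: quotient_category_def)

definition Q :: "'m \<Rightarrow> 'o \<times> 'm set step list set \<times> 'o" where
  "Q f = zigzag_class C_mod_N W (Dom C f) [Fwd (cls f)] (Cod C f)"

lemma Q_eq: "f \<in> Hom C A B \<Longrightarrow> Q f = zigzag_class C_mod_N W A [Fwd (cls f)] B"
  using HomD[of f C A B] by (simp add: Q_def)

lemma Q_zigzag: "f \<in> Hom C A B \<Longrightarrow> zigzag C_mod_N W A [Fwd (cls f)] B"
  by (rule I.zigzag_Fwd[OF cls_Hom])

lemma Q_Hom: "f \<in> Hom C A B \<Longrightarrow> Q f \<in> Hom L A B"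
  using Q_zigzag[of f A B] Q_eq[of f A B] by (auto simp: quotient_category_def I.Hom_localization)

lemma Q_Cmp:
  assumes f: "f \<in> Hom C A B" and g: "g \<in> Hom C B D"
  shows "Q g \<cdot>\<^bsub>L\<^esub> Q f = Q (g \<cdot> f)"
proof -
  note p = Q_zigzag[OF f] and q = Q_zigzag[OF g]
  have "zigzag_eq C_mod_N W A ([Fwd (cls f)] @ [Fwd (cls g)]) [Fwd (cls (g \<cdot> f))] D"
    using zigzag_eq.Cmp[OF cls_Hom[OF f] cls_Hom[OF g]] Cmp_cls[OF f g] by simp
  then show ?thesis
    using I.Cmp_localization[OF p q] I.zigzag_class_eq_iff[OF I.zigzag_append[OF p q]]
    by (simp add: Q_eq[OF f] Q_eq[OF g] Q_eq[OF Cmp_Hom[OF f g]] quotient_category_def)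
qed

lemma Q_Xeq: "\<lbrakk>f \<in> Hom C A B; g \<in> Hom C A B; Xeq f g A\<rbrakk> \<Longrightarrow> Q f = Q g"
  using Q_eq[of f A B] Q_eq[of g A B] cls_eq_iff[of f A B g] by simp

lemma Q_eqD:
  assumes f: "f \<in> Hom C A B" and g: "g \<in> Hom C A B" and "Q f = Q g"
  shows "Xeq f g A"
  unfolding Xeq_def
proof (intro ballI)
  fix X x assume X: "X \<in> \<X>" and x: "x \<in> Hom C X A"
  have "zigzag_eq C_mod_N W A [Fwd (cls f)] [Fwd (cls g)] B"
    using assms(3) I.zigzag_class_eq_iff[OF Q_zigzag[OF f]] by (simp add: Q_eq[OF f] Q_eq[OF g])
  then have "act X [Fwd (cls f)] x (f \<cdot> x) \<longleftrightarrow> act X [Fwd (cls g)] x (f \<cdot> x)"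
    by (rule act_zigzag_eq[OF X _ x])
  then show "f \<cdot> x = g \<cdot> x"
    unfolding act_Fwd[OF f X x] act_Fwd[OF g X x] by simp
qed

lemma Q_eq_on_X:
  assumes X: "X \<in> \<X>" and f: "f \<in> Hom C X B" and g: "g \<in> Hom C X B" and "Q f = Q g"
  shows "f = g"
  using XeqD[OF Q_eqD[OF f g assms(4)] X Idn_Hom[OF X_Ob[OF X]]] Cmp_Idn[OF f] Cmp_Idn[OF g] by simp

lemma Q_inverts:
  assumes "s \<in> SN C \<N>" "s \<in> Hom C A B"
  shows "is_iso L (Q s)"
proof -
  have "cls s \<in> W" using assms(1) by blast
  then show ?thesis
    unfolding Q_eq[OF assms(2)] quotient_category_def
    by (rule I.localization_inverts[OF _ cls_Hom[OF assms(2)]])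
qed

text \<open>An object is liftable if arrows out of it lift, up to the kernel of \<open>H\<close>, along arrows that
  \<open>H\<close> inverts; so every zigzag starting there can be straightened to an arrow of \<open>\<C>\<close>.\<close>

definition liftable :: "'o \<Rightarrow> bool" where
  "liftable A \<longleftrightarrow> A \<in> Ob C \<and> (\<forall>B B' s f. s \<in> Hom C B' B \<and> Xmono s B' \<and> Xepi s B' B \<and> f \<in> Hom C A B
     \<longrightarrow> (\<exists>f' \<in> Hom C A B'. Xeq f (s \<cdot> f') A))"

lemma liftable_X:
  assumes "X \<in> \<X>"
  shows "liftable X"
  unfolding liftable_def
proof (intro conjI allI impI)
  show "X \<in> Ob C" by (rule X_Ob[OF assms])
  fix B B' s f assume "s \<in> Hom C B' B \<and> Xmono s B' \<and> Xepi s B' B \<and> f \<in> Hom C X B"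
  then obtain f' where "f' \<in> Hom C X B'" "f = s \<cdot> f'" using XepiE[of s B' B X f] assms by blast
  then show "\<exists>f' \<in> Hom C X B'. Xeq f (s \<cdot> f') X" by (auto simp: Xeq_def)
qed

text \<open>On \<open>P0\<close> an arrow \<open>f\<close> lifts along \<open>s\<close> since \<open>P0 \<in> \<X>\<close>; the lift vanishes on \<open>P1\<close> since \<open>H s\<close> is
  injective, so it extends to \<open>A\<close>. It agrees with \<open>f\<close> under \<open>H\<close> because \<open>H P0 \<rightarrow> H A\<close> is onto, by
  rigidity.\<close>

lemma liftable_cone:
  assumes P1: "P1 \<in> \<X>" and P0: "P0 \<in> \<X>" and t: "tri p k l P1 P0 A"
  shows "liftable A"
  unfolding liftable_def
proof (intro conjI allI impI)
  note T = triD[OF t]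
  show "A \<in> Ob C" by (rule T(7))
  fix B B' s f assume "s \<in> Hom C B' B \<and> Xmono s B' \<and> Xepi s B' B \<and> f \<in> Hom C A B"
  then have s: "s \<in> Hom C B' B" "Xmono s B'" "Xepi s B' B" and f: "f \<in> Hom C A B" by auto
  obtain q where q: "q \<in> Hom C P0 B'" "f \<cdot> k = s \<cdot> q" using XepiE[OF s(3) P0 Cmp_Hom[OF T(3) f]] .
  have "s \<cdot> q \<cdot> p = (f \<cdot> k) \<cdot> p" using q(2) Cmp_assoc[OF T(2) q(1) s(1)] by simp
  also have "\<dots> = Zer C P1 B"
    using Cmp_assoc[OF T(2,3) f] tri_comp_zero[OF t] Cmp_Zer[OF T(5) f] by simp
  finally have "q \<cdot> p = Zer C P1 B'" by (rule Xmono_zero[OF s(2,1) P1 Cmp_Hom[OF T(2) q(1)]])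
  then obtain f' where f': "f' \<in> Hom C A B'" "q = f' \<cdot> k" using tri_coexact[OF t q(1)] by blast
  have "Xeq f (s \<cdot> f') A"
    unfolding Xeq_def
  proof (intro ballI)
    fix X x assume X: "X \<in> \<X>" and x: "x \<in> Hom C X A"
    obtain y where y: "y \<in> Hom C X P0" "x = k \<cdot> y"
      using XepiE[OF tri_Xepi_of_Xzero[OF t Xzero_to_X_sh[OF T(4) P1]] X x] .
    have "f \<cdot> x = (f \<cdot> k) \<cdot> y" using y Cmp_assoc[OF y(1) T(3) f] by simp
    also have "\<dots> = ((s \<cdot> f') \<cdot> k) \<cdot> y" using q(2) f'(2) Cmp_assoc[OF T(3) f'(1) s(1)] by simp
    also have "\<dots> = (s \<cdot> f') \<cdot> x" using y Cmp_assoc[OF y(1) T(3) Cmp_Hom[OF f'(1) s(1)]] by simp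
    finally show "f \<cdot> x = (s \<cdot> f') \<cdot> x" .
  qed
  then show "\<exists>f' \<in> Hom C A B'. Xeq f (s \<cdot> f') A" using f'(1) by blast
qed

text \<open>Approximating first \<open>D\<close> and then the fibre \<open>M[-1]\<close> of \<open>P0 \<rightarrow> D\<close> gives a presentation of \<open>H D\<close>.
  By the octahedron its cone \<open>A\<close> maps to \<open>D\<close> with fibre in \<open>\<N>\<close>.\<close>

lemma liftable_resolution:
  assumes D: "D \<in> Ob C"
  obtains A a where "liftable A" "a \<in> Hom C A D" "a \<in> SN C \<N>"
proof -
  obtain P0 x M n m where P0: "P0 \<in> \<X>" and "M \<in> \<N>" and t0: "tri x n m P0 D M" and epi0: "Xepi x P0 D"
    using approximation_triangle[OF D] .
  obtain w n' where t1: "tri w x n' (unshO C M) P0 D" using tri_unrotate[OF t0] .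
  note T1 = triD[OF t1]
  obtain P1 y M1 n1 m1 where P1: "P1 \<in> \<X>" and M1: "M1 \<in> \<N>" and t2: "tri y n1 m1 P1 (unshO C M) M1"
    and "Xepi y P1 (unshO C M)"
    using approximation_triangle[OF T1(5)] .
  note T2 = triD[OF t2]
  obtain k l A where t3: "tri (w \<cdot> y) k l P1 P0 A" using cone_ex[OF Cmp_Hom[OF T2(2) T1(2)]] .
  note T3 = triD[OF t3]
  have cod: "Cod C n1 = M1" "Cod C k = A" "Cod C x = D"
    using HomD[OF T2(3)] HomD[OF T3(3)] HomD[OF T1(3)] by auto
  obtain u v where uv: "u \<in> Hom C M1 A" "v \<in> Hom C A D" "(u, v, shA C n1 \<cdot> n') \<in> Tri C" "v \<cdot> k = x"
    using TR4[OF T2(2) T1(2) T2(1) T1(1) T3(1)] unfolding cod by blast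
  let ?h = "shA C n1 \<cdot> n'"
  have h: "?h \<in> Hom C D (shO C M1)" by (rule Cmp_Hom[OF T1(4) shA_Hom[OF T2(3)]])
  have o: "tri u v ?h M1 A D" using uv h by (simp add: tri_def)
  have "Xepi v A D" using Xepi_of_factor[OF T3(3) uv(2)] uv(4) epi0 by simp
  then have "?h \<in> ER C \<N> D M1"
    using Xzero_imp_ER[OF h tri_Xzero_of_Xepi[OF o] N_Ob[OF M1]] by simp
  moreover have "?h \<in> EL C \<N> D M1"
  proof -
    have "?h \<cdot> z \<in> factoring C (shO C ` \<N>)" if z: "z \<in> Hom C N' D" for z N'
    proof -
      note hz = Cmp_Hom[OF z h]
      have "?h \<cdot> z = Idn C (shO C M1) \<cdot> ?h \<cdot> z" using Idn_Cmp[OF hz] by simp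
      then show ?thesis
        unfolding factoring_def using M1 hz HomD[OF hz] Idn_Hom[OF Hom_Ob(2)[OF h]] by auto
    qed
    then show ?thesis using h by (simp add: EL_def)
  qed
  ultimately have "v \<in> SN C \<N>"
    using SN.cocone[OF uv(3)] HomD[OF uv(1)] HomD[OF uv(2)] M1 by (simp add: EN_def)
  then show thesis using that[OF liftable_cone[OF P1 P0 t3] uv(2)] by blast
qed

lemma liftable_zigzag:
  assumes A: "liftable A"
  shows "\<lbrakk>zigzag C_mod_N W B p D; f \<in> Hom C A B\<rbrakk>
    \<Longrightarrow> \<exists>f' \<in> Hom C A D. zigzag_eq C_mod_N W A (Fwd (cls f) # p) [Fwd (cls f')] D"
proof (induction p arbitrary: B f)
  case Nil
  then show ?case using zigzag_eq.refl[OF Q_zigzag[OF Nil(2)]] by auto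
next
  case (Cons s p)
  show ?case
  proof (cases s)
    case (Fwd G)
    then have G: "G \<in> Hom C_mod_N B (Cod C_mod_N G)" and p: "zigzag C_mod_N W (Cod C_mod_N G) p D"
      using Cons.prems(1) by (auto intro: HomI)
    then obtain g where g: "g \<in> Hom C B (Cod C_mod_N G)" "G = cls g" using Hom_C_mod_N by blast
    have "zigzag_eq C_mod_N W A [Fwd (cls f), Fwd G] [Fwd (cls (g \<cdot> f))] (Cod C_mod_N G)"
      using zigzag_eq.Cmp[OF cls_Hom[OF Cons.prems(2)] G] Cmp_cls[OF Cons.prems(2) g(1)] g(2) by simp
    from zigzag_eq.append[OF this zigzag_eq.refl[OF p]]
    have "zigzag_eq C_mod_N W A (Fwd (cls f) # s # p) (Fwd (cls (g \<cdot> f)) # p) D" by (simp add: Fwd)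
    from zigzag_eq.trans[OF this] show ?thesis
      using Cons.IH[OF p Cmp_Hom[OF Cons.prems(2) g(1)]] by blast
  next
    case (Bwd G)
    let ?B' = "Dom C_mod_N G"
    have GW: "G \<in> W" and G: "G \<in> Hom C_mod_N ?B' B" and p: "zigzag C_mod_N W ?B' p D"
      using Cons.prems(1) Bwd by (auto intro: HomI)
    obtain g where g: "g \<in> Hom C ?B' B" "G = cls g" "Xmono g ?B'" "Xepi g ?B' B"
      using W_elem[OF GW G] by blast
    obtain f' where f': "f' \<in> Hom C A ?B'" "Xeq f (g \<cdot> f') A"
      using A g Cons.prems(2) unfolding liftable_def by blast
    have f_eq: "cls f = G \<cdot>\<^bsub>C_mod_N\<^esub> cls f'"
      using cls_eq_iff[OF Cons.prems(2) Cmp_Hom[OF f'(1) g(1)]] f'(2) Cmp_cls[OF f'(1) g(1)] g(2) by simp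
    note F = zigzag_eq.refl[OF Q_zigzag[OF f'(1)]] and B = zigzag_eq.refl[OF I.zigzag_Bwd[OF GW G]]
    have "zigzag_eq C_mod_N W A [Fwd (cls f), Bwd G] [Fwd (cls f'), Fwd G, Bwd G] ?B'"
      using zigzag_eq.append[OF zigzag_eq.sym[OF zigzag_eq.Cmp[OF cls_Hom[OF f'(1)] G]] B] f_eq by simp
    moreover have "zigzag_eq C_mod_N W A [Fwd (cls f'), Fwd G, Bwd G] [Fwd (cls f')] ?B'"
      using zigzag_eq.append[OF F zigzag_eq.Fwd_Bwd[OF GW G]] by simp
    ultimately have "zigzag_eq C_mod_N W A [Fwd (cls f), Bwd G] [Fwd (cls f')] ?B'"
      by (rule zigzag_eq.trans)
    from zigzag_eq.append[OF this zigzag_eq.refl[OF p]]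
    have "zigzag_eq C_mod_N W A (Fwd (cls f) # s # p) (Fwd (cls f') # p) D" by (simp add: Bwd)
    from zigzag_eq.trans[OF this] show ?thesis using Cons.IH[OF p f'(1)] by blast
  qed
qed

lemma liftable_full:
  assumes A: "liftable A" and a: "\<alpha> \<in> Hom L A B"
  obtains f where "f \<in> Hom C A B" "\<alpha> = Q f"
proof -
  obtain p where p: "zigzag C_mod_N W A p B" "\<alpha> = zigzag_class C_mod_N W A p B"
    using a by (auto simp: quotient_category_def I.Hom_localization)
  have AO: "A \<in> Ob C" using A by (simp add: liftable_def)
  obtain f where f: "f \<in> Hom C A B"
    and eq: "zigzag_eq C_mod_N W A (Fwd (cls (Idn C A)) # p) [Fwd (cls f)] B"
    using liftable_zigzag[OF A p(1) Idn_Hom[OF AO]] by blast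
  have "zigzag_eq C_mod_N W A (Fwd (cls (Idn C A)) # p) p B"
    using zigzag_eq.append[OF zigzag_eq.Idn zigzag_eq.refl[OF p(1)]] AO by (simp add: Idn_C_mod_N)
  then have "zigzag_eq C_mod_N W A p [Fwd (cls f)] B"
    by (rule zigzag_eq.trans[OF zigzag_eq.sym eq])
  then show thesis
    using that[OF f] I.zigzag_class_eq_iff[OF p(1)] p(2) Q_eq[OF f] by simp
qed

section \<open>Exact sequences in the quotient category\<close>

lemma zero_object_L:
  obtains Z where "zero_object C Z" "zero_object L Z"
proof -
  obtain Z where Z: "Z \<in> \<X>" "zero_object C Z" using X_zero_object .
  have ZO: "Z \<in> Ob C" by (rule X_Ob[OF Z(1)])
  have "zero_object L Z"
    unfolding zero_object_def
  proof (intro conjI ballI ex_ex1I)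
    show "Z \<in> Ob L" using ZO by simp
    fix A assume "A \<in> Ob L"
    then have AO: "A \<in> Ob C" by simp
    show "\<exists>f. f \<in> Hom L A Z" "\<exists>f. f \<in> Hom L Z A"
      using Q_Hom[OF Zer_Hom[OF AO ZO]] Q_Hom[OF Zer_Hom[OF ZO AO]] by blast+
    fix \<alpha> \<beta>
    show "\<alpha> = \<beta>" if ab: "\<alpha> \<in> Hom L Z A" "\<beta> \<in> Hom L Z A"
    proof -
      obtain f where f: "f \<in> Hom C Z A" "\<alpha> = Q f" using liftable_full[OF liftable_X[OF Z(1)] ab(1)] .
      obtain g where g: "g \<in> Hom C Z A" "\<beta> = Q g" using liftable_full[OF liftable_X[OF Z(1)] ab(2)] .
      show ?thesis using f g zero_object_unique(2)[OF Z(2) f(1) g(1)] by simp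
    qed
    show "\<alpha> = \<beta>" if ab: "\<alpha> \<in> Hom L A Z" "\<beta> \<in> Hom L A Z"
    proof -
      obtain A' a where a: "liftable A'" "a \<in> Hom C A' A" "a \<in> SN C \<N>" using liftable_resolution[OF AO] .
      note Qa = Q_Hom[OF a(2)]
      obtain f where f: "f \<in> Hom C A' Z" "\<alpha> \<cdot>\<^bsub>L\<^esub> Q a = Q f"
        using liftable_full[OF a(1) L.Cmp_Hom[OF Qa ab(1)]] .
      obtain g where g: "g \<in> Hom C A' Z" "\<beta> \<cdot>\<^bsub>L\<^esub> Q a = Q g"
        using liftable_full[OF a(1) L.Cmp_Hom[OF Qa ab(2)]] .
      show ?thesis
        using L.iso_cancel_right[OF Qa Q_inverts[OF a(3,2)] ab] f g
          zero_object_unique(1)[OF Z(2) f(1) g(1)] by simp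
    qed
  qed
  then show thesis using that Z by blast
qed

text \<open>If \<open>Q f\<close> factors through a zero object, then \<open>Q (f \<cdot> x)\<close> does not depend on \<open>x\<close>, so it equals
  \<open>Q (f \<cdot> 0)\<close>.\<close>

lemma zero_arrow_L_iff:
  assumes f: "f \<in> Hom C A B"
  shows "zero_arrow L (Q f) \<longleftrightarrow> Xzero f A B"
proof
  assume "zero_arrow L (Q f)"
  then obtain Z u v where Z: "zero_object L Z" and u: "u \<in> Hom L A Z" and v: "v \<in> Hom L Z B"
    and eq: "Q f = v \<cdot>\<^bsub>L\<^esub> u"
    using L.zero_arrowE[OF _ Q_Hom[OF f]] by blast
  show "Xzero f A B"
    unfolding Xzero_def
  proof (intro ballI)
    fix X x assume X: "X \<in> \<X>" and x: "x \<in> Hom C X A"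
    note XO = X_Ob[OF X]
    have z: "Zer C X A \<in> Hom C X A" by (rule Zer_Hom[OF Hom_Ob[OF x]])
    have "u \<cdot>\<^bsub>L\<^esub> Q x = u \<cdot>\<^bsub>L\<^esub> Q (Zer C X A)"
      by (rule L.zero_object_unique(1)[OF Z L.Cmp_Hom[OF Q_Hom[OF x] u] L.Cmp_Hom[OF Q_Hom[OF z] u]])
    then have "Q (f \<cdot> x) = Q (f \<cdot> Zer C X A)"
      using Q_Cmp[OF x f] Q_Cmp[OF z f] eq L.Cmp_assoc[OF Q_Hom[OF x] u v] L.Cmp_assoc[OF Q_Hom[OF z] u v]
      by simp
    then show "f \<cdot> x = Zer C X B"
      using Q_eq_on_X[OF X Cmp_Hom[OF x f] Cmp_Hom[OF z f]] Cmp_Zer[OF XO f] by simp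
  qed
next
  assume z: "Xzero f A B"
  note AB = Hom_Ob[OF f]
  obtain Z where Z: "zero_object C Z" "zero_object L Z" using zero_object_L .
  have ZO: "Z \<in> Ob C" using Z(1) by (simp add: zero_object_def)
  note u = Zer_Hom[OF AB(1) ZO] and v = Zer_Hom[OF ZO AB(2)]
  have "Xeq f (Zer C Z B \<cdot> Zer C A Z) A"
    unfolding Xeq_def Cmp_Zer[OF AB(1) v] using XzeroD[OF z] Zer_Cmp[OF AB(2)] by simp
  then have "Q f = Q (Zer C Z B) \<cdot>\<^bsub>L\<^esub> Q (Zer C A Z)"
    using Q_Xeq[OF f Cmp_Hom[OF u v]] Q_Cmp[OF u v] by simp
  then show "zero_arrow L (Q f)" using L.zero_arrowI[OF Z(2) Q_Hom[OF u] Q_Hom[OF v]] by simp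
qed

text \<open>On an object \<open>X \<in> \<X>\<close> the functor to the quotient category is bijective on \<open>Hom X A\<close>. So
  properties of arrows of the quotient category that refer to all test objects can be read off
  from \<open>H\<close>.\<close>

lemma X_Hom_L:
  assumes "X \<in> \<X>" "\<alpha> \<in> Hom L X A"
  obtains x where "x \<in> Hom C X A" "\<alpha> = Q x"
  using liftable_full[OF liftable_X[OF assms(1)] assms(2)] .

lemma Xmono_if_cancellable:
  assumes f: "f \<in> Hom C A B"
    and cancel: "\<And>T \<alpha> \<beta>. \<lbrakk>\<alpha> \<in> Hom L T A; \<beta> \<in> Hom L T A; Q f \<cdot>\<^bsub>L\<^esub> \<alpha> = Q f \<cdot>\<^bsub>L\<^esub> \<beta>\<rbrakk> \<Longrightarrow> \<alpha> = \<beta>"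
  shows "Xmono f A"
  unfolding Xmono_def
proof (intro ballI impI)
  fix X x y assume X: "X \<in> \<X>" and x: "x \<in> Hom C X A" and y: "y \<in> Hom C X A" and eq: "f \<cdot> x = f \<cdot> y"
  have "Q x = Q y"
    by (rule cancel[OF Q_Hom[OF x] Q_Hom[OF y]]) (simp add: Q_Cmp[OF x f] Q_Cmp[OF y f] eq)
  then show "x = y" by (rule Q_eq_on_X[OF X x y])
qed

text \<open>An epimorphism of the quotient category annihilates the arrow \<open>g\<close> to the cone of \<open>f\<close>, so
  \<open>H g = 0\<close>.\<close>

lemma Xepi_if_cancellable:
  assumes f: "f \<in> Hom C A B"
    and cancel: "\<And>T \<alpha> \<beta>. \<lbrakk>\<alpha> \<in> Hom L B T; \<beta> \<in> Hom L B T; \<alpha> \<cdot>\<^bsub>L\<^esub> Q f = \<beta> \<cdot>\<^bsub>L\<^esub> Q f\<rbrakk> \<Longrightarrow> \<alpha> = \<beta>"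
  shows "Xepi f A B"
proof -
  obtain g h D where t: "tri f g h A B D" using cone_ex[OF f] .
  note T = triD[OF t]
  have z: "Zer C B D \<in> Hom C B D" by (rule Zer_Hom[OF T(6,7)])
  have "Q g = Q (Zer C B D)"
    by (rule cancel[OF Q_Hom[OF T(3)] Q_Hom[OF z]])
       (simp add: Q_Cmp[OF f T(3)] Q_Cmp[OF f z] tri_comp_zero[OF t] Zer_Cmp[OF T(7) f])
  then have "Xeq g (Zer C B D) B" by (rule Q_eqD[OF T(3) z])
  then have "g \<cdot> y = Zer C X D" if "X \<in> \<X>" "y \<in> Hom C X B" for X y
    using XeqD that Zer_Cmp[OF T(7) that(2)] by simp
  then show ?thesis
    unfolding Xepi_def using tri_exact[OF t] by metis
qed

text \<open>An isomorphism out of \<open>A\<close> becomes, after precomposition with a liftable resolution, the image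
  of an arrow of \<open>\<C>\<close> that \<open>H\<close> inverts.\<close>

lemma theta_gen_iso_L:
  assumes A: "A \<in> Ob C" and B: "B \<in> Ob C" and eq: "iso_class L A = iso_class L B"
  shows "theta_gen A - theta_gen B \<in> Rel"
proof -
  obtain \<alpha> where \<alpha>: "\<alpha> \<in> Hom L A B" "is_iso L \<alpha>" using L.iso_class_eqD[OF _ _ eq] A B by auto
  obtain A' a where a: "liftable A'" "a \<in> Hom C A' A" "a \<in> SN C \<N>" using liftable_resolution[OF A] .
  note Qa = Q_Hom[OF a(2)]
  obtain f where f: "f \<in> Hom C A' B" "\<alpha> \<cdot>\<^bsub>L\<^esub> Q a = Q f"
    using liftable_full[OF a(1) L.Cmp_Hom[OF Qa \<alpha>(1)]] .
  have iso: "is_iso L (Q f)" using L.is_iso_Cmp[OF Qa \<alpha>(1) Q_inverts[OF a(3,2)] \<alpha>(2)] f(2) by simp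
  have "Xmono f A'" by (rule Xmono_if_cancellable[OF f(1)]) (rule L.iso_cancel_left[OF Q_Hom[OF f(1)] iso])
  moreover have "Xepi f A' B"
    by (rule Xepi_if_cancellable[OF f(1)]) (rule L.iso_cancel_right[OF Q_Hom[OF f(1)] iso])
  ultimately have "theta_gen B - theta_gen A' \<in> Rel" by (rule theta_gen_Xiso[OF f(1)])
  moreover have "theta_gen A - theta_gen A' \<in> Rel"
    using theta_gen_Xiso[OF a(2)] SN_Xiso[OF a(3)] HomD[OF a(2)] by simp
  ultimately show ?thesis using Rel_diff[of "theta_gen A - theta_gen A'" "theta_gen B - theta_gen A'"] by simp
qed

text \<open>After replacing \<open>B\<close> and \<open>A\<close> by liftable objects both arrows of a short exact sequence come from
  \<open>\<C>\<close>, and the universal properties tested on \<open>\<X>\<close> say that \<open>H\<close> makes the sequence exact.\<close>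

lemma theta_gen_short_exact_L:
  assumes k: "is_kernel L k g" and c: "is_cokernel L g k" and kH: "k \<in> Hom L A B" and gH: "g \<in> Hom L B D"
  shows "theta_gen A - theta_gen B + theta_gen D \<in> Rel"
proof -
  have Ob: "A \<in> Ob C" "B \<in> Ob C" "D \<in> Ob C" using L.Hom_Ob[OF kH] L.Hom_Ob[OF gH] by simp_all
  obtain B' b where b: "liftable B'" "b \<in> Hom C B' B" "b \<in> SN C \<N>" using liftable_resolution[OF Ob(2)] .
  obtain A' a where a: "liftable A'" "a \<in> Hom C A' A" "a \<in> SN C \<N>" using liftable_resolution[OF Ob(1)] .
  note Qa = Q_Hom[OF a(2)] and Qb = Q_Hom[OF b(2)] and ia = Q_inverts[OF a(3,2)] and ib = Q_inverts[OF b(3,2)]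
  obtain b1 where b1: "b1 \<in> Hom L B B'" "b1 \<cdot>\<^bsub>L\<^esub> Q b = Idn L B'" "Q b \<cdot>\<^bsub>L\<^esub> b1 = Idn L B"
    using L.is_isoE[OF ib Qb] by blast
  obtain a1 where a1: "a1 \<in> Hom L A A'" "Q a \<cdot>\<^bsub>L\<^esub> a1 = Idn L A"
    using L.is_isoE[OF ia Qa] by blast
  obtain g0 where g0: "g0 \<in> Hom C B' D" "g \<cdot>\<^bsub>L\<^esub> Q b = Q g0"
    using liftable_full[OF b(1) L.Cmp_Hom[OF Qb gH]] .
  note ka = L.Cmp_Hom[OF Qa kH]
  obtain k0 where k0: "k0 \<in> Hom C A' B'" "b1 \<cdot>\<^bsub>L\<^esub> k \<cdot>\<^bsub>L\<^esub> Q a = Q k0"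
    using liftable_full[OF a(1) L.Cmp_Hom[OF ka b1(1)]] .
  have bk0: "Q b \<cdot>\<^bsub>L\<^esub> Q k0 = k \<cdot>\<^bsub>L\<^esub> Q a"
    using k0(2) L.Cmp_assoc[OF ka b1(1) Qb] b1(3) L.Idn_Cmp[OF ka] by simp
  have epi: "Xepi g0 B' D"
  proof (rule Xepi_if_cancellable[OF g0(1)])
    fix T \<alpha> \<beta> assume \<alpha>: "\<alpha> \<in> Hom L D T" and \<beta>: "\<beta> \<in> Hom L D T" and "\<alpha> \<cdot>\<^bsub>L\<^esub> Q g0 = \<beta> \<cdot>\<^bsub>L\<^esub> Q g0"
    then have "(\<alpha> \<cdot>\<^bsub>L\<^esub> g) \<cdot>\<^bsub>L\<^esub> Q b = (\<beta> \<cdot>\<^bsub>L\<^esub> g) \<cdot>\<^bsub>L\<^esub> Q b"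
      using g0(2) L.Cmp_assoc[OF Qb gH \<alpha>] L.Cmp_assoc[OF Qb gH \<beta>] by simp
    then have "\<alpha> \<cdot>\<^bsub>L\<^esub> g = \<beta> \<cdot>\<^bsub>L\<^esub> g"
      by (rule L.iso_cancel_right[OF Qb ib L.Cmp_Hom[OF gH \<alpha>] L.Cmp_Hom[OF gH \<beta>]])
    then show "\<alpha> = \<beta>" by (rule L.cokernel_cancel[OF c kH gH \<alpha> \<beta>])
  qed
  have mono: "Xmono k0 A'"
  proof (rule Xmono_if_cancellable[OF k0(1)])
    fix T \<alpha> \<beta> assume \<alpha>: "\<alpha> \<in> Hom L T A'" and \<beta>: "\<beta> \<in> Hom L T A'" and "Q k0 \<cdot>\<^bsub>L\<^esub> \<alpha> = Q k0 \<cdot>\<^bsub>L\<^esub> \<beta>"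
    then have "(Q b \<cdot>\<^bsub>L\<^esub> Q k0) \<cdot>\<^bsub>L\<^esub> \<alpha> = (Q b \<cdot>\<^bsub>L\<^esub> Q k0) \<cdot>\<^bsub>L\<^esub> \<beta>"
      using L.Cmp_assoc[OF \<alpha> Q_Hom[OF k0(1)] Qb] L.Cmp_assoc[OF \<beta> Q_Hom[OF k0(1)] Qb] by simp
    then have "k \<cdot>\<^bsub>L\<^esub> Q a \<cdot>\<^bsub>L\<^esub> \<alpha> = k \<cdot>\<^bsub>L\<^esub> Q a \<cdot>\<^bsub>L\<^esub> \<beta>"
      using bk0 L.Cmp_assoc[OF \<alpha> Qa kH] L.Cmp_assoc[OF \<beta> Qa kH] by simp
    then have "Q a \<cdot>\<^bsub>L\<^esub> \<alpha> = Q a \<cdot>\<^bsub>L\<^esub> \<beta>"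
      by (rule L.kernel_cancel[OF k kH gH L.Cmp_Hom[OF \<alpha> Qa] L.Cmp_Hom[OF \<beta> Qa]])
    then show "\<alpha> = \<beta>" by (rule L.iso_cancel_left[OF Qa ia \<alpha> \<beta>])
  qed
  have gk: "Xzero (g0 \<cdot> k0) A' D"
  proof -
    have "Q (g0 \<cdot> k0) = g \<cdot>\<^bsub>L\<^esub> Q b \<cdot>\<^bsub>L\<^esub> Q k0"
      using Q_Cmp[OF k0(1) g0(1)] g0(2) L.Cmp_assoc[OF Q_Hom[OF k0(1)] Qb gH] by simp
    also have "\<dots> = (g \<cdot>\<^bsub>L\<^esub> k) \<cdot>\<^bsub>L\<^esub> Q a" using bk0 L.Cmp_assoc[OF Qa kH gH] by simp
    finally have "zero_arrow L (Q (g0 \<cdot> k0))"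
      using L.zero_arrow_Cmp_right[OF L.is_kernelD(1)[OF k kH gH] Qa L.Cmp_Hom[OF kH gH]] by simp
    then show ?thesis using zero_arrow_L_iff[OF Cmp_Hom[OF k0(1) g0(1)]] by simp
  qed
  have exact: "\<exists>u \<in> Hom C X A'. x = k0 \<cdot> u"
    if X: "X \<in> \<X>" and x: "x \<in> Hom C X B'" and gx: "g0 \<cdot> x = Zer C X D" for X x
  proof -
    note Qx = Q_Hom[OF x]
    have "g \<cdot>\<^bsub>L\<^esub> Q b \<cdot>\<^bsub>L\<^esub> Q x = Q (g0 \<cdot> x)"
      using Q_Cmp[OF x g0(1)] g0(2) L.Cmp_assoc[OF Qx Qb gH] by simp
    moreover have "Xzero (g0 \<cdot> x) X D"
      unfolding gx Xzero_def using Zer_Cmp[OF Ob(3)] by blast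
    ultimately have "zero_arrow L (g \<cdot>\<^bsub>L\<^esub> Q b \<cdot>\<^bsub>L\<^esub> Q x)"
      using zero_arrow_L_iff[OF Cmp_Hom[OF x g0(1)]] by simp
    then obtain \<mu> where \<mu>: "\<mu> \<in> Hom L X A" "k \<cdot>\<^bsub>L\<^esub> \<mu> = Q b \<cdot>\<^bsub>L\<^esub> Q x"
      using L.is_kernelD(2)[OF k kH gH L.Cmp_Hom[OF Qx Qb]] by blast
    obtain u where u: "u \<in> Hom C X A'" "a1 \<cdot>\<^bsub>L\<^esub> \<mu> = Q u"
      using X_Hom_L[OF X L.Cmp_Hom[OF \<mu>(1) a1(1)]] .
    have "Q b \<cdot>\<^bsub>L\<^esub> Q (k0 \<cdot> u) = (k \<cdot>\<^bsub>L\<^esub> Q a) \<cdot>\<^bsub>L\<^esub> a1 \<cdot>\<^bsub>L\<^esub> \<mu>"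
      using Q_Cmp[OF u(1) k0(1)] L.Cmp_assoc[OF Q_Hom[OF u(1)] Q_Hom[OF k0(1)] Qb] bk0 u(2) by simp
    also have "\<dots> = k \<cdot>\<^bsub>L\<^esub> (Q a \<cdot>\<^bsub>L\<^esub> a1) \<cdot>\<^bsub>L\<^esub> \<mu>"
      using L.Cmp_assoc[OF L.Cmp_Hom[OF \<mu>(1) a1(1)] Qa kH] L.Cmp_assoc[OF \<mu>(1) a1(1) Qa] by simp
    also have "\<dots> = Q b \<cdot>\<^bsub>L\<^esub> Q x" using a1(2) L.Idn_Cmp[OF \<mu>(1)] \<mu>(2) by simp
    finally have "Q (k0 \<cdot> u) = Q x"
      by (rule L.iso_cancel_left[OF Qb ib Q_Hom[OF Cmp_Hom[OF u(1) k0(1)]] Qx])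
    then have "x = k0 \<cdot> u" using Q_eq_on_X[OF X Cmp_Hom[OF u(1) k0(1)] x] by simp
    then show ?thesis using u(1) by blast
  qed
  have "theta_gen A' - theta_gen B' + theta_gen D \<in> Rel" by (rule theta_gen_H_exact[OF k0(1) g0(1) mono epi gk exact])
  moreover have "theta_gen A - theta_gen A' \<in> Rel" "theta_gen B - theta_gen B' \<in> Rel"
    using theta_gen_Xiso[OF a(2)] SN_Xiso[OF a(3)] HomD[OF a(2)]
      theta_gen_Xiso[OF b(2)] SN_Xiso[OF b(3)] HomD[OF b(2)] by simp_all
  ultimately have "(theta_gen A' - theta_gen B' + theta_gen D) + (theta_gen A - theta_gen A') - (theta_gen B - theta_gen B') \<in> Rel"
    using Rel_diff Rel_add by blast
  then show ?thesis by (simp add: algebra_simps)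
qed

end

section \<open>The exact sequence\<close>

context rigid_subcategory
begin

abbreviation Rel_tri :: "('o set \<Rightarrow>\<^sub>0 int) set" where
  "Rel_tri \<equiv> K0_relations C (triangles C)"

lemma conflations_R_triangles: "conflations_R C \<N> \<subseteq> triangles C"
  unfolding conflations_R_def triangles_def by blast

lemma Rel_subset_Rel_tri: "Rel \<subseteq> Rel_tri"
  unfolding K0_relations_def
  by (rule group.mono_generate[OF group_K0_free]) (use conflations_R_triangles in blast)

text \<open>Every triangle \<open>A[-1] \<rightarrow> 0 \<rightarrow> A\<close> is a relation of \<open>K0_triangulated\<close>; this gives \<open>\<pi> \<circ> \<theta> = 0\<close>.\<close>

lemma theta_gen_Rel_tri:
  assumes A: "A \<in> Ob C"
  shows "theta_gen A \<in> Rel_tri"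
proof -
  obtain Z where Z: "zero_object C Z" using zero_object_ex by blast
  obtain w z k where t: "tri w z k (unshO C A) (unshO C Z) A" using tri_through_zero[OF A Z] .
  have "(gen C (unshO C A) - gen C (unshO C Z) + gen C A) + gen C (unshO C Z) \<in> Rel_tri"
    using K0_relations_add[OF K0_relations_incl[OF tri_triangles[OF t]]]
      gen_unsh_zero_Rel[OF Z] Rel_subset_Rel_tri by blast
  then show ?thesis by (simp add: theta_gen_def algebra_simps)
qed

lemma short_exact_sequences_Ob:
  "short_exact_sequences L \<subseteq> Ob L \<times> Ob L \<times> Ob L"
proof -
  interpret L: category L by (rule category_L)
  show ?thesis
    unfolding short_exact_sequences_def is_kernel_def using L.Dom_Ob L.Cod_Ob by blast
qed

lemma pi_exists:
  "\<exists>\<pi> \<in> hom (K0_R C \<N>) (K0_triangulated C).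
    \<forall>A \<in> Ob C. \<pi> (class_R C \<N> A) = class_triangulated C A"
proof -
  have "\<exists>h \<in> hom (K0 C (conflations_R C \<N>)) (K0_triangulated C).
      \<forall>A \<in> Ob C. h (K0_class C (conflations_R C \<N>) A) = class_triangulated C A"
  proof (rule K0_universal[OF conflations_R_Ob])
    show "comm_group (K0_triangulated C)"
      unfolding K0_triangulated_def by (rule comm_group_K0[OF triangles_Ob])
    show "class_triangulated C A \<in> carrier (K0_triangulated C)" if "A \<in> Ob C" for A
      unfolding K0_triangulated_def class_triangulated_def by (rule K0_class_closed[OF triangles_Ob that])
    show "class_triangulated C A = class_triangulated C B" if "iso_class C A = iso_class C B" for A B
      by (simp add: class_triangulated_def K0_class_def that)
    show "class_triangulated C A \<otimes>\<^bsub>K0_triangulated C\<^esub> class_triangulated C D = class_triangulated C B"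
      if "(A, B, D) \<in> conflations_R C \<N>" for A B D
      unfolding K0_triangulated_def class_triangulated_def
      using K0_class_relation[OF triangles_Ob] that conflations_R_triangles by blast
  qed
  then show ?thesis by (simp add: K0_R_def class_R_def)
qed

lemma class_R_theta_gen:
  assumes "A \<in> Ob C"
  shows "class_R C \<N> A \<otimes>\<^bsub>K0_R C \<N>\<^esub> class_R C \<N> (unshO C A) = Rel #>\<^bsub>K0_free C\<^esub> theta_gen A"
  unfolding class_R_def K0_R_def K0_class_def theta_gen_def
  by (rule coset_add[OF conflations_R_Ob gen_closed[OF assms] gen_closed[OF unshO_Ob[OF assms]], symmetric])

lemma theta_exists:
  "\<exists>\<theta> \<in> hom (K0_abelian L) (K0_R C \<N>).
    \<forall>A \<in> Ob C. \<theta> (class_abelian L A) = Rel #>\<^bsub>K0_free C\<^esub> theta_gen A"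
proof -
  interpret L: category L by (rule category_L)
  have "\<exists>h \<in> hom (K0 L (short_exact_sequences L)) (K0_R C \<N>).
      \<forall>A \<in> Ob L. h (K0_class L (short_exact_sequences L) A) = Rel #>\<^bsub>K0_free C\<^esub> theta_gen A"
  proof (rule K0_universal[OF short_exact_sequences_Ob])
    show "comm_group (K0_R C \<N>)"
      unfolding K0_R_def by (rule comm_group_K0[OF conflations_R_Ob])
    show "Rel #>\<^bsub>K0_free C\<^esub> theta_gen A \<in> carrier (K0_R C \<N>)" if "A \<in> Ob L" for A
      unfolding K0_R_def carrier_K0[OF conflations_R_Ob] using that theta_gen_closed by simp
    show "Rel #>\<^bsub>K0_free C\<^esub> theta_gen A = Rel #>\<^bsub>K0_free C\<^esub> theta_gen B"
      if "A \<in> Ob L" "B \<in> Ob L" "iso_class L A = iso_class L B" for A B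
      unfolding coset_eq_iff[OF conflations_R_Ob] using theta_gen_iso_L that by simp
    show "(Rel #>\<^bsub>K0_free C\<^esub> theta_gen A) \<otimes>\<^bsub>K0_R C \<N>\<^esub> (Rel #>\<^bsub>K0_free C\<^esub> theta_gen D) = Rel #>\<^bsub>K0_free C\<^esub> theta_gen B"
      if ses: "(A, B, D) \<in> short_exact_sequences L" for A B D
    proof -
      obtain k g where k: "is_kernel L k g" "is_cokernel L g k" and ABD: "A = Dom L k" "B = Cod L k" "D = Cod L g"
        using ses by (auto simp: short_exact_sequences_def)
      have kH: "k \<in> Hom L A B" and gH: "g \<in> Hom L B D"
        using k(1) unfolding is_kernel_def by (auto simp: ABD intro: HomI)
      have "A \<in> Ob C" "D \<in> Ob C" using L.Hom_Ob[OF kH] L.Hom_Ob[OF gH] by simp_all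
      then show ?thesis
        unfolding K0_R_def
        by (intro coset_mult_eqI[OF conflations_R_Ob] theta_gen_closed theta_gen_short_exact_L[OF k kH gH])
    qed
  qed
  then show ?thesis by (simp add: K0_abelian_def class_abelian_def)
qed

text \<open>Exactness at \<open>K0_R\<close>: a class killed by \<open>\<pi>\<close> is represented by an element of \<open>Rel_tri\<close>, and the
  elements of the free group whose class lies in the image of \<open>\<theta>\<close> form a subgroup containing the
  relation of every triangle.\<close>

lemma exact_sequence:
  assumes \<pi>: "\<pi> \<in> hom (K0_R C \<N>) (K0_triangulated C)"
    and \<pi>_class: "\<And>A. A \<in> Ob C \<Longrightarrow> \<pi> (class_R C \<N> A) = class_triangulated C A"
    and \<theta>: "\<theta> \<in> hom (K0_abelian L) (K0_R C \<N>)"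
    and \<theta>_class: "\<And>A. A \<in> Ob C \<Longrightarrow> \<theta> (class_abelian L A) = Rel #>\<^bsub>K0_free C\<^esub> theta_gen A"
  shows "exact_seq
      ([singleton_group \<one>\<^bsub>K0_triangulated C\<^esub>, K0_triangulated C, K0_R C \<N>, K0_abelian L],
       [\<lambda>_. \<one>\<^bsub>K0_triangulated C\<^esub>, \<pi>, \<theta>])"
proof -
  let ?T = "K0_triangulated C" and ?R = "K0_R C \<N>" and ?A = "K0_abelian L"
  let ?q = "\<lambda>x. Rel #>\<^bsub>K0_free C\<^esub> x" and ?qT = "\<lambda>x. Rel_tri #>\<^bsub>K0_free C\<^esub> x"
  have T: "Group.group ?T" and R: "Group.group ?R" and A: "Group.group ?A"
    unfolding K0_triangulated_def K0_R_def K0_abelian_def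
    using comm_group_K0[OF triangles_Ob] comm_group_K0[OF conflations_R_Ob]
      comm_group_K0[OF short_exact_sequences_Ob] by (auto dest: comm_group.axioms(2))
  interpret \<theta>: group_hom ?A ?R \<theta> using A R \<theta> by (simp add: group_hom_def group_hom_axioms_def)
  interpret \<pi>: group_hom ?R ?T \<pi> using R T \<pi> by (simp add: group_hom_def group_hom_axioms_def)
  have q: "?q \<in> hom (K0_free C) ?R" unfolding K0_R_def by (rule coset_hom[OF conflations_R_Ob])
  have qT: "?qT \<in> hom (K0_free C) ?T" unfolding K0_triangulated_def by (rule coset_hom[OF triangles_Ob])
  interpret q: group_hom "K0_free C" ?R ?q
    using group_K0_free R q by (simp add: group_hom_def group_hom_axioms_def)
  have carrier_R: "carrier ?R = ?q ` carrier (K0_free C)"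
    unfolding K0_R_def by (rule carrier_K0[OF conflations_R_Ob])
  have carrier_T: "carrier ?T = ?qT ` carrier (K0_free C)"
    unfolding K0_triangulated_def by (rule carrier_K0[OF triangles_Ob])
  have \<pi>_q: "\<pi> (?q x) = ?qT x" if x: "x \<in> carrier (K0_free C)" for x
  proof -
    have "(\<pi> \<circ> ?q) (gen C A) = ?qT (gen C A)" if "A \<in> Ob C" for A
      using \<pi>_class[OF that] by (simp add: class_R_def class_triangulated_def K0_class_def)
    from K0_free_hom_eq[OF T hom_compose[OF q \<pi>] qT this x] show ?thesis by simp
  qed
  have qT_one: "?qT x = \<one>\<^bsub>?T\<^esub> \<longleftrightarrow> x \<in> Rel_tri" for x
    unfolding K0_triangulated_def by (rule coset_eq_one_iff[OF triangles_Ob])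
  have surj: "\<pi> ` carrier ?R = carrier ?T"
    unfolding carrier_R carrier_T image_image using \<pi>_q by (auto simp: image_iff)
  have image_in_kernel: "\<theta> y \<in> kernel ?R ?T \<pi>" if y: "y \<in> carrier ?A" for y
  proof -
    have \<pi>\<theta>: "\<pi> \<circ> \<theta> \<in> hom (K0 L (short_exact_sequences L)) ?T"
      using hom_compose[OF \<theta> \<pi>] by (simp add: K0_abelian_def)
    have trivial: "(\<lambda>_. \<one>\<^bsub>?T\<^esub>) \<in> hom (K0 L (short_exact_sequences L)) ?T"
      using \<pi>.H.one_closed by (auto simp: hom_def)
    have gens: "(\<pi> \<circ> \<theta>) (K0_class L (short_exact_sequences L) B) = \<one>\<^bsub>?T\<^esub>" if "B \<in> Ob L" for B
    proof -
      have B: "B \<in> Ob C" using that by simp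
      show ?thesis
        using \<theta>_class[OF B] \<pi>_q[OF theta_gen_closed[OF B]] qT_one theta_gen_Rel_tri[OF B]
        by (simp add: class_abelian_def)
    qed
    have "(\<pi> \<circ> \<theta>) y = \<one>\<^bsub>?T\<^esub>"
      using K0_hom_eq[OF short_exact_sequences_Ob T \<pi>\<theta> trivial gens] y by (simp add: K0_abelian_def)
    then show ?thesis using \<theta>.hom_closed[OF y] by (simp add: kernel_def)
  qed
  have kernel_in_image: "y \<in> \<theta> ` carrier ?A" if "y \<in> kernel ?R ?T \<pi>" for y
  proof -
    have "Rel_tri \<subseteq> {x \<in> carrier (K0_free C). ?q x \<in> \<theta> ` carrier ?A}" (is "_ \<subseteq> ?J")
      unfolding K0_relations_def[of C "triangles C"]
    proof (rule q.G.generate_subgroup_incl)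
      have J: "subgroup (\<theta> ` carrier ?A) ?R" by (rule \<theta>.img_is_subgroup)
      show "subgroup ?J (K0_free C)"
      proof
        show "?J \<subseteq> carrier (K0_free C)" by blast
        show "x \<otimes>\<^bsub>K0_free C\<^esub> y \<in> ?J" if "x \<in> ?J" "y \<in> ?J" for x y
          using that q.hom_mult subgroup.m_closed[OF J] by simp
        show "\<one>\<^bsub>K0_free C\<^esub> \<in> ?J" using q.hom_one subgroup.one_closed[OF J] by simp
        show "inv\<^bsub>K0_free C\<^esub> x \<in> ?J" if "x \<in> ?J" for x
          using that q.hom_inv subgroup.m_inv_closed[OF J] by simp
      qed
      show "{gen C A - gen C B + gen C D |A B D. (A, B, D) \<in> triangles C} \<subseteq> ?J"
      proof safe
        fix A B D assume ABD: "(A, B, D) \<in> triangles C"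
        let ?r = "gen C A - gen C B + gen C D"
        obtain f g h where "tri f g h A B D"
          using ABD Tri_tri unfolding triangles_def by blast
        then obtain I where I: "I \<in> Ob C" "theta_gen I - ?r \<in> Rel" by (rule triangle_relation_eq_theta_gen)
        show "?r \<in> carrier (K0_free C)" using K0_relators_closed[OF triangles_Ob] ABD by blast
        have "\<theta> (class_abelian L I) = ?q ?r"
          using \<theta>_class[OF I(1)] I(2) coset_eq_iff[OF conflations_R_Ob] by simp
        moreover have "class_abelian L I \<in> carrier ?A"
          unfolding class_abelian_def K0_abelian_def
          by (rule K0_class_closed[OF short_exact_sequences_Ob]) (simp add: I(1))
        ultimately show "?q ?r \<in> \<theta> ` carrier ?A" by (metis imageI)
      qed
    qed
    moreover obtain x where x: "x \<in> carrier (K0_free C)" "y = ?q x" and "\<pi> y = \<one>\<^bsub>?T\<^esub>"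
      using \<open>y \<in> kernel ?R ?T \<pi>\<close> carrier_R by (auto simp: kernel_def)
    moreover have "x \<in> Rel_tri" using calculation(4) \<pi>_q[OF x(1)] qT_one x(2) by simp
    ultimately show ?thesis by blast
  qed
  have ker: "kernel ?R ?T \<pi> = \<theta> ` carrier ?A" using image_in_kernel kernel_in_image by blast
  have "kernel ?T (singleton_group \<one>\<^bsub>?T\<^esub>) (\<lambda>_. \<one>\<^bsub>?T\<^esub>) = \<pi> ` carrier ?R"
    unfolding surj by (simp add: kernel_def singleton_group_def)
  moreover have "(\<lambda>_. \<one>\<^bsub>?T\<^esub>) \<in> hom ?T (singleton_group \<one>\<^bsub>?T\<^esub>)"
    using \<pi>.H.hom_into_singleton_iff by simp
  ultimately show ?thesis
    by (intro exact_seq.extension exact_seq.unity) (use T \<pi> ker \<theta>.group_hom_axioms in auto)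
qed

end

theorem propositionE:
  fixes C :: "('o, 'm, 'x) tricat_scheme" and \<X> \<N> :: "'o set"
  assumes "triangulated_category C"
    and "idempotent_complete C"
    and "additive_subcategory C \<X>"
    and "contravariantly_finite C \<X>"
    and "rigid C \<X>"
    and "summand_closed C \<X>"
    and "\<N> = perp0 C \<X>"
  shows "\<exists>\<theta> \<pi>.
    (\<forall>A \<in> Ob C. \<theta> (class_abelian (quotient_category C \<N>) (Q_ob C \<N> A))
        = class_R C \<N> A \<otimes>\<^bsub>K0_R C \<N>\<^esub> class_R C \<N> (unshO C A)) \<and>
    (\<forall>A \<in> Ob C. \<pi> (class_R C \<N> A) = class_triangulated C A) \<and>
    exact_seq
      ([singleton_group \<one>\<^bsub>K0_triangulated C\<^esub>, K0_triangulated C, K0_R C \<N>,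
        K0_abelian (quotient_category C \<N>)],
       [\<lambda>_. \<one>\<^bsub>K0_triangulated C\<^esub>, \<pi>, \<theta>])"
proof -
  interpret rigid_subcategory C \<X> \<N>
    using assms by (simp add: rigid_subcategory_def rigid_subcategory_axioms_def)
  obtain \<theta> where \<theta>: "\<theta> \<in> hom (K0_abelian L) (K0_R C \<N>)"
    "\<And>A. A \<in> Ob C \<Longrightarrow> \<theta> (class_abelian L A) = Rel #>\<^bsub>K0_free C\<^esub> theta_gen A"
    using theta_exists by blast
  obtain \<pi> where \<pi>: "\<pi> \<in> hom (K0_R C \<N>) (K0_triangulated C)"
    "\<And>A. A \<in> Ob C \<Longrightarrow> \<pi> (class_R C \<N> A) = class_triangulated C A"
    using pi_exists by blast
  show ?thesis
  proof (intro exI conjI ballI)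
    show "\<theta> (class_abelian (quotient_category C \<N>) (Q_ob C \<N> A))
        = class_R C \<N> A \<otimes>\<^bsub>K0_R C \<N>\<^esub> class_R C \<N> (unshO C A)" if "A \<in> Ob C" for A
      using \<theta>(2)[OF that] class_R_theta_gen[OF that] by (simp add: Q_ob_def)
    show "\<pi> (class_R C \<N> A) = class_triangulated C A" if "A \<in> Ob C" for A by (rule \<pi>(2)[OF that])
    show "exact_seq
      ([singleton_group \<one>\<^bsub>K0_triangulated C\<^esub>, K0_triangulated C, K0_R C \<N>,
        K0_abelian (quotient_category C \<N>)],
       [\<lambda>_. \<one>\<^bsub>K0_triangulated C\<^esub>, \<pi>, \<theta>])"
      by (rule exact_sequence[OF \<pi> \<theta>])
  qed
qed

end
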